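(* Let $k\ge 3$ be an integer and $n$ an integer with $n-\frac{k+1}{12}>0$. Then $\Delta_k(n)=M_k(n)+R_k(n)$, where $M_k(n):=\frac{\pi^3\alpha_k}{18\,x_k(n)^2}\,I_2\big(\sqrt{\alpha_k}\,x_k(n)\big)$ and the remainder satisfies $$|R_k(n)|\le 12k^3e^{\pi\sqrt{k/3}}\,x_k(n)^{-3/2}\exp\big(\sqrt{\beta_k}\,x_k(n)\big).$$
   Context: For an integer $k\ge1$, $\Delta_k(n)$ is defined by $\sum_{n\ge0}\Delta_k(n)q^n=\prod_{m\ge1}\frac{(1-q^{2m})(1-q^{(2k+1)m})}{(1-q^m)^3(1-q^{(4k+2)m})}$. Set $x_k(n):=\frac{\pi\sqrt{24n-(2k+2)}}{6}$, $\alpha_k:=\frac{5k+2}{2k+1}$, $\beta_k:=\frac{5k-10}{2k+1}$. $I_2$ is the modified Bessel function of the first kind of order $2$. *)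

theory Defs
  imports "HOL-Analysis.Analysis" "HOL-Computational_Algebra.Formal_Power_Series"
begin

definition Delta_factor :: "nat \<Rightarrow> nat \<Rightarrow> real fps" where
  "Delta_factor k m =
     (1 - fps_X ^ (2*m)) * (1 - fps_X ^ ((2*k+1)*m)) *
     inverse ((1 - fps_X ^ m) ^ 3 * (1 - fps_X ^ ((4*k+2)*m)))"

text \<open>Coefficient of q^n in the infinite product. Factors with m > n are
  congruent to 1 modulo q^(n+1), so truncating the product at m = n gives
  exactly the n-th coefficient of the infinite product.\<close>
definition Delta :: "nat \<Rightarrow> nat \<Rightarrow> real" where
  "Delta k n = fps_nth (\<Prod>m\<in>{1..n}. Delta_factor k m) n"

definition xk :: "nat \<Rightarrow> nat \<Rightarrow> real" where
  "xk k n = pi * sqrt (24 * real n - (2 * real k + 2)) / 6"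

definition alpha_k :: "nat \<Rightarrow> real" where
  "alpha_k k = (5 * real k + 2) / (2 * real k + 1)"

definition beta_k :: "nat \<Rightarrow> real" where
  "beta_k k = (5 * real k - 10) / (2 * real k + 1)"

definition Bessel_I2 :: "real \<Rightarrow> real" where
  "Bessel_I2 x = (\<Sum>j. (x / 2) ^ (2 * j + 2) / (fact j * fact (j + 2)))"

definition Mk :: "nat \<Rightarrow> nat \<Rightarrow> real" where
  "Mk k n = pi ^ 3 * alpha_k k / (18 * (xk k n)^2) * Bessel_I2 (sqrt (alpha_k k) * xk k n)"

end

theory Submission
  imports Defs "HOL-Complex_Analysis.Complex_Analysis" "HOL-Real_Asymp.Real_Asymp"
begin

text \<open>
  The generating function is an eta quotient of weight \<open>-1\<close>.  Writing \<open>q = exp (-2\<pi>z)\<close> with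
  \<open>z = \<rho> + it\<close>, the coefficient is an integral over \<open>|t| \<le> 1/2\<close>, and the inversion \<open>z \<mapsto> 1/z\<close> of the eta
  function turns the generating function into \<open>z exp (\<pi>\<alpha>/(12z))\<close> times a power series \<open>1 + Q + \<dots>\<close> in
  \<open>Q = exp (-2\<pi>/((4k+2)z))\<close>.  Replacing the series by \<open>1\<close> and closing the contour around \<open>0\<close> gives the Bessel
  function exactly; the next term lowers \<open>\<alpha>\<close> to \<open>\<beta>\<close>, which is where the error exponent comes from.
  With \<open>\<rho>\<close> the saddle point belonging to \<open>\<beta>\<close>, the expansion is used for \<open>|t| \<le> \<surd>3 \<rho>\<close>.  For larger \<open>|t|\<close> the
  same inversion followed by trivial estimates of the Euler products suffices: it bounds the logarithm of the
  integrand by a function of \<open>(\<rho>\<^sup>2 + t\<^sup>2)/\<rho>\<close> that is largest at the end points, where it is about a quarter of its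
  value at \<open>t = 0\<close>, and \<open>\<alpha>/4 < \<beta>\<close>; no other cusps are needed.  If \<open>x\<^sub>k(n) \<le> 3k/2\<close>, the trivial bound for a
  coefficient of a power series is already good enough.
\<close>

section \<open>The eta transformation on the positive real axis\<close>

text \<open>The circle of radius 2\<rho> around 0 meets the line Re z = \<rho> at the heights +-sqrt
  3 \<rho>; hence the cut at sqrt 3 \<rho>. On the part of the circle that is left over, Re(1/z) has
  a quarter of its value at z = \<rho>, so this part costs \<alpha>/4 where the saddle point allows
  \<beta>. For integers, \<alpha> <= 4\<beta> means 15k >= 42, that is k >= 3. The threshold 3k/2
  has this origin: |Q| <= 1/2 at the ends of the segment forces \<rho> to be at most of order 1/k,
  and as the saddle point is pi sqrt \<beta>/(6x), x must be at least of order k. For smaller x the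
  trivial bounds have an exponent r x whose r^2 differs from \<beta> by O(1/k), so r x exceeds sqrt
  \<beta> x by a bounded amount only. What stays unbounded is the shift from n - (k+1)/12 to n,
  which adds O(sqrt k) to the exponent; the factor exp(pi sqrt(k/3)) absorbs it. The eta inversion
  is obtained for real z from a double series of positive terms that diverges logarithmically;
  analytic continuation gives the rest of the half-plane.\<close>

lemma coth_partial_fractions:
  fixes x :: real
  assumes x: "x > 0"
  shows "(\<lambda>m. x / (x\<^sup>2 + (real (Suc m))\<^sup>2)) sums (pi / 2 + pi / (exp (2 * pi * x) - 1) - 1 / (2 * x))"
proof -
  define f :: "nat \<Rightarrow> complex \<Rightarrow> complex" where "f = (\<lambda>k z. 1 - z\<^sup>2 / of_nat (Suc k) ^ 2)"
  \<comment> \<open>The removable singularity at 0 is filled in, so that P is the limit of the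
    products on the whole disc.\<close>
  define P :: "complex \<Rightarrow> complex" where "P = (\<lambda>z. if z = 0 then 1 else sin (of_real pi * z) / (of_real pi * z))"
  define A :: "complex set" where "A = ball 0 (x + 1)"
  define z0 where "z0 = \<i> * of_real x"
  have z0: "z0 \<in> A" "z0 \<noteq> 0" using x by (auto simp: z0_def A_def norm_mult)
  have lim: "(\<lambda>n. \<Prod>k<n. f k z) \<longlonglongrightarrow> P z" for z
  proof (cases "z = 0")
    case True then show ?thesis by (simp add: f_def P_def)
  next
    case False
    have "(\<lambda>n. (of_real pi * z * (\<Prod>k=1..n. 1 - z^2 / of_nat k^2)) / (of_real pi * z)) \<longlonglongrightarrow> P z"
      using tendsto_divide[OF sin_product_formula_complex[of z] tendsto_const[of "of_real pi * z"]] False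
      by (simp add: P_def)
    also have "(\<lambda>n. (of_real pi * z * (\<Prod>k=1..n. 1 - z^2 / of_nat k^2)) / (of_real pi * z)) = (\<lambda>n. \<Prod>k<n. f k z)"
    proof
      fix n
      have "(\<Prod>k=1..n. 1 - z^2 / of_nat k^2) = (\<Prod>k<n. f k z)"
        unfolding f_def using prod.atLeast1_atMost_eq[of "\<lambda>k. 1 - z^2 / of_nat k^2" n] by simp
      then show "(of_real pi * z * (\<Prod>k=1..n. 1 - z^2 / of_nat k^2)) / (of_real pi * z) = (\<Prod>k<n. f k z)"
        using False by simp
    qed
    finally show ?thesis .
  qed
  have uc: "uniformly_convergent_on (cball 0 (x+1)) (\<lambda>N z. \<Prod>n<N. f n z)"
  proof (rule uniformly_convergent_on_prod')
    show "continuous_on (cball 0 (x+1)) (f n)" for n unfolding f_def by (intro continuous_intros) (metis of_nat_eq_0_iff nat.distinct(1) power_eq_0_iff)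
    show "uniformly_convergent_on (cball 0 (x + 1)) (\<lambda>N z. \<Sum>n<N. norm (f n z - 1))"
    proof (rule Weierstrass_m_test')
      show "summable (\<lambda>n. (x+1)^2 * (1 / (real n + 1)^2))"
        using inverse_squares_sums by (intro summable_mult) (simp add: sums_iff add.commute)
      fix n :: nat and z :: complex assume "z \<in> cball 0 (x+1)"
      then have "norm z ^ 2 \<le> (x+1)^2" by (intro power_mono) auto
      then have "norm z ^ 2 / (real n + 1)\<^sup>2 \<le> (x+1)^2 / (real n + 1)\<^sup>2" by (intro divide_right_mono) auto
      moreover have "norm (1 + of_nat n :: complex) = 1 + real n"
        by (metis norm_of_nat of_nat_Suc)
      ultimately show "norm (norm (f n z - 1)) \<le> (x+1)^2 * (1 / (real n + 1)^2)"
        by (simp add: f_def norm_divide norm_power add.commute)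
    qed
  qed auto
  have ul: "uniform_limit A (\<lambda>n z. \<Prod>k<n. f k z) P sequentially"
  proof -
    obtain l where l: "uniform_limit (cball 0 (x+1)) (\<lambda>n z. \<Prod>k<n. f k z) l sequentially"
      using uc by (auto simp: uniformly_convergent_on_def)
    have "l z = P z" if "z \<in> A" for z
      using tendsto_uniform_limitI[OF l, of z] lim[of z] that LIMSEQ_unique by (auto simp: A_def)
    moreover have "uniform_limit A (\<lambda>n z. \<Prod>k<n. f k z) l sequentially"
      by (rule uniform_limit_on_subset[OF l]) (auto simp: A_def)
    ultimately show ?thesis by (metis (mono_tags, lifting) uniform_limit_cong')
  qed
  have sh: "sinh (pi * x) > 0" using x by simp
  have sin: "sin (of_real pi * z0) = \<i> * of_real (sinh (pi * x))"
    and cos: "cos (of_real pi * z0) = of_real (cosh (pi * x))"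
  proof -
    have e: "exp (of_real pi * of_real x) = complex_of_real (exp (pi * x))"
      by (metis exp_of_real of_real_mult)
    have "sin (\<i> * of_real (pi*x)) = \<i> * sinh (of_real (pi * x))"
      by (simp add: sinh_conv_sin)
    then show "sin (of_real pi * z0) = \<i> * of_real (sinh (pi * x))"
      by (simp add: z0_def mult_ac sinh_field_def e exp_minus)
    have "cos (\<i> * of_real (pi*x)) = cosh (of_real (pi * x))"
      by (simp add: cosh_conv_cos)
    then show "cos (of_real pi * z0) = of_real (cosh (pi * x))"
      by (simp add: z0_def mult_ac cosh_field_def e exp_minus)
  qed
  have Pnz: "P z0 \<noteq> 0" using sh z0 sin x by (simp add: P_def)
  \<comment> \<open>Logarithmic differentiation of Euler's sine product at the imaginary point i x:
    the factors become 1 + x^2/m^2, and the quotient of cos and sin becomes a hyperbolic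
    cotangent.\<close>
  have "(\<lambda>k. deriv (f k) z0 / f k z0) sums (deriv P z0 / P z0)"
    by (rule logderiv_prodinf_complex_uniform_limit[OF ul _ Pnz])
       (use x in \<open>auto simp: f_def A_def z0_def norm_mult intro!: holomorphic_intros\<close>)
  also have "(\<lambda>k. deriv (f k) z0 / f k z0) = (\<lambda>k. - \<i> * of_real (2 * (x / (x\<^sup>2 + (real (Suc k))\<^sup>2))))"
  proof
    fix k
    have d: "deriv (f k) z0 = - 2 * z0 / of_nat (Suc k) ^ 2"
    proof -
      have nz: "of_nat (Suc k) \<noteq> (0::complex)" by (metis of_nat_eq_0_iff nat.distinct(1))
      show ?thesis unfolding f_def
        by (rule DERIV_imp_deriv) (use nz in \<open>auto intro!: derivative_eq_intros simp: power2_eq_square simp del: of_nat_Suc\<close>)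
    qed
    have f: "f k z0 = of_real ((x\<^sup>2 + (real (Suc k))\<^sup>2) / real (Suc k)^2)"
      by (simp add: f_def z0_def power_mult_distrib field_simps del: of_nat_Suc)
    have "of_real (x\<^sup>2 + (real (Suc k))\<^sup>2) \<noteq> (0::complex)"
      by (metis of_real_eq_0_iff add_pos_pos less_irrefl of_nat_0_less_iff zero_less_Suc zero_less_power x)
    then show "deriv (f k) z0 / f k z0 = - \<i> * of_real (2 * (x / (x\<^sup>2 + (real (Suc k))\<^sup>2)))"
      unfolding d f unfolding z0_def by (simp add: field_simps del: of_nat_Suc)
  qed
  also have "deriv P z0 / P z0 = - \<i> * of_real (pi * cosh (pi*x) / sinh (pi*x) - 1 / x)"
  proof -
    have "((\<lambda>z. sin (of_real pi * z) / (of_real pi * z)) has_field_derivative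
        (cos (of_real pi * z0) * of_real pi * (of_real pi * z0) - sin (of_real pi * z0) * of_real pi) / (of_real pi * z0)^2) (at z0)"
      using z0 by (auto intro!: derivative_eq_intros simp: power2_eq_square)
    then have "(P has_field_derivative
        (cos (of_real pi * z0) * of_real pi * (of_real pi * z0) - sin (of_real pi * z0) * of_real pi) / (of_real pi * z0)^2) (at z0)"
      by (rule has_field_derivative_transform_within_open[where S = "-{0}"]) (use z0 in \<open>auto simp: P_def\<close>)
    then have "deriv P z0 = (cos (of_real pi * z0) * of_real pi * (of_real pi * z0) - sin (of_real pi * z0) * of_real pi) / (of_real pi * z0)^2"
      by (rule DERIV_imp_deriv)
    have "P z0 = sin (of_real pi * z0) / (of_real pi * z0)" using z0 by (simp add: P_def)
    have nz: "complex_of_real (sinh (pi*x)) \<noteq> 0" "complex_of_real x \<noteq> 0" using sh x by auto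
    show ?thesis unfolding \<open>deriv P z0 = _\<close> \<open>P z0 = _\<close> unfolding sin cos using nz
      by (simp add: z0_def field_simps power2_eq_square)
  qed
  finally have "(\<lambda>k. \<i> * (- \<i> * of_real (2 * (x / (x\<^sup>2 + (real (Suc k))\<^sup>2))))) sums
      (\<i> * (- \<i> * of_real (pi * cosh (pi*x) / sinh (pi*x) - 1 / x)))"
    by (rule sums_mult)
  then have "(\<lambda>k. complex_of_real (2 * (x / (x\<^sup>2 + (real (Suc k))\<^sup>2)))) sums
      of_real (pi * cosh (pi*x) / sinh (pi*x) - 1 / x)"
    by (simp add: mult.assoc[symmetric] del: of_real_mult of_real_diff of_real_divide of_real_add of_real_power of_nat_Suc)
  then have "(\<lambda>k. 2 * (x / (x\<^sup>2 + (real (Suc k))\<^sup>2))) sums (pi * cosh (pi*x) / sinh (pi*x) - 1 / x)"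
    by (simp only: sums_of_real_iff)
  then have "(\<lambda>k. x / (x\<^sup>2 + (real (Suc k))\<^sup>2)) sums ((pi * cosh (pi*x) / sinh (pi*x) - 1 / x) / 2)"
    using sums_divide[of "\<lambda>k. 2 * (x / (x\<^sup>2 + (real (Suc k))\<^sup>2))" _ 2]
    by (simp only: nonzero_mult_div_cancel_left zero_neq_numeral not_False_eq_True)
  \<comment> \<open>coth(pi x) is split as 1 + 2/(exp(2 pi x) - 1), because the second part becomes
    a term of the Lambert series.\<close>
  moreover have "(pi * cosh (pi*x) / sinh (pi*x) - 1 / x) / 2 = pi / 2 + pi / (exp (2 * pi * x) - 1) - 1 / (2 * x)"
  proof -
    have e: "exp (2 * pi * x) = exp (pi*x)^2" by (simp add: power2_eq_square flip: exp_add)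
    have g: "exp (pi*x) > 1" using x by simp
    have 1: "cosh (pi*x) / sinh (pi*x) = (exp (pi*x)^2 + 1) / (exp (pi*x)^2 - 1)"
      using g by (simp add: cosh_field_def sinh_field_def exp_minus divide_simps power2_eq_square)
    have ne: "exp (pi*x)^2 - 1 > 0" using g by (simp add: power_strict_increasing one_less_power)
    have "cosh (pi*x) / sinh (pi*x) = 1 + 2 / (exp (pi*x)^2 - 1)"
      unfolding 1 using ne by (simp add: divide_simps)
    then have "pi * cosh (pi*x) / sinh (pi*x) = pi + 2 * (pi / (exp (2 * pi * x) - 1))"
      unfolding e by (metis (no_types, opaque_lifting) distrib_left mult.commute mult.right_neutral times_divide_eq_right)
    then show ?thesis by (simp add: field_simps)
  qed
  ultimately show ?thesis by simp
qed

section \<open>The Lambert series of -ln of the Euler product, and its symmetric kernel\<close>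

definition lambert :: "real \<Rightarrow> nat \<Rightarrow> real" where
  "lambert z l = 1 / (real (Suc l) * (exp (2 * pi * real (Suc l) * z) - 1))"

text \<open>The partial fractions of coth at L z with L = l+1, divided by pi L. For z > 0 the terms
  are positive and invariant under z -> 1/z with l and m exchanged, but their double sum
  diverges.\<close>

definition eisenstein_kernel :: "real \<Rightarrow> nat \<Rightarrow> nat \<Rightarrow> real" where
  "eisenstein_kernel z l m = z / (pi * ((real (Suc l) * z)\<^sup>2 + (real (Suc m))\<^sup>2))"

lemma eisenstein_kernel_swap:
  "z > 0 \<Longrightarrow> eisenstein_kernel (1 / z) m l = eisenstein_kernel z l m"
  unfolding eisenstein_kernel_def by (simp add: divide_simps) (simp add: algebra_simps power2_eq_square)

text \<open>Of the three parts of a row sum the first is the wanted one, the second is harmonic and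
  causes the divergence, the third adds up to pi/(12 z).\<close>

lemma eisenstein_kernel_sums:
  assumes z: "z > 0"
  shows "eisenstein_kernel z l sums
    (lambert z l + 1 / (2 * real (Suc l)) - 1 / (2 * pi * z) * (1 / (real (Suc l))\<^sup>2))"
proof -
  define L where "L = real (Suc l)"
  have L: "L > 0" by (simp add: L_def)
  have "(\<lambda>m. (L * z) / ((L * z)\<^sup>2 + (real (Suc m))\<^sup>2) * (1 / (pi * L))) sums
     ((pi / 2 + pi / (exp (2 * pi * (L * z)) - 1) - 1 / (2 * (L * z))) * (1 / (pi * L)))"
    using z L by (intro sums_mult2 coth_partial_fractions) simp
  also have "(\<lambda>m. (L * z) / ((L * z)\<^sup>2 + (real (Suc m))\<^sup>2) * (1 / (pi * L))) = eisenstein_kernel z l"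
    using L by (simp add: eisenstein_kernel_def fun_eq_iff L_def[symmetric] del: of_nat_Suc)
  also have "(pi / 2 + pi / (exp (2 * pi * (L * z)) - 1) - 1 / (2 * (L * z))) * (1 / (pi * L)) =
     lambert z l + 1 / (2 * L) - 1 / (2 * pi * z) * (1 / L\<^sup>2)"
  proof -
    define E where "E = exp (2 * pi * L * z)"
    have E: "E > 1" using L z by (simp add: E_def)
    have l: "lambert z l = 1 / (L * (E - 1))" by (simp add: lambert_def E_def L_def)
    have "exp (2 * pi * (L * z)) = E" by (simp add: E_def mult.assoc)
    then show ?thesis unfolding l using E z L
      by (simp add: left_diff_distrib distrib_right power2_eq_square add_divide_distrib diff_divide_distrib mult.commute mult.left_commute)
  qed
  finally show ?thesis by (simp add: L_def)
qed


text \<open>The kernel decreases in l, so the part of a column from row L on lies between two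
  integrals of the kernel, whose primitive is an arctan. These tails are what separates the two
  orders of summation.\<close>

lemma eisenstein_tail_le:
  assumes z: "z > 0" and L: "L > 0"
  shows "(\<Sum>l. eisenstein_kernel z (l + L) m) \<le> arctan (real (Suc m) / (real L * z)) / (pi * real (Suc m))"
    and "arctan (real (Suc m) / (real (Suc L) * z)) / (pi * real (Suc m)) \<le> (\<Sum>l. eisenstein_kernel z (l + L) m)"
proof -
  define M where "M = real (Suc m)"
  have M: "M > 0" by (simp add: M_def)
  define G where "G = (\<lambda>x. arctan (x * z / M) / (pi * M))"
  have G': "(G has_real_derivative z / (pi * ((x * z)\<^sup>2 + M\<^sup>2))) (at x)" for x
  proof -
    have "M * M * (1 + (x*z/M)^2) = (x*z)^2 + M^2" using M by (simp add: field_simps power2_eq_square)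
    moreover have "(G has_real_derivative z / (pi * (M * M * (1 + (x*z/M)^2)))) (at x)"
      unfolding G_def using M by (auto intro!: derivative_eq_intros simp: divide_simps)
    ultimately show ?thesis by simp
  qed
  have bnd: "G (real (Suc l)) - G (real l) \<ge> eisenstein_kernel z l m"
     "G (real (Suc (Suc l))) - G (real (Suc l)) \<le> eisenstein_kernel z l m" for l
  proof -
    obtain \<xi> where xi: "real l < \<xi>" "\<xi> < real (Suc l)" "G (real (Suc l)) - G (real l) = (real (Suc l) - real l) * (z / (pi * ((\<xi> * z)\<^sup>2 + M\<^sup>2)))"
      using MVT2[of "real l" "real (Suc l)" G "\<lambda>x. z / (pi * ((x * z)\<^sup>2 + M\<^sup>2))"] G' by auto
    have "(\<xi> * z)^2 \<le> (real (Suc l) * z)^2" using xi z by (intro power_mono mult_right_mono) auto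
    then show "G (real (Suc l)) - G (real l) \<ge> eisenstein_kernel z l m"
      unfolding xi(3) eisenstein_kernel_def M_def[symmetric] using z M
      by (auto intro!: divide_left_mono mult_left_mono mult_pos_pos add_nonneg_pos)
    obtain \<xi> where xi: "real (Suc l) < \<xi>" "\<xi> < real (Suc (Suc l))" "G (real (Suc (Suc l))) - G (real (Suc l)) = (real (Suc (Suc l)) - real (Suc l)) * (z / (pi * ((\<xi> * z)\<^sup>2 + M\<^sup>2)))"
      using MVT2[of "real (Suc l)" "real (Suc (Suc l))" G "\<lambda>x. z / (pi * ((x * z)\<^sup>2 + M\<^sup>2))"] G' by auto
    have "(\<xi> * z)^2 \<ge> (real (Suc l) * z)^2" using xi z by (intro power_mono mult_right_mono) auto
    then show "G (real (Suc (Suc l))) - G (real (Suc l)) \<le> eisenstein_kernel z l m"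
      unfolding xi(3) eisenstein_kernel_def M_def[symmetric] using z M
      by (auto intro!: divide_left_mono mult_left_mono mult_pos_pos add_nonneg_pos)
  qed
  have "filterlim (\<lambda>x::real. x * z / M) at_top at_top"
    using z M by real_asymp
  then have "((\<lambda>x. arctan (x * z / M)) \<longlongrightarrow> pi / 2) at_top"
    by (rule filterlim_compose[OF tendsto_arctan_at_top])
  then have Glim: "(G \<longlongrightarrow> pi / 2 / (pi * M)) at_top"
    unfolding G_def using M by (intro tendsto_intros) auto
  have Gseq: "(\<lambda>l. G (real (l + n))) \<longlonglongrightarrow> pi / 2 / (pi * M)" for n
    by (rule filterlim_compose[OF Glim]) real_asymp
  have tel: "(\<lambda>l. G (real (Suc l + n)) - G (real (l + n))) sums (pi / 2 / (pi * M) - G (real n))" for n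
    using telescope_sums[OF Gseq, of n] by simp
  \<comment> \<open>Passing to the reciprocal argument prepares the shape arctan(u)/u, which makes
    the sum over the columns a Riemann sum.\<close>
  have cot: "pi / 2 / (pi * M) - G (real n) = arctan (M / (real n * z)) / (pi * M)" if "n > 0" for n
  proof -
    have p: "real n * z / M > 0" using that z M by simp
    have "arctan (1 / (real n * z / M)) = pi / 2 - arctan (real n * z / M)"
      using p arctan_inverse[of "real n * z / M"] by simp
    then show ?thesis using M by (simp add: G_def diff_divide_distrib)
  qed
  have summ: "summable (\<lambda>l. eisenstein_kernel z l m)"
    using sums_summable[OF eisenstein_kernel_sums[of "1/z" m]] z by (simp add: eisenstein_kernel_swap[OF z, abs_def])
  then have summ': "summable (\<lambda>l. eisenstein_kernel z (l + L) m)"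
    by (rule summable_ignore_initial_segment)
  show "(\<Sum>l. eisenstein_kernel z (l + L) m) \<le> arctan (real (Suc m) / (real L * z)) / (pi * real (Suc m))"
    using suminf_le[OF _ summ' sums_summable[OF tel[of L]]] bnd(1) sums_unique[OF tel[of L]] cot[OF L]
    unfolding M_def by (metis add_Suc)
  show "arctan (real (Suc m) / (real (Suc L) * z)) / (pi * real (Suc m)) \<le> (\<Sum>l. eisenstein_kernel z (l + L) m)"
    using suminf_le[OF _ sums_summable[OF tel[of "Suc L"]] summ'] bnd(2) sums_unique[OF tel[of "Suc L"]] cot[of "Suc L"]
    unfolding M_def by (metis add_Suc add_Suc_right zero_less_Suc)
qed

section \<open>The inverse tangent integral and its logarithmic growth\<close>

definition sinc_arctan :: "real \<Rightarrow> real" where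
  "sinc_arctan u = (if u = 0 then 1 else arctan u / u)"

lemma sinc_arctan_le_1: "u \<ge> 0 \<Longrightarrow> sinc_arctan u \<le> 1"
  using arctan_le_self[of u] by (auto simp: sinc_arctan_def divide_le_eq)

lemma sinc_arctan_nonneg: "u \<ge> 0 \<Longrightarrow> sinc_arctan u \<ge> 0"
  by (auto simp: sinc_arctan_def)

text \<open>This is the sign of the derivative of arctan x / x.\<close>

lemma arctan_lower:
  assumes "x \<ge> (0::real)"
  shows "x / (1 + x\<^sup>2) \<le> arctan x"
proof -
  have "(\<lambda>y. y / (1 + y\<^sup>2) - arctan y) x \<le> (\<lambda>y. y / (1 + y\<^sup>2) - arctan y) 0"
  proof (rule DERIV_nonpos_imp_nonincreasing[OF assms])
    fix y :: real
    have p: "1 + y^2 > 0" by (simp add: add_pos_nonneg)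
    have "((\<lambda>y. y / (1 + y\<^sup>2) - arctan y) has_real_derivative (1 * (1 + y^2) - y * (2 * y)) / ((1+y^2) * (1+y^2)) - 1 / (1 + y^2)) (at y)"
      using p by (auto intro!: derivative_eq_intros simp: inverse_eq_divide)
    also have "(1 * (1 + y^2) - y * (2 * y)) / ((1+y^2) * (1+y^2)) - 1 / (1 + y^2) = - 2 * y^2 / (1+y^2)^2"
      using p by (simp add: divide_simps) (simp add: algebra_simps power2_eq_square)
    finally show "\<exists>d. ((\<lambda>y. y / (1 + y\<^sup>2) - arctan y) has_real_derivative d) (at y) \<and> d \<le> 0"
      by (intro exI[of _ "- 2 * y^2 / (1+y^2)^2"]) (auto simp: divide_nonpos_nonneg)
  qed
  then show ?thesis by simp
qed

lemma sinc_arctan_antimono: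
  assumes "0 \<le> u" "u \<le> v"
  shows "sinc_arctan v \<le> sinc_arctan u"
proof (cases "u = 0")
  case True then show ?thesis using sinc_arctan_le_1[of v] assms by (simp add: sinc_arctan_def)
next
  case False
  then have u: "u > 0" using assms by simp
  have "arctan v / v \<le> arctan u / u"
  proof (rule DERIV_nonpos_imp_nonincreasing[OF assms(2)])
    fix x assume x: "u \<le> x" "x \<le> v"
    then have x0: "x > 0" using u by simp
    have "x / (1 + x\<^sup>2) \<le> arctan x" using x0 by (intro arctan_lower) simp
    moreover have "((\<lambda>x. arctan x / x) has_real_derivative (x / (1 + x\<^sup>2) - arctan x) / x^2) (at x)"
      using x0 by (auto intro!: derivative_eq_intros simp: field_simps power2_eq_square)
    ultimately show "\<exists>y. ((\<lambda>x. arctan x / x) has_real_derivative y) (at x) \<and> y \<le> 0"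
      by (intro exI[of _ "(x / (1 + x\<^sup>2) - arctan x) / x^2"]) (auto simp: divide_nonpos_nonneg)
  qed
  then show ?thesis using u assms by (auto simp: sinc_arctan_def)
qed

lemma isCont_sinc_arctan: "isCont sinc_arctan u"
proof (cases "u = 0")
  case True
  have "((\<lambda>x. arctan x / x) \<longlongrightarrow> 1) (at (0::real))" by real_asymp
  then show ?thesis using True unfolding isCont_def
    by (auto simp: sinc_arctan_def eventually_at_filter intro: Lim_transform_eventually)
next
  case False
  then have "eventually (\<lambda>x. x \<in> -{0}) (nhds u)" by (intro eventually_nhds_in_open) auto
  then have e: "eventually (\<lambda>x. sinc_arctan x = arctan x / x) (nhds u)"
    by eventually_elim (auto simp: sinc_arctan_def)
  show ?thesis unfolding isCont_cong[OF e] using False by (intro continuous_intros) auto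
qed

definition Ti2 :: "real \<Rightarrow> real" where "Ti2 u = integral {0..u} sinc_arctan"

lemma Ti2_deriv: "u > 0 \<Longrightarrow> (Ti2 has_real_derivative sinc_arctan u) (at u)"
  using integral_has_real_derivative[of 0 "u+1" sinc_arctan u]
  unfolding Ti2_def
  by (auto simp: at_within_Icc_at isCont_sinc_arctan continuous_at_imp_continuous_on)

lemma sinc_arctan_integrable: "sinc_arctan integrable_on {a..b}"
  by (intro integrable_continuous_real continuous_at_imp_continuous_on) (auto simp: isCont_sinc_arctan)

lemma Ti2_diff:
  assumes "0 \<le> a" "a \<le> b"
  shows "Ti2 b - Ti2 a \<le> (b - a) * sinc_arctan a" "(b - a) * sinc_arctan b \<le> Ti2 b - Ti2 a"
proof -
  have "Ti2 b - Ti2 a = integral {a..b} sinc_arctan"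
    unfolding Ti2_def using assms Henstock_Kurzweil_Integration.integral_combine[OF assms sinc_arctan_integrable] by linarith
  moreover have "integral {a..b} sinc_arctan \<le> integral {a..b} (\<lambda>_. sinc_arctan a)"
    by (rule integral_le) (auto intro: sinc_arctan_integrable sinc_arctan_antimono simp: assms)
  moreover have "integral {a..b} sinc_arctan \<ge> integral {a..b} (\<lambda>_. sinc_arctan b)"
    by (rule integral_le) (use assms in \<open>auto intro: sinc_arctan_integrable sinc_arctan_antimono\<close>)
  ultimately show "Ti2 b - Ti2 a \<le> (b - a) * sinc_arctan a" "(b - a) * sinc_arctan b \<le> Ti2 b - Ti2 a"
    using assms by auto
qed

lemma Ti2_0 [simp]: "Ti2 0 = 0" by (simp add: Ti2_def)

text \<open>Differentiation and arctan u + arctan(1/u) = pi/2 show that the difference of the sides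
  is constant, and it vanishes at u = 1. Hence \<open>Ti2\<close> grows like (pi/2) ln u: this is
  the source of the logarithm, and so of the square root in the eta inversion.\<close>

lemma Ti2_reflect:
  assumes "u > 0"
  shows "Ti2 u = pi / 2 * ln u + Ti2 (1 / u)"
proof -
  define D where "D = (\<lambda>u. Ti2 u - pi / 2 * ln u - Ti2 (1 / u))"
  have "(D has_real_derivative 0) (at u)" if "u > 0" for u
  proof -
    have "((\<lambda>u. Ti2 (1 / u)) has_real_derivative sinc_arctan (1/u) * (- (1 / u^2))) (at u)"
      by (rule DERIV_chain2[OF Ti2_deriv]) (use that in \<open>auto intro!: derivative_eq_intros simp: power2_eq_square\<close>)
    then have "(D has_real_derivative (sinc_arctan u - pi / 2 * (1 / u) - sinc_arctan (1/u) * (- (1 / u^2)))) (at u)"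
      unfolding D_def using that by (auto intro!: derivative_eq_intros Ti2_deriv)
    moreover have "sinc_arctan u - pi / 2 * (1 / u) - sinc_arctan (1/u) * (- (1 / u^2)) = 0"
      using that arctan_inverse[of u] by (simp add: sinc_arctan_def field_simps power2_eq_square)
    ultimately show ?thesis by simp
  qed
  then have "D u = D 1"
    by (intro DERIV_isconst3[of "min u 1 / 2" "max u 1 + 1" u 1 D])
       (use assms in \<open>auto simp: min_def max_def split: if_splits\<close>)
  then show ?thesis by (simp add: D_def)
qed

text \<open>A Riemann sum of mesh 1/c for the decreasing integrand arctan u / u, taken at right end
  points. The integrand lies between 0 and 1, so a shift by one step costs at most 1/c.\<close>

lemma arctan_sum_bounds:
  assumes c: "c > 0"
  shows "(\<Sum>m<M. arctan (real (Suc m) / c) / real (Suc m)) \<le> Ti2 (real M / c)"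
    and "Ti2 (real M / c) - 1 / c \<le> (\<Sum>m<M. arctan (real (Suc m) / c) / real (Suc m))"
proof -
  have t: "arctan (real (Suc m) / c) / real (Suc m) = (1 / c) * sinc_arctan (real (Suc m) / c)" for m
    using c by (simp add: sinc_arctan_def del: of_nat_Suc)
  have d: "real (Suc m) / c - real m / c = 1 / c" for m by (simp add: diff_divide_distrib[symmetric])
  have le: "real m / c \<le> real (Suc m) / c" for m using c by (intro divide_right_mono) auto
  have "(\<Sum>m<M. arctan (real (Suc m) / c) / real (Suc m)) \<le> (\<Sum>m<M. Ti2 (real (Suc m) / c) - Ti2 (real m / c))"
    using Ti2_diff(2)[OF _ le] c unfolding t d by (intro sum_mono) simp
  also have "\<dots> = Ti2 (real M / c)" by (subst sum_lessThan_telescope) simp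
  finally show "(\<Sum>m<M. arctan (real (Suc m) / c) / real (Suc m)) \<le> Ti2 (real M / c)" .
  have "Ti2 (real (Suc M) / c) - Ti2 (1 / c) = (\<Sum>m<M. Ti2 (real (Suc (Suc m)) / c) - Ti2 (real (Suc m) / c))"
    by (subst sum_lessThan_telescope[of "\<lambda>m. Ti2 (real (Suc m) / c)"]) simp
  also have "\<dots> \<le> (\<Sum>m<M. arctan (real (Suc m) / c) / real (Suc m))"
    using Ti2_diff(1)[OF _ le] c unfolding t d by (intro sum_mono) (metis d divide_nonneg_pos of_nat_0_le_iff)
  finally have "Ti2 (real (Suc M) / c) - Ti2 (1 / c) \<le> (\<Sum>m<M. arctan (real (Suc m) / c) / real (Suc m))" .
  moreover have "Ti2 (1 / c) \<le> 1 / c" using Ti2_diff(1)[of 0 "1/c"] c by (simp add: sinc_arctan_def)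
  moreover have "Ti2 (real M / c) \<le> Ti2 (real (Suc M) / c)"
    using Ti2_diff(2)[OF _ le, of M] c sinc_arctan_nonneg[of "real (Suc M) / c"]
    by (smt (verit, best) d divide_nonneg_pos mult_nonneg_nonneg of_nat_0_le_iff)
  ultimately show "Ti2 (real M / c) - 1 / c \<le> (\<Sum>m<M. arctan (real (Suc m) / c) / real (Suc m))"
    by linarith
qed

lemma lambert_nonneg: "z > 0 \<Longrightarrow> lambert z l \<ge> 0"
  by (simp add: lambert_def)

lemma lambert_le: "z > 0 \<Longrightarrow> lambert z l \<le> 1 / (2 * pi * z) * (1 / (real (Suc l))\<^sup>2)"
proof -
  assume z: "z > 0"
  have "2 * pi * real (Suc l) * z \<le> exp (2 * pi * real (Suc l) * z) - 1"
    using exp_ge_add_one_self[of "2 * pi * real (Suc l) * z"] by linarith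
  then have "1 / (real (Suc l) * (exp (2 * pi * real (Suc l) * z) - 1)) \<le> 1 / (real (Suc l) * (2 * pi * real (Suc l) * z))"
    using z by (intro divide_left_mono mult_left_mono mult_pos_pos) (auto simp: )
  also have "\<dots> = 1 / (2 * pi * z) * (1 / (real (Suc l))\<^sup>2)"
    by (simp add: power2_eq_square field_simps)
  finally show ?thesis by (simp add: lambert_def)
qed

lemma inverse_squares_sums': "(\<lambda>n. 1 / (real (Suc n))\<^sup>2) sums (pi\<^sup>2 / 6)"
  using inverse_squares_sums by (simp add: add.commute)

lemma summable_lambert:
  assumes "z > 0"
  shows "summable (lambert z)"
proof (rule summable_comparison_test')
  show "summable (\<lambda>l. 1 / (2 * pi * z) * (1 / (real (Suc l))\<^sup>2))"
    by (intro summable_mult sums_summable[OF inverse_squares_sums'])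
  show "norm (lambert z n) \<le> 1 / (2 * pi * z) * (1 / (real (Suc n))\<^sup>2)" if "n \<ge> 0" for n
    using lambert_nonneg[OF assms, of n] lambert_le[OF assms, of n] by simp
qed

text \<open>Summing the symmetric kernel by rows first and by columns first gives the two Lambert series;
  the two orders of summation differ, and the defect is the logarithm.\<close>

theorem lambert_reflect:
  assumes z: "z > 0"
  shows "(\<Sum>l. lambert z l) - (\<Sum>l. lambert (1/z) l) = pi / (12 * z) - pi * z / 12 + ln z / 2"
proof -
  define K where "K = eisenstein_kernel z"
  have z': "1 / z > 0" using z by simp
  \<comment> \<open>\<open>A\<close> and \<open>B\<close> are partial sums from which the harmonic
    part has been removed; they converge, while \<open>H\<close> carries the divergence.\<close>
  define A where "A = (\<lambda>L. \<Sum>l<L. lambert z l - 1 / (2 * pi * z) * (1 / (real (Suc l))\<^sup>2))"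
  define B where "B = (\<lambda>M. \<Sum>m<M. lambert (1/z) m - 1 / (2 * pi * (1/z)) * (1 / (real (Suc m))\<^sup>2))"
  define H where "H = (\<lambda>n. harm n :: real)"
  define T where "T = (\<lambda>L M. \<Sum>m<M. \<Sum>l. K (l + L) m)"
  have Harm: "H n = (\<Sum>l<n. 1 / real (Suc l))" for n
    by (simp add: H_def harm_altdef inverse_eq_divide)
  have rowsum: "(\<Sum>l<L. (\<Sum>m. K l m)) = A L + H L / 2" for L
    unfolding A_def Harm sum_divide_distrib sum.distrib[symmetric] K_def
    using eisenstein_kernel_sums[OF z] by (intro sum.cong refl) (simp add: sums_iff)
  have col: "(\<lambda>l. K l m) sums (lambert (1/z) m + 1 / (2 * real (Suc m)) - 1 / (2 * pi * (1/z)) * (1 / (real (Suc m))\<^sup>2))" for m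
    using eisenstein_kernel_sums[OF z', of m] unfolding K_def eisenstein_kernel_swap[OF z, abs_def] by simp
  have colsum: "(\<Sum>m<M. (\<Sum>l. K l m)) = B M + H M / 2" for M
    unfolding B_def Harm sum_divide_distrib sum.distrib[symmetric]
    using col by (intro sum.cong refl) (simp add: sums_iff)
  \<comment> \<open>The first \<open>M\<close> columns without their tails \<open>T\<close> form a
    finite rectangle, where the order of summation does not matter.\<close>
  have split: "B M + H M / 2 - T L M = (\<Sum>m<M. \<Sum>l<L. K l m)" for L M
    unfolding colsum[symmetric] T_def sum_subtractf[symmetric]
    using suminf_split_initial_segment[OF sums_summable[OF col], where k = L] by (intro sum.cong refl) simp
  \<comment> \<open>\<open>M\<close> tends to infinity first, with \<open>L\<close> fixed: the
    rectangle fills the first \<open>L\<close> rows.\<close>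
  have lim: "(\<lambda>M. B M + H M / 2 - T L M) \<longlonglongrightarrow> A L + H L / 2" for L
    unfolding split rowsum[symmetric]
  proof (subst sum.swap, intro tendsto_sum)
    fix l show "(\<lambda>M. \<Sum>m<M. K l m) \<longlonglongrightarrow> suminf (K l)"
      using sums_summable[OF eisenstein_kernel_sums[OF z]] unfolding K_def by (intro summable_LIMSEQ)
  qed
  have sA: "(\<lambda>l. lambert z l - 1 / (2 * pi * z) * (1 / (real (Suc l))\<^sup>2)) sums ((\<Sum>l. lambert z l) - 1 / (2 * pi * z) * (pi^2/6))"
    by (intro sums_diff sums_mult summable_sums summable_lambert z inverse_squares_sums')
  have sB: "(\<lambda>l. lambert (1/z) l - 1 / (2 * pi * (1/z)) * (1 / (real (Suc l))\<^sup>2)) sums ((\<Sum>l. lambert (1/z) l) - 1 / (2 * pi * (1/z)) * (pi^2/6))"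
    by (intro sums_diff sums_mult summable_sums summable_lambert z' inverse_squares_sums')
  define a where "a = (\<Sum>l. lambert z l) - 1 / (2 * pi * z) * (pi^2/6)"
  define b where "b = (\<Sum>l. lambert (1/z) l) - 1 / (2 * pi * (1/z)) * (pi^2/6)"
  have Alim: "A \<longlonglongrightarrow> a" using sA unfolding sums_def A_def a_def .
  have Blim: "B \<longlonglongrightarrow> b" using sB unfolding sums_def B_def b_def .
  define \<gamma> where "\<gamma> = (euler_mascheroni :: real)"
  have Hlim: "(\<lambda>n. H n - ln (real n)) \<longlonglongrightarrow> \<gamma>"
    unfolding H_def \<gamma>_def by (rule euler_mascheroni_LIMSEQ)
  have Tb: "T L M \<le> Ti2 (real M / (real L * z)) / pi"
     "Ti2 (real M / (real (Suc L) * z)) / pi - 1 / (pi * (real (Suc L) * z)) \<le> T L M" if L: "L > 0" for L M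
  proof -
    have "T L M \<le> (\<Sum>m<M. arctan (real (Suc m) / (real L * z)) / real (Suc m)) / pi"
      unfolding T_def K_def sum_divide_distrib
      using eisenstein_tail_le(1)[OF z L] by (intro sum_mono) (simp add: mult.commute)
    also have "\<dots> \<le> Ti2 (real M / (real L * z)) / pi"
      using L z by (intro divide_right_mono arctan_sum_bounds(1)) auto
    finally show "T L M \<le> Ti2 (real M / (real L * z)) / pi" .
    have "Ti2 (real M / (real (Suc L) * z)) / pi - 1 / (pi * (real (Suc L) * z)) = (Ti2 (real M / (real (Suc L) * z)) - 1 / (real (Suc L) * z)) / pi"
      by (simp add: diff_divide_distrib mult.commute)
    also have "\<dots> \<le> (\<Sum>m<M. arctan (real (Suc m) / (real (Suc L) * z)) / real (Suc m)) / pi"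
      using L z by (intro divide_right_mono arctan_sum_bounds(2)) auto
    also have "\<dots> \<le> T L M"
      unfolding T_def K_def sum_divide_distrib
      using eisenstein_tail_le(2)[OF z L] by (intro sum_mono) (simp add: mult.commute)
    finally show "Ti2 (real M / (real (Suc L) * z)) / pi - 1 / (pi * (real (Suc L) * z)) \<le> T L M" .
  qed
  \<comment> \<open>The growth (ln M)/2 found here cancels against that of \<open>H M / 2\<close>,
    so the upper and lower estimates of \<open>T\<close> have finite counterparts in the
    limit.\<close>
  have Ti2_asymp: "(\<lambda>M. Ti2 (real M / c) / pi - ln (real M) / 2) \<longlonglongrightarrow> - ln c / 2" if c: "c > 0" for c
  proof -
    have "eventually (\<lambda>M. Ti2 (real M / c) / pi - ln (real M) / 2 = - ln c / 2 + Ti2 (c / real M) / pi) sequentially"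
      using eventually_gt_at_top[of 0]
    proof eventually_elim
      case (elim M)
      then have "real M / c > 0" using c by simp
      from Ti2_reflect[OF this] show ?case using c elim by (simp add: ln_div field_simps)
    qed
    moreover have "(\<lambda>M. Ti2 (c / real M)) \<longlonglongrightarrow> 0"
    proof (rule tendsto_sandwich[where f = "\<lambda>_. 0" and h = "\<lambda>M. c / real M"])
      show "\<forall>\<^sub>F M in sequentially. Ti2 (c / real M) \<le> c / real M"
        using Ti2_diff(1)[of 0 "c / real M" for M] c by (auto simp: sinc_arctan_def)
      show "\<forall>\<^sub>F M in sequentially. 0 \<le> Ti2 (c / real M)"
      proof (intro always_eventually allI)
        fix M
        have p: "c / real M \<ge> 0" using c by simp
        show "0 \<le> Ti2 (c / real M)"
          using Ti2_diff(2)[of 0 "c / real M"] p sinc_arctan_nonneg[OF p] mult_nonneg_nonneg[OF p sinc_arctan_nonneg[OF p]] by simp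
      qed
    qed (auto intro!: tendsto_divide_0[OF tendsto_const] filterlim_real_sequentially filterlim_at_top_imp_at_infinity)
    then have "(\<lambda>M. - ln c / 2 + Ti2 (c / real M) / pi) \<longlonglongrightarrow> - ln c / 2 + 0 / pi"
      by (intro tendsto_intros) auto
    ultimately show ?thesis by (simp add: filterlim_cong)
  qed
  \<comment> \<open>The two estimates of \<open>T\<close> in the limit of large \<open>M\<close>.
    They differ by L against L+1 and by a term of order 1/L, which both disappear when
    \<open>L\<close> grows.\<close>
  have up: "b + \<gamma> / 2 + ln (real L * z) / 2 \<le> A L + H L / 2" if L: "L > 0" for L
  proof (rule LIMSEQ_le[OF _ lim[of L]])
    have "(\<lambda>M. B M + (H M - ln (real M)) / 2 - (Ti2 (real M / (real L * z)) / pi - ln (real M) / 2)) \<longlonglongrightarrow> b + \<gamma> / 2 - (- ln (real L * z) / 2)"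
      using L z by (intro tendsto_intros Blim Hlim Ti2_asymp) auto
    then show "(\<lambda>M. B M + H M / 2 - Ti2 (real M / (real L * z)) / pi) \<longlonglongrightarrow> b + \<gamma> / 2 + ln (real L * z) / 2"
      by (simp add: diff_divide_distrib algebra_simps)
    show "\<exists>N. \<forall>n\<ge>N. B n + H n / 2 - Ti2 (real n / (real L * z)) / pi \<le> B n + H n / 2 - T L n"
      using Tb(1)[OF L] by auto
  qed
  have lo: "A L + H L / 2 \<le> b + \<gamma> / 2 + ln (real (Suc L) * z) / 2 + 1 / (pi * (real (Suc L) * z))" if L: "L > 0" for L
  proof (rule LIMSEQ_le[OF lim[of L]])
    have "(\<lambda>M. B M + (H M - ln (real M)) / 2 - (Ti2 (real M / (real (Suc L) * z)) / pi - ln (real M) / 2) + 1 / (pi * (real (Suc L) * z))) \<longlonglongrightarrow> b + \<gamma> / 2 - (- ln (real (Suc L) * z) / 2) + 1 / (pi * (real (Suc L) * z))"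
      using L z by (intro tendsto_intros Blim Hlim Ti2_asymp) auto
    then show "(\<lambda>M. B M + H M / 2 - (Ti2 (real M / (real (Suc L) * z)) / pi - 1 / (pi * (real (Suc L) * z)))) \<longlonglongrightarrow> b + \<gamma> / 2 + ln (real (Suc L) * z) / 2 + 1 / (pi * (real (Suc L) * z))"
      by (simp add: diff_divide_distrib algebra_simps)
    show "\<exists>N. \<forall>n\<ge>N. B n + H n / 2 - T L n \<le> B n + H n / 2 - (Ti2 (real n / (real (Suc L) * z)) / pi - 1 / (pi * (real (Suc L) * z)))"
      by (intro exI[of _ 0] allI impI diff_left_mono Tb(2) L)
  qed
  \<comment> \<open>Now \<open>L\<close> tends to infinity. Euler's constant enters from the columns
    and from the rows with the same weight 1/2 and cancels; ln z / 2 remains.\<close>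
  have Xlim: "(\<lambda>L. A L + (H L - ln (real L)) / 2) \<longlonglongrightarrow> a + \<gamma> / 2"
    by (intro tendsto_intros Alim Hlim) auto
  have "b + \<gamma> / 2 + ln z / 2 \<le> a + \<gamma> / 2"
  proof (rule LIMSEQ_le_const[OF Xlim], intro exI[of _ 1] allI impI)
    fix L :: nat assume "1 \<le> L"
    then show "b + \<gamma> / 2 + ln z / 2 \<le> A L + (H L - ln (real L)) / 2"
      using up[of L] z by (simp add: ln_mult diff_divide_distrib add_divide_distrib)
  qed
  moreover have "a + \<gamma> / 2 \<le> b + \<gamma> / 2 + ln z / 2"
  proof (rule LIMSEQ_le[OF Xlim])
    have l1: "(\<lambda>L. ln (real (Suc L)) - ln (real L)) \<longlonglongrightarrow> 0" by real_asymp
    have l2: "(\<lambda>L. 1 / (pi * (real (Suc L) * z))) \<longlonglongrightarrow> 0" using z by real_asymp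
    have "(\<lambda>L. b + \<gamma> / 2 + ln z / 2 + (ln (real (Suc L)) - ln (real L)) / 2 + 1 / (pi * (real (Suc L) * z))) \<longlonglongrightarrow> b + \<gamma> / 2 + ln z / 2 + 0 / 2 + 0"
      by (intro tendsto_intros l1 l2) auto
    then show "(\<lambda>L. b + \<gamma> / 2 + ln z / 2 + (ln (real (Suc L)) - ln (real L)) / 2 + 1 / (pi * (real (Suc L) * z))) \<longlonglongrightarrow> b + \<gamma> / 2 + ln z / 2" by simp
    show "\<exists>N. \<forall>n\<ge>N. A n + (H n - ln (real n)) / 2 \<le> b + \<gamma> / 2 + ln z / 2 + (ln (real (Suc n)) - ln (real n)) / 2 + 1 / (pi * (real (Suc n) * z))"
    proof (intro exI[of _ 1] allI impI)
      fix L :: nat assume "1 \<le> L"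
      then show "A L + (H L - ln (real L)) / 2 \<le> b + \<gamma> / 2 + ln z / 2 + (ln (real (Suc L)) - ln (real L)) / 2 + 1 / (pi * (real (Suc L) * z))"
        using lo[of L] z by (simp add: ln_mult diff_divide_distrib add_divide_distrib del: of_nat_Suc)
    qed
  qed
  ultimately have "a = b + ln z / 2" by linarith
  then show ?thesis using z unfolding a_def b_def by (simp add: field_simps power2_eq_square)
qed


section \<open>The Euler product\<close>

lemma neg_ln_one_minus_sums:
  fixes x :: real
  assumes "0 \<le> x" "x < 1"
  shows "(\<lambda>l. x ^ Suc l / real (Suc l)) sums (- ln (1 - x))"
proof -
  have "\<bar>- x\<bar> < 1" using assms by simp
  from sums_minus[OF ln_series'[OF this]] have 1: "(\<lambda>n. x ^ n / real n) sums (- ln (1 - x))"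
    by (simp only: minus_minus minus_divide_left add_uminus_conv_diff)
  have "(\<lambda>n. (\<lambda>n. x ^ n / real n) (Suc n)) sums (- ln (1 - x))"
    by (subst sums_Suc_iff) (use 1 in \<open>simp only: of_nat_0 div_by_0 add_0_right\<close>)
  then show ?thesis by (simp only:)
qed

lemma sum_neg_ln_sums:
  fixes x :: "nat \<Rightarrow> real"
  assumes "\<And>m. m < M \<Longrightarrow> 0 \<le> x m \<and> x m < 1"
  shows "(\<lambda>l. (\<Sum>m<M. x m ^ Suc l) / real (Suc l)) sums (\<Sum>m<M. - ln (1 - x m))"
  unfolding sum_divide_distrib using assms by (intro sums_sum neg_ln_one_minus_sums) auto

text \<open>Expanding the logarithms leaves the power sums of the \<open>x m\<close> with weights
  1/l; a bound C/l for them turns the total into C times the sum of 1/l^2.\<close>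

lemma prod_inverse_one_minus_le:
  fixes x :: "nat \<Rightarrow> real"
  assumes x: "\<And>m. m < M \<Longrightarrow> 0 \<le> x m \<and> x m < 1"
    and C: "\<And>l. (\<Sum>m<M. x m ^ Suc l) \<le> C / real (Suc l)"
  shows "(\<Prod>m<M. inverse (1 - x m)) \<le> exp (C * pi\<^sup>2 / 6)"
proof -
  have "(\<Sum>m<M. - ln (1 - x m)) \<le> C * (pi\<^sup>2 / 6)"
  proof (rule sums_le[OF _ sum_neg_ln_sums[OF x] sums_mult[OF inverse_squares_sums']])
    fix l
    have "(\<Sum>m<M. x m ^ Suc l) / real (Suc l) \<le> C / real (Suc l) / real (Suc l)"
      by (intro divide_right_mono C) auto
    then show "(\<Sum>m<M. x m ^ Suc l) / real (Suc l) \<le> C * (1 / (real (Suc l))\<^sup>2)"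
      by (simp add: power2_eq_square)
  qed
  moreover have "(\<Prod>m<M. inverse (1 - x m)) = exp (\<Sum>m<M. - ln (1 - x m))"
    using x by (subst exp_sum) (auto simp: exp_minus intro!: prod.cong)
  ultimately show ?thesis by simp
qed

text \<open>The two quotients are 1/(exp s - 1) and 1/(2 sinh s). The second one belongs to odd
  exponents only and saves a factor 2.\<close>

lemma geometric_tail_le:
  fixes s :: real
  assumes s: "s > 0" and r: "r = exp (- s)"
  shows "r / (1 - r) \<le> 1 / s" "r / (1 - r\<^sup>2) \<le> 1 / (2 * s)"
proof -
  have rs: "r > 0" "r < 1" using s r by auto
  have e: "exp s = 1 / r" by (simp add: r exp_minus inverse_eq_divide)
  have "s \<le> exp s - 1" using exp_ge_add_one_self[of s] by linarith
  then have "1 / (exp s - 1) \<le> 1 / s" using s by (intro divide_left_mono) auto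
  moreover have "1 / (exp s - 1) = r / (1 - r)" unfolding e using rs by (simp add: field_simps)
  ultimately show "r / (1 - r) \<le> 1 / s" by simp
  have "2 * s \<le> exp s - exp (- s)" using real_le_x_sinh[of s] s by (simp add: exp_minus)
  then have "1 / (exp s - exp (- s)) \<le> 1 / (2 * s)" using s by (intro divide_left_mono) auto
  moreover have "1 / (exp s - exp (- s)) = r / (1 - r^2)" unfolding e r[symmetric] using rs
    by (simp add: field_simps power2_eq_square)
  ultimately show "r / (1 - r\<^sup>2) \<le> 1 / (2 * s)" by simp
qed

lemma sum_geometric_le:
  fixes r :: real
  assumes "0 \<le> r" "r < 1"
  shows "(\<Sum>m<M. r ^ Suc m) \<le> r / (1 - r)" "(\<Sum>m<M. r ^ (2 * m + 1)) \<le> r / (1 - r\<^sup>2)"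
proof -
  have "(\<Sum>m<M. r ^ Suc m) = r * (\<Sum>m<M. r ^ m)" by (simp add: sum_distrib_left)
  also have "\<dots> \<le> r * (1 / (1 - r))"
    using assms sum_le_suminf[of "\<lambda>m. r ^ m" "{..<M}"] by (intro mult_left_mono) (auto simp: suminf_geometric summable_geometric)
  finally show "(\<Sum>m<M. r ^ Suc m) \<le> r / (1 - r)" by simp
  have r2: "0 \<le> r^2" "r^2 < 1" using assms by (auto simp: power_less_one_iff abs_square_less_1)
  have "(\<Sum>m<M. r ^ (2 * m + 1)) = r * (\<Sum>m<M. (r^2) ^ m)" by (simp add: sum_distrib_left power_mult)
  also have "\<dots> \<le> r * (1 / (1 - r^2))"
    using assms r2 sum_le_suminf[of "\<lambda>m. (r^2) ^ m" "{..<M}"] by (intro mult_left_mono) (auto simp: suminf_geometric summable_geometric)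
  finally show "(\<Sum>m<M. r ^ (2 * m + 1)) \<le> r / (1 - r\<^sup>2)" by simp
qed

lemma exp_minus_power: "exp (- s) ^ n = exp (- (real n * s))" for s :: real
  by (simp flip: exp_of_nat_mult)

lemma prod_inverse_le_exp:
  assumes s: "s > 0"
  shows "(\<Prod>m<M. inverse (1 - exp (- s) ^ Suc m)) \<le> exp (pi\<^sup>2 / (6 * s))"
proof -
  have "(\<Prod>m<M. inverse (1 - exp (- s) ^ Suc m)) \<le> exp (1 / s * pi\<^sup>2 / 6)"
  proof (rule prod_inverse_one_minus_le)
    show "0 \<le> exp (- s) ^ Suc m \<and> exp (- s) ^ Suc m < 1" for m
      using s by (auto simp: exp_minus_power simp del: power_Suc of_nat_Suc)
    fix l
    define R where "R = exp (- (real (Suc l) * s))"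
    have p: "real (Suc l) * s > 0" using s by simp
    have Rp: "R = exp (- s) ^ Suc l" by (simp only: R_def exp_minus_power)
    have "(\<Sum>m<M. (exp (- s) ^ Suc m) ^ Suc l) = (\<Sum>m<M. R ^ Suc m)"
      unfolding Rp by (intro sum.cong refl) (simp only: power_mult[symmetric] mult.commute)
    also have "\<dots> \<le> R / (1 - R)" using p by (intro sum_geometric_le) (auto simp: R_def)
    also have "\<dots> \<le> 1 / (real (Suc l) * s)" by (rule geometric_tail_le(1)[OF p R_def])
    finally show "(\<Sum>m<M. (exp (- s) ^ Suc m) ^ Suc l) \<le> 1 / s / real (Suc l)" by (simp add: mult.commute)
  qed
  then show ?thesis by (simp add: mult.commute)
qed

lemma prod_inverse_odd_le_exp:
  assumes s: "s > 0"
  shows "(\<Prod>m<M. inverse (1 - exp (- s) ^ (2 * m + 1))) \<le> exp (pi\<^sup>2 / (12 * s))"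
proof -
  have "(\<Prod>m<M. inverse (1 - exp (- s) ^ (2 * m + 1))) \<le> exp (1 / (2 * s) * pi\<^sup>2 / 6)"
  proof (rule prod_inverse_one_minus_le)
    show "0 \<le> exp (- s) ^ (2 * m + 1) \<and> exp (- s) ^ (2 * m + 1) < 1" for m
      using s by (auto simp: exp_minus_power add_pos_nonneg simp del: power_Suc of_nat_Suc)
    fix l
    define R where "R = exp (- (real (Suc l) * s))"
    have p: "real (Suc l) * s > 0" using s by simp
    have Rp: "R = exp (- s) ^ Suc l" by (simp only: R_def exp_minus_power)
    have "(\<Sum>m<M. (exp (- s) ^ (2 * m + 1)) ^ Suc l) = (\<Sum>m<M. R ^ (2 * m + 1))"
      unfolding Rp by (intro sum.cong refl) (simp only: power_mult[symmetric] mult.commute)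
    also have "\<dots> \<le> R / (1 - R\<^sup>2)" using p by (intro sum_geometric_le) (auto simp: R_def)
    also have "\<dots> \<le> 1 / (2 * (real (Suc l) * s))" by (rule geometric_tail_le(2)[OF p R_def])
    finally show "(\<Sum>m<M. (exp (- s) ^ (2 * m + 1)) ^ Suc l) \<le> 1 / (2 * s) / real (Suc l)" by (simp only: divide_divide_eq_left mult.assoc mult.commute mult.left_commute)
  qed
  then show ?thesis by simp
qed

section \<open>The Euler product as a holomorphic function, its size and its inversion\<close>

definition euler_prod :: "complex \<Rightarrow> complex" where
  "euler_prod q = (\<Prod>m. 1 - q ^ Suc m)"

lemma norm_power_Suc_less_1: "norm (q::complex) < 1 \<Longrightarrow> norm (q ^ Suc m) < 1"
  by (simp only: norm_power) (simp add: power_less_one_iff del: power_Suc)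

lemma power_Suc_neq_1: "norm (q::complex) < 1 \<Longrightarrow> q ^ Suc m \<noteq> 1"
  using norm_power_Suc_less_1[of q m] by (auto simp del: power_Suc)

lemma euler_prod_convergent:
  fixes q :: complex
  assumes "norm q < 1"
  shows "convergent_prod (\<lambda>m. 1 - q ^ Suc m)"
proof (rule abs_convergent_prod_imp_convergent_prod)
  have "summable (\<lambda>m. norm q * norm q ^ m)" using assms by (intro summable_mult summable_geometric) simp
  then show "abs_convergent_prod (\<lambda>m. 1 - q ^ Suc m)"
    unfolding abs_convergent_prod_conv_summable by (simp add: norm_mult norm_power)
qed

lemma euler_prod_LIMSEQ:
  fixes q :: complex
  assumes "norm q < 1"
  shows "(\<lambda>M. \<Prod>m<M. 1 - q ^ Suc m) \<longlonglongrightarrow> euler_prod q"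
  using convergent_prod_LIMSEQ[OF euler_prod_convergent[OF assms]] unfolding euler_prod_def
  by (subst filterlim_sequentially_Suc[symmetric]) (simp add: lessThan_Suc_atMost)

lemma euler_prod_nonzero: "norm q < 1 \<Longrightarrow> euler_prod q \<noteq> 0"
  unfolding euler_prod_def
  by (rule prodinf_nonzero[OF euler_prod_convergent]) (use power_Suc_neq_1 in \<open>auto simp del: power_Suc\<close>)

lemma euler_prod_holomorphic: "euler_prod holomorphic_on ball 0 1"
proof (rule holomorphic_uniform_sequence)
  show "(\<lambda>q. \<Prod>m<n. 1 - q ^ Suc m) holomorphic_on ball 0 1" for n
    by (intro holomorphic_intros)
  fix x :: complex assume x: "x \<in> ball 0 1"
  define d where "d = (1 - norm x) / 2"
  have d: "d > 0" "norm x + d < 1" using x by (auto simp: d_def field_simps)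
  have sub: "cball x d \<subseteq> cball 0 (norm x + d)"
  proof
    fix y assume "y \<in> cball x d"
    then show "y \<in> cball 0 (norm x + d)" using dist_triangle[of 0 y x] by (simp add: dist_commute)
  qed
  have uc: "uniformly_convergent_on (cball x d) (\<lambda>N q. \<Prod>n<N. 1 - q ^ Suc n)"
  proof (rule uniformly_convergent_on_prod')
    show "uniformly_convergent_on (cball x d) (\<lambda>N q. \<Sum>n<N. norm (1 - q ^ Suc n - 1))"
    proof (rule Weierstrass_m_test')
      show "summable (\<lambda>n. (norm x + d) * (norm x + d) ^ n)"
        using d by (intro summable_mult summable_geometric) auto
      fix n q assume "q \<in> cball x d"
      then have "norm q \<le> norm x + d" using sub by auto
      then have "norm q ^ Suc n \<le> (norm x + d) ^ Suc n" by (intro power_mono) auto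
      then show "norm (norm (1 - q ^ Suc n - 1)) \<le> (norm x + d) * (norm x + d) ^ n"
        by (simp add: norm_mult norm_power)
    qed
  qed (auto intro!: continuous_intros)
  obtain l where l: "uniform_limit (cball x d) (\<lambda>N q. \<Prod>n<N. 1 - q ^ Suc n) l sequentially"
    using uc by (auto simp: uniformly_convergent_on_def)
  have "l q = euler_prod q" if "q \<in> cball x d" for q
    using tendsto_uniform_limitI[OF l that] euler_prod_LIMSEQ[of q] that sub d LIMSEQ_unique
    by (metis (no_types, lifting) dist_0_norm le_less_trans mem_cball subsetD)
  then have "uniform_limit (cball x d) (\<lambda>N q. \<Prod>n<N. 1 - q ^ Suc n) euler_prod sequentially"
    using l by (metis (mono_tags, lifting) uniform_limit_cong')
  moreover have "cball x d \<subseteq> ball 0 1" using sub d by auto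
  ultimately show "\<exists>d>0. cball x d \<subseteq> ball 0 1 \<and> uniform_limit (cball x d) (\<lambda>N q. \<Prod>n<N. 1 - q ^ Suc n) euler_prod sequentially"
    using d(1) by blast
qed auto

lemma holomorphic_on_euler_prod [holomorphic_intros]:
  assumes "f holomorphic_on A" "\<And>z. z \<in> A \<Longrightarrow> norm (f z) < 1"
  shows "(\<lambda>z. euler_prod (f z)) holomorphic_on A"
  using holomorphic_on_compose_gen[OF assms(1) euler_prod_holomorphic] assms(2)
  by (auto simp: o_def image_subset_iff)

lemma norm_inverse_one_minus_le:
  fixes q :: complex
  assumes "norm q < 1"
  shows "norm (inverse (1 - q)) \<le> inverse (1 - norm q)"
proof -
  have "1 - norm q \<le> norm (1 - q)" using norm_triangle_ineq2[of 1 q] by simp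
  then show ?thesis using assms by (simp add: norm_inverse le_imp_inverse_le)
qed

text \<open>Factor by factor, the reciprocal is largest at the positive real point of the
  circle.\<close>

lemma norm_inverse_euler_prod_le:
  assumes s: "s > 0" and q: "norm q = exp (- s)"
  shows "norm (inverse (euler_prod q)) \<le> exp (pi\<^sup>2 / (6 * s))"
proof -
  have q1: "norm q < 1" using s q by simp
  have "(\<lambda>M. norm (inverse (\<Prod>m<M. 1 - q ^ Suc m))) \<longlonglongrightarrow> norm (inverse (euler_prod q))"
    by (intro tendsto_norm tendsto_inverse euler_prod_LIMSEQ q1 euler_prod_nonzero)
  moreover have "norm (inverse (\<Prod>m<M. 1 - q ^ Suc m)) \<le> exp (pi\<^sup>2 / (6 * s))" for M
  proof -
    have "norm (inverse (\<Prod>m<M. 1 - q ^ Suc m)) = (\<Prod>m<M. norm (inverse (1 - q ^ Suc m)))"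
      by (simp add: prod_norm[symmetric] norm_inverse prod_inversef[symmetric] o_def del: power_Suc)
    also have "\<dots> \<le> (\<Prod>m<M. inverse (1 - norm (q ^ Suc m)))"
      by (intro prod_mono conjI norm_ge_zero norm_inverse_one_minus_le norm_power_Suc_less_1 q1)
    also have "\<dots> \<le> exp (pi\<^sup>2 / (6 * s))"
      using prod_inverse_le_exp[OF s, of M] by (simp add: norm_power norm_mult q mult.commute)
    finally show ?thesis .
  qed
  ultimately show ?thesis by (intro LIMSEQ_le_const2[OF _ exI[of _ 0]]) auto
qed

lemma prod_odd_even:
  fixes f :: "nat \<Rightarrow> 'a::comm_monoid_mult"
  shows "(\<Prod>m<2*M. f (Suc m)) = (\<Prod>m<M. f (2 * m + 1)) * (\<Prod>m<M. f (2 * Suc m))"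
  by (induction M) (auto simp: mult_ac)

text \<open>The even exponents cancel and a product over the odd ones is left. Grouping the eta
  factors into such quotients is cheaper than bounding them one at a time.\<close>

lemma euler_prod_quotient_LIMSEQ:
  assumes q: "norm q < 1"
  shows "(\<lambda>M. \<Prod>m<M. 1 - q ^ (2 * m + 1)) \<longlonglongrightarrow> euler_prod q / euler_prod (q\<^sup>2)"
proof -
  have q2: "norm (q\<^sup>2) < 1" using norm_power_Suc_less_1[OF q, of 1] by (simp add: numeral_2_eq_2)
  have "(\<lambda>M. (\<Prod>m<2*M. 1 - q ^ Suc m)) \<longlonglongrightarrow> euler_prod q"
    by (rule filterlim_compose[OF euler_prod_LIMSEQ[OF q]]) (auto intro!: mult_nat_left_at_top)
  then have "(\<lambda>M. (\<Prod>m<2*M. 1 - q ^ Suc m) / (\<Prod>m<M. 1 - (q\<^sup>2) ^ Suc m)) \<longlonglongrightarrow> euler_prod q / euler_prod (q\<^sup>2)"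
    by (intro tendsto_divide euler_prod_LIMSEQ euler_prod_nonzero q2)
  moreover have "(\<Prod>m<2*M. 1 - q ^ Suc m) / (\<Prod>m<M. 1 - (q\<^sup>2) ^ Suc m) = (\<Prod>m<M. 1 - q ^ (2 * m + 1))" for M
  proof -
    have "(\<Prod>m<M. 1 - q ^ (2 * Suc m)) = (\<Prod>m<M. 1 - (q\<^sup>2) ^ Suc m)" by (simp only: power_mult)
    moreover have "(\<Prod>m<M. 1 - (q\<^sup>2) ^ Suc m) \<noteq> 0" using power_Suc_neq_1[OF q2] by (auto simp del: power_Suc)
    ultimately show ?thesis by (subst prod_odd_even[of "\<lambda>m. 1 - q ^ m"]) (simp del: power_Suc mult_Suc_right)
  qed
  ultimately show ?thesis by simp
qed

text \<open>The first exponent is half of that for a full reciprocal product, as only odd exponents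
  occur. The second bound is 1 + x <= exp x applied to each factor.\<close>

lemma norm_euler_prod_quotient_le:
  assumes s: "s > 0" and q: "norm q = exp (- s)"
  shows "norm (euler_prod (q\<^sup>2) / euler_prod q) \<le> exp (pi\<^sup>2 / (12 * s))"
    and "norm (euler_prod q / euler_prod (q\<^sup>2)) \<le> exp (1 / (2 * s))"
proof -
  have q1: "norm q < 1" using s q by simp
  have q2: "norm (q\<^sup>2) < 1" using norm_power_Suc_less_1[OF q1, of 1] by (simp add: numeral_2_eq_2)
  note lim = euler_prod_quotient_LIMSEQ[OF q1]
  have odd: "norm (q ^ (2 * m + 1)) < 1" for m using norm_power_Suc_less_1[OF q1, of "2*m"] by simp
  have "(\<lambda>M. norm (inverse (\<Prod>m<M. 1 - q ^ (2 * m + 1)))) \<longlonglongrightarrow> norm (inverse (euler_prod q / euler_prod (q\<^sup>2)))"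
    by (intro tendsto_norm tendsto_inverse lim) (simp add: euler_prod_nonzero q1 q2)
  moreover have "norm (inverse (\<Prod>m<M. 1 - q ^ (2 * m + 1))) \<le> exp (pi\<^sup>2 / (12 * s))" for M
  proof -
    have "norm (inverse (\<Prod>m<M. 1 - q ^ (2 * m + 1))) = (\<Prod>m<M. norm (inverse (1 - q ^ (2 * m + 1))))"
      by (simp add: prod_norm[symmetric] norm_inverse prod_inversef[symmetric] o_def del: power_Suc)
    also have "\<dots> \<le> (\<Prod>m<M. inverse (1 - norm (q ^ (2 * m + 1))))"
      by (intro prod_mono conjI norm_ge_zero norm_inverse_one_minus_le odd)
    also have "\<dots> \<le> exp (pi\<^sup>2 / (12 * s))"
      using prod_inverse_odd_le_exp[OF s, of M] by (simp add: norm_power norm_mult q mult.commute)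
    finally show ?thesis .
  qed
  ultimately have "norm (inverse (euler_prod q / euler_prod (q\<^sup>2))) \<le> exp (pi\<^sup>2 / (12 * s))"
    by (intro LIMSEQ_le_const2[OF _ exI[of _ 0]]) auto
  then show "norm (euler_prod (q\<^sup>2) / euler_prod q) \<le> exp (pi\<^sup>2 / (12 * s))" by simp
  have "norm (\<Prod>m<M. 1 - q ^ (2 * m + 1)) \<le> exp (1 / (2 * s))" for M
  proof -
    define r where "r = exp (- s)"
    have r: "0 \<le> r" "r < 1" using s by (auto simp: r_def)
    have "norm (\<Prod>m<M. 1 - q ^ (2 * m + 1)) = (\<Prod>m<M. norm (1 - q ^ (2 * m + 1)))"
      by (simp add: prod_norm del: power_Suc)
    also have "\<dots> \<le> (\<Prod>m<M. 1 + r ^ (2 * m + 1))"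
    proof (intro prod_mono conjI norm_ge_zero)
      fix m show "norm (1 - q ^ (2 * m + 1)) \<le> 1 + r ^ (2 * m + 1)"
        using norm_triangle_ineq4[of 1 "q ^ (2 * m + 1)"] by (simp only: norm_power q r_def norm_one)
    qed
    also have "\<dots> \<le> exp (\<Sum>m<M. r ^ (2 * m + 1))"
      using r by (intro prod_le_exp_sum) auto
    also have "\<dots> \<le> exp (1 / (2 * s))"
      using sum_geometric_le(2)[OF r, of M] geometric_tail_le(2)[OF s r_def] by simp
    finally show ?thesis .
  qed
  then show "norm (euler_prod q / euler_prod (q\<^sup>2)) \<le> exp (1 / (2 * s))"
    by (intro LIMSEQ_le_const2[OF tendsto_norm[OF lim] exI[of _ 0]]) auto
qed

text \<open>For the first M factors the inner geometric sums are explicit: the logarithm is the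
  Lambert series with weights 1 - r^(M(l+1)). These lie between 1 - r^M and 1, so a squeeze takes
  the place of an exchange of two infinite sums.\<close>

lemma euler_prod_real:
  assumes z: "z > 0"
  shows "euler_prod (of_real (exp (- (2 * pi * z)))) = of_real (exp (- (\<Sum>l. lambert z l)))"
proof -
  define r where "r = exp (- (2 * pi * z))"
  have r: "0 < r" "r < 1" using z by (auto simp: r_def)
  have rl: "r ^ Suc l < 1" for l using r by (simp add: power_Suc_less_one del: power_Suc)
  have lam: "lambert z l = r ^ Suc l / (1 - r ^ Suc l) / real (Suc l)" for l
  proof -
    have e: "exp (2 * pi * real (Suc l) * z) = 1 / r ^ Suc l"
    proof -
      have "r ^ Suc l = exp (- (2 * pi * real (Suc l) * z))"
        by (simp only: r_def exp_minus_power) (simp add: mult_ac del: of_nat_Suc)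
      then show ?thesis by (simp add: exp_minus inverse_eq_divide del: of_nat_Suc power_Suc)
    qed
    show ?thesis unfolding lambert_def e using rl[of l] r(1) by (simp add: field_simps del: power_Suc of_nat_Suc)
  qed
  define S where "S = (\<lambda>M. \<Sum>m<M. - ln (1 - r ^ Suc m))"
  have Ssums: "(\<lambda>l. lambert z l * (1 - r ^ (M * Suc l))) sums S M" for M
  proof -
    have "(\<lambda>l. (\<Sum>m<M. (r ^ Suc m) ^ Suc l) / real (Suc l)) sums S M"
      unfolding S_def using r rl by (intro sum_neg_ln_sums) (auto simp del: power_Suc)
    moreover have "(\<Sum>m<M. (r ^ Suc m) ^ Suc l) / real (Suc l) = lambert z l * (1 - r ^ (M * Suc l))" for l
    proof -
      define x where "x = r ^ Suc l"
      have x: "x < 1" using rl by (simp add: x_def)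
      have "(\<Sum>m<M. (r ^ Suc m) ^ Suc l) = x * (\<Sum>m<M. x ^ m)"
        unfolding sum_distrib_left x_def power_mult[symmetric]
        by (intro sum.cong refl) (simp flip: power_add add: algebra_simps)
      also have "\<dots> = x * ((1 - x ^ M) / (1 - x))" using x by (simp add: sum_gp_strict)
      moreover have "r ^ (M * Suc l) = x ^ M" by (simp only: x_def power_mult[symmetric] mult.commute)
      ultimately show ?thesis unfolding lam x_def[symmetric] by simp
    qed
    ultimately show ?thesis by simp
  qed
  have Sl: "S \<longlonglongrightarrow> (\<Sum>l. lambert z l)"
  proof (rule tendsto_sandwich[where h = "\<lambda>_. \<Sum>l. lambert z l" and f = "\<lambda>M. (\<Sum>l. lambert z l) * (1 - r ^ M)"])
    have "lambert z l * (1 - r ^ M) \<le> lambert z l * (1 - r ^ (M * Suc l))" for l M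
      using r lambert_nonneg[OF z] by (intro mult_left_mono diff_left_mono power_decreasing) auto
    then show "\<forall>\<^sub>F M in sequentially. (\<Sum>l. lambert z l) * (1 - r ^ M) \<le> S M"
      using sums_le[OF _ sums_mult2[OF summable_sums[OF summable_lambert[OF z]]] Ssums] by auto
    have "lambert z l * (1 - r ^ (M * Suc l)) \<le> lambert z l" for l M
      using r lambert_nonneg[OF z, of l] by (simp add: mult_left_le)
    then show "\<forall>\<^sub>F M in sequentially. S M \<le> (\<Sum>l. lambert z l)"
      using sums_le[OF _ Ssums summable_sums[OF summable_lambert[OF z]]] by auto
    have "(\<lambda>M. (\<Sum>l. lambert z l) * (1 - r ^ M)) \<longlonglongrightarrow> (\<Sum>l. lambert z l) * (1 - 0)"
      using r by (intro tendsto_intros LIMSEQ_power_zero) auto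
    then show "(\<lambda>M. (\<Sum>l. lambert z l) * (1 - r ^ M)) \<longlonglongrightarrow> (\<Sum>l. lambert z l)" by simp
  qed auto
  have eq: "(\<Prod>m<M. 1 - complex_of_real r ^ Suc m) = of_real (exp (- S M))" for M
  proof -
    have "(\<Prod>m<M. 1 - r ^ Suc m) = exp (- S M)"
      unfolding S_def sum_negf[symmetric] using rl by (subst exp_sum) (auto intro!: prod.cong simp del: power_Suc)
    then have "of_real (exp (- S M)) = (\<Prod>m<M. complex_of_real (1 - r ^ Suc m))" by (metis of_real_prod)
    then show ?thesis by simp
  qed
  have "(\<lambda>M. \<Prod>m<M. 1 - complex_of_real r ^ Suc m) \<longlonglongrightarrow> of_real (exp (- (\<Sum>l. lambert z l)))"
    unfolding eq by (intro tendsto_intros Sl)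
  moreover have "(\<lambda>M. \<Prod>m<M. 1 - complex_of_real r ^ Suc m) \<longlonglongrightarrow> euler_prod (of_real r)"
    using r by (intro euler_prod_LIMSEQ) auto
  ultimately show ?thesis using LIMSEQ_unique r_def by blast
qed

lemma Re_inverse_pos: "Re z > 0 \<Longrightarrow> Re (1 / z) > 0"
  by (auto simp: Re_divide sum_power2_gt_zero_iff intro!: divide_pos_pos)

text \<open>The inversion of the Dedekind eta function at i z, with the fractional powers of q from
  both sides collected in one exponential. On the positive axis it is \<open>lambert_reflect\<close>
  exponentiated; both sides are holomorphic in the right half-plane, where \<open>csqrt\<close>
  stays off its cut, so the identity theorem applies.\<close>

theorem euler_prod_reflect:
  assumes z: "Re z > 0"
  shows "euler_prod (exp (- (2 * of_real pi * z))) * csqrt z =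
    exp (of_real pi * z / 12 - of_real pi / (12 * z)) * euler_prod (exp (- (2 * of_real pi / z)))"
proof -
  define S where "S = {z::complex. Re z > 0}"
  define f where "f = (\<lambda>z. euler_prod (exp (- (2 * of_real pi * z))) * csqrt z -
    exp (of_real pi * z / 12 - of_real pi / (12 * z)) * euler_prod (exp (- (2 * of_real pi / z))))"
  have n2: "norm (exp (- (2 * of_real pi / z))) < 1" if "Re z > 0" for z
  proof -
    have "2 * of_real pi / z = of_real (2 * pi) * (1 / z)" by simp
    then have "Re (2 * of_real pi / z) = 2 * pi * Re (1 / z)" by (metis Re_complex_of_real Im_complex_of_real times_complex.simps(1) mult_zero_left diff_zero)
    then show ?thesis using Re_inverse_pos[OF that] by (simp del: times_divide_eq_right)
  qed
  have "f z = 0"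
  proof (rule analytic_continuation[where f = f and w = z and S = S and U = "of_real ` {0<..}" and \<xi> = 1])
    show "f holomorphic_on S"
      unfolding f_def S_def
      by (intro holomorphic_intros) (use n2 in \<open>auto simp: complex_nonpos_Reals_iff\<close>)
    show "open S" unfolding S_def by (rule open_halfspace_Re_gt)
    show "connected S" unfolding S_def by (intro convex_connected convex_halfspace_Re_gt)
    show "(1::complex) islimpt of_real ` {0<..}"
    proof (rule islimptI)
      fix T :: "complex set" assume "1 \<in> T" "open T"
      then obtain e where e: "e > 0" "ball 1 e \<subseteq> T" by (meson open_contains_ball)
      have "of_real (1 + e / 2) \<in> ball (1::complex) e" using e(1) by (simp add: dist_norm)
      then show "\<exists>y\<in>complex_of_real ` {0<..}. y \<in> T \<and> y \<noteq> 1"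
        using e by (intro bexI[of _ "of_real (1 + e / 2)"] imageI) auto
    qed
    fix w :: complex assume "w \<in> of_real ` {0<..}"
    then obtain x where x: "x > 0" "w = of_real x" by auto
    have e1: "exp (- (2 * of_real pi * w)) = of_real (exp (- (2 * pi * x)))"
      by (simp add: x exp_of_real[symmetric])
    have e2: "exp (- (2 * of_real pi / w)) = of_real (exp (- (2 * pi * (1 / x))))"
      by (simp add: x exp_of_real[symmetric])
    have e3: "exp (of_real pi * w / 12 - of_real pi / (12 * w)) = of_real (exp (pi * x / 12 - pi / (12 * x)))"
      by (simp add: x exp_of_real[symmetric])
    have e4: "csqrt w = of_real (exp (ln x / 2))"
    proof -
      have "exp (ln x / 2) = sqrt x" using x(1) by (simp add: exp_ln ln_sqrt[symmetric])
      then show ?thesis using x by (simp add: csqrt_of_real_nonneg)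
    qed
    have "exp (- (\<Sum>l. lambert x l)) * exp (ln x / 2) = exp (pi * x / 12 - pi / (12 * x)) * exp (- (\<Sum>l. lambert (1/x) l))"
      using lambert_reflect[OF x(1)] unfolding exp_add[symmetric] by (intro arg_cong[where f = exp]) linarith
    then show "f w = 0"
      unfolding f_def e1 e2 e3 e4 using x(1) euler_prod_real[of x] euler_prod_real[of "1/x"]
      by (simp flip: of_real_mult)
  qed (use z in \<open>auto simp: S_def\<close>)
  then show ?thesis by (simp add: f_def)
qed


section \<open>Coefficients as integrals\<close>

text \<open>Orthogonality of the exponentials over one full period, on a vertical segment.\<close>

lemma integral_exp_frequency:
  fixes d :: int
  shows "((\<lambda>t. exp (2 * of_real pi * of_int d * Complex \<rho> t)) has_integral (if d = 0 then 1 else 0)) {-(1/2)..1/2}"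
proof (cases "d = 0")
  case True
  have "((\<lambda>t::real. 1::complex) has_integral 1) {-(1/2)..1/2}"
    using has_integral_const_real[of "1::complex" "-(1/2)" "1/2 :: real"] by (simp add: content_real)
  then show ?thesis using True by simp
next
  case False
  define G where "G = (\<lambda>t. exp (2 * of_real pi * of_int d * Complex \<rho> t) / (2 * of_real pi * of_int d * \<i>))"
  have z: "Complex \<rho> t = of_real \<rho> + \<i> * of_real t" for t by (simp add: complex_eq_iff)
  have "((\<lambda>t. exp (2 * of_real pi * of_int d * Complex \<rho> t)) has_integral (G (1/2) - G (-(1/2)))) {-(1/2)..1/2}"
  proof (rule fundamental_theorem_of_calculus)
    fix t :: real
    have "((\<lambda>w. exp (2 * of_real pi * of_int d * (of_real \<rho> + \<i> * w)) / (2 * of_real pi * of_int d * \<i>))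
       has_field_derivative exp (2 * of_real pi * of_int d * (of_real \<rho> + \<i> * of_real t))) (at (of_real t))"
      using False by (auto intro!: derivative_eq_intros)
    from has_vector_derivative_real_field[OF this]
    show "(G has_vector_derivative exp (2 * of_real pi * of_int d * Complex \<rho> t)) (at t within {-(1/2)..1/2})"
      unfolding G_def z by (rule has_vector_derivative_at_within)
  qed simp
  moreover have "G (1/2) = G (-(1/2))"
  proof -
    have "2 * of_real pi * of_int d * Complex \<rho> (1/2) = 2 * of_real pi * of_int d * Complex \<rho> (-(1/2)) + of_int (2 * d) * (of_real pi * \<i>)"
      by (simp add: z algebra_simps)
    moreover have "exp (of_int (2 * d) * (of_real pi * \<i>)) = 1"
      using exp_integer_2pi[of "of_int d"] by (simp add: mult_ac)
    ultimately have "exp (2 * of_real pi * of_int d * Complex \<rho> (1/2)) = exp (2 * of_real pi * of_int d * Complex \<rho> (-(1/2)))"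
      by (simp add: exp_add)
    then show ?thesis by (simp add: G_def)
  qed
  ultimately show ?thesis using False by simp
qed

text \<open>Cauchy's coefficient formula in the coordinate q = exp(-2 pi z), where a circle around 0
  becomes a segment Re z = \<rho>. The power series is integrated term by term.\<close>

lemma fps_coeff_has_integral:
  assumes hol: "f holomorphic_on ball 0 1" and exp: "f has_fps_expansion F" and \<rho>: "\<rho> > 0"
  shows "((\<lambda>t. f (exp (- (2 * of_real pi * Complex \<rho> t))) * exp (2 * of_real pi * of_nat n * Complex \<rho> t))
    has_integral fps_nth F n) {-(1/2)..1/2}"
proof -
  define c where "c = fps_nth F"
  define q where "q = (\<lambda>t. exp (- (2 * of_real pi * Complex \<rho> t)))"
  define E where "E = (\<lambda>t. exp (2 * of_real pi * of_nat n * Complex \<rho> t))"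
  define r where "r = exp (- (2 * pi * \<rho>))"
  have r: "0 < r" "r < 1" using \<rho> by (auto simp: r_def)
  have nq: "norm (q t) = r" for t by (simp add: q_def r_def)
  have nE: "norm (E t) = exp (2 * pi * real n * \<rho>)" for t by (simp add: E_def)
  have sums: "(\<lambda>j. c j * w ^ j) sums f w" if "norm w < 1" for w
    unfolding c_def by (rule has_fps_expansion_imp_sums_complex[OF exp, of 1]) (use that hol in \<open>auto simp: one_ereal_def\<close>)
  \<comment> \<open>Convergence at the larger point (r+1)/2 < 1 gives absolute convergence at r, and
    with it a majorant that does not depend on t.\<close>
  have "summable (\<lambda>j. norm (c j * of_real r ^ j))"
  proof (rule powser_insidea)
    show "summable (\<lambda>j. c j * of_real ((r + 1) / 2) ^ j)"
      using r by (intro sums_summable[OF sums]) (unfold norm_of_real abs_if, simp)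
    show "norm (complex_of_real r) < norm (complex_of_real ((r + 1) / 2))"
      using r unfolding norm_of_real abs_if by simp
  qed
  then have "summable (\<lambda>j. norm (c j) * r ^ j * exp (2 * pi * real n * \<rho>))"
    using r by (intro summable_mult2) (simp add: norm_mult norm_power)
  then have "uniform_limit {-(1/2)..1/2} (\<lambda>N t. \<Sum>j<N. c j * q t ^ j * E t) (\<lambda>t. \<Sum>j. c j * q t ^ j * E t) sequentially"
    by (intro Weierstrass_m_test) (simp_all add: norm_mult norm_power nq nE)
  moreover have "(\<Sum>j. c j * q t ^ j * E t) = f (q t) * E t" for t
    using sums_mult2[OF sums[of "q t"], of "E t"] nq[of t] r by (simp add: sums_iff)
  ultimately have ul: "uniform_limit {-(1/2)..1/2} (\<lambda>N t. \<Sum>j<N. c j * q t ^ j * E t) (\<lambda>t. f (q t) * E t) sequentially"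
    by simp
  have cont: "continuous_on {-(1/2)..1/2} (\<lambda>t. \<Sum>j<N. c j * q t ^ j * E t)" for N
    unfolding q_def E_def by (auto simp: Complex_eq intro!: continuous_intros)
  obtain I J where IJ: "\<And>N. ((\<lambda>t. \<Sum>j<N. c j * q t ^ j * E t) has_integral I N) {-(1/2)..1/2}"
    "((\<lambda>t. f (q t) * E t) has_integral J) {-(1/2)..1/2}" "I \<longlonglongrightarrow> J"
    using uniform_limit_integral[OF ul cont] by auto
  have "I N = c n" if "N > n" for N
  proof -
    have "((\<lambda>t. \<Sum>j<N. c j * q t ^ j * E t) has_integral (\<Sum>j<N. c j * (if j = n then 1 else 0))) {-(1/2)..1/2}"
    proof (intro has_integral_sum finite_lessThan)
      fix j
      have eq: "c j * q t ^ j * E t = c j * exp (2 * of_real pi * of_int (int n - int j) * Complex \<rho> t)" for t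
      proof -
        have "q t ^ j * E t = exp (of_nat j * (- (2 * of_real pi * Complex \<rho> t)) + 2 * of_real pi * of_nat n * Complex \<rho> t)"
          unfolding q_def E_def exp_of_nat_mult[symmetric] exp_add[symmetric] ..
        also have "of_nat j * (- (2 * of_real pi * Complex \<rho> t)) + 2 * of_real pi * of_nat n * Complex \<rho> t =
            2 * of_real pi * of_int (int n - int j) * Complex \<rho> t"
          by (simp add: algebra_simps)
        finally show ?thesis by (simp only: mult.assoc)
      qed
      show "((\<lambda>t. c j * q t ^ j * E t) has_integral c j * (if j = n then 1 else 0)) {-(1/2)..1/2}"
        unfolding eq using integral_exp_frequency[of "int n - int j" \<rho>]
        by (intro has_integral_mult_right) (auto split: if_splits)
    qed
    moreover have "(\<Sum>j<N. c j * (if j = n then 1 else 0)) = c n"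
      using that by (subst sum.remove[of _ n]) auto
    ultimately show ?thesis using has_integral_unique[OF IJ(1)[of N]] by simp
  qed
  then have "eventually (\<lambda>N. I N = c n) sequentially"
    by (rule eventually_mono[OF eventually_gt_at_top])
  then have "J = c n" by (intro LIMSEQ_unique[OF IJ(3)] tendsto_eventually)
  then show ?thesis using IJ(2) by (simp add: c_def q_def E_def)
qed

section \<open>From the formal product to the analytic one\<close>

definition fps_complex :: "real fps \<Rightarrow> complex fps" where
  "fps_complex f = Abs_fps (\<lambda>n. of_real (fps_nth f n))"

lemma fps_complex_nth [simp]: "fps_nth (fps_complex f) n = of_real (fps_nth f n)"
  by (simp add: fps_complex_def)

lemma fps_complex_mult: "fps_complex (f * g) = fps_complex f * fps_complex g"
  by (rule fps_ext) (simp add: fps_mult_nth)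

lemma fps_complex_diff: "fps_complex (f - g) = fps_complex f - fps_complex g"
  by (rule fps_ext) simp

lemma fps_complex_1: "fps_complex 1 = 1"
  by (rule fps_ext) simp

lemma fps_complex_X_power: "fps_complex (fps_X ^ m) = fps_X ^ m"
  by (rule fps_ext) simp

lemma fps_complex_power: "fps_complex (f ^ m) = fps_complex f ^ m"
  by (induction m) (auto simp: fps_complex_1 fps_complex_mult)

lemma fps_complex_prod: "fps_complex (prod f A) = (\<Prod>x\<in>A. fps_complex (f x))"
  by (induction A rule: infinite_finite_induct) (auto simp: fps_complex_1 fps_complex_mult)

lemma fps_complex_inverse:
  assumes "fps_nth f 0 \<noteq> 0"
  shows "fps_complex (inverse f) = inverse (fps_complex f)"
proof (rule fps_inverse_unique[symmetric])
  have "fps_complex f * fps_complex (inverse f) = fps_complex (f * inverse f)" by (simp add: fps_complex_mult)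
  also have "f * inverse f = 1" using assms by (rule inverse_mult_eq_1')
  finally show "fps_complex f * fps_complex (inverse f) = 1" by (simp add: fps_complex_1)
qed

lemma dvd_one_minus_mult:
  fixes y a b :: "'a::comm_ring_1"
  assumes "y dvd a - 1" "y dvd b - 1"
  shows "y dvd a * b - 1"
proof -
  have "a * b - 1 = (a - 1) * b + (b - 1)" by (simp add: algebra_simps)
  then show ?thesis using assms by (simp only: dvd_add dvd_mult2)
qed

text \<open>Every constituent is 1 minus a positive power of y = X^m, or built from such terms, and
  being congruent to 1 modulo y is preserved by products and inverses.\<close>

lemma Delta_factor_cong_1: "fps_X ^ m dvd Delta_factor k m - 1"
proof (cases "m = 0")
  case False
  define y where "y = (fps_X ^ m :: real fps)"
  have y0: "fps_nth y 0 = 0" using False by (simp add: y_def)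
  have d: "y dvd (1 - y ^ Suc j) - 1" for j by simp
  have d1: "y dvd (1 - y) - 1" using d[of 0] by simp
  have d2: "y dvd (1 - y ^ 2) - 1" using d[of 1] by (simp add: numeral_2_eq_2)
  have d3: "y dvd (1 - y ^ (2*k+1)) - 1" using d[of "2*k"] by simp
  have d4: "y dvd (1 - y ^ (4*k+2)) - 1" using d[of "4*k+1"] by simp
  define D where "D = (1 - y) ^ 3 * (1 - y ^ (4*k+2))"
  have dD: "y dvd D - 1" unfolding D_def power3_eq_cube by (intro dvd_one_minus_mult d1 d4)
  have D0: "fps_nth D 0 = 1" unfolding D_def using y0 by (simp add: fps_nth_power_0 power_0_left)
  have "inverse D - 1 = - (D - 1) * inverse D"
    using inverse_mult_eq_1'[of D] D0 by (simp add: algebra_simps)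
  then have "y dvd inverse D - 1" using dD by (metis dvd_minus_iff dvd_mult2)
  then have "y dvd (1 - y ^ 2) * (1 - y ^ (2*k+1)) * inverse D - 1"
    by (intro dvd_one_minus_mult d2 d3)
  then show ?thesis
    unfolding Delta_factor_def D_def y_def power_mult[symmetric] by (simp only: mult.commute)
qed simp

lemma Delta_truncation:
  assumes "n \<le> M"
  shows "fps_nth (\<Prod>m\<in>{1..M}. Delta_factor k m) n = Delta k n"
  using assms
proof (induction M rule: dec_induct)
  case base then show ?case by (simp add: Delta_def)
next
  case (step M)
  obtain h where h: "Delta_factor k (Suc M) - 1 = fps_X ^ Suc M * h"
    using Delta_factor_cong_1[of "Suc M" k] by (auto elim: dvdE)
  define P where "P = (\<Prod>m\<in>{1..M}. Delta_factor k m)"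
  have "(\<Prod>m\<in>{1..Suc M}. Delta_factor k m) = P * (1 + fps_X ^ Suc M * h)"
    using h by (simp add: P_def algebra_simps)
  also have "\<dots> = P + fps_X ^ Suc M * (P * h)" by (simp add: algebra_simps)
  finally show ?case using step by (simp add: fps_X_power_mult_nth P_def del: power_Suc)
qed

definition Delta_factor_fun :: "nat \<Rightarrow> nat \<Rightarrow> complex \<Rightarrow> complex" where
  "Delta_factor_fun k m q = (1 - q ^ (2*m)) * (1 - q ^ ((2*k+1)*m)) *
     inverse ((1 - q ^ m) ^ 3 * (1 - q ^ ((4*k+2)*m)))"

lemma Delta_factor_fun_expansion:
  assumes "m > 0"
  shows "Delta_factor_fun k m has_fps_expansion fps_complex (Delta_factor k m)"
proof -
  define D :: "real fps" where "D = (1 - fps_X ^ m) ^ 3 * (1 - fps_X ^ ((4*k+2)*m))"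
  have D0: "fps_nth D 0 = 1" unfolding D_def using assms by (simp add: fps_nth_power_0 power_0_left)
  have Dc: "fps_complex D = (1 - fps_X ^ m) ^ 3 * (1 - fps_X ^ ((4*k+2)*m))"
    unfolding D_def by (simp only: fps_complex_mult fps_complex_diff fps_complex_1 fps_complex_X_power fps_complex_power[of "1 - _"])
  have "fps_complex (Delta_factor k m) = (1 - fps_X ^ (2*m)) * (1 - fps_X ^ ((2*k+1)*m)) * inverse (fps_complex D)"
    unfolding Delta_factor_def D_def[symmetric] using D0
    by (simp only: fps_complex_mult fps_complex_diff fps_complex_1 fps_complex_X_power fps_complex_inverse zero_neq_one not_False_eq_True)
  moreover have "Delta_factor_fun k m has_fps_expansion (1 - fps_X ^ (2*m)) * (1 - fps_X ^ ((2*k+1)*m)) * inverse (fps_complex D)"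
    unfolding Delta_factor_fun_def[abs_def] Dc
    by (intro fps_expansion_intros) (use assms in \<open>auto simp: fps_nth_power_0 power_0_left\<close>)
  ultimately show ?thesis by simp
qed

lemma power_pos_neq_1: "norm (q::complex) < 1 \<Longrightarrow> m > 0 \<Longrightarrow> 1 - q ^ m \<noteq> 0"
  using power_Suc_neq_1[of q "m - 1"] by (auto simp del: power_Suc)

lemma Delta_factor_fun_holomorphic: "m > 0 \<Longrightarrow> Delta_factor_fun k m holomorphic_on ball 0 1"
  unfolding Delta_factor_fun_def by (intro holomorphic_intros) (auto simp only: mult_eq_0_iff power_eq_0_iff power_pos_neq_1 mem_ball dist_0_norm mult_pos_pos add_pos_pos zero_less_numeral)

definition Delta_gf :: "nat \<Rightarrow> complex \<Rightarrow> complex" where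
  "Delta_gf k q = euler_prod (q ^ 2) * euler_prod (q ^ (2*k+1)) / (euler_prod q ^ 3 * euler_prod (q ^ (4*k+2)))"

text \<open>Each of the two numerator factors is at most 1 + r^m <= 1/(1 - r^m), and the denominator
  contributes four reciprocals; hence the sixth power. Its product over m converges, which is all
  that a dominating function requires.\<close>

lemma norm_Delta_factor_fun_le:
  assumes q: "norm q = r" and r: "0 < r" "r < 1" and m: "m > 0"
  shows "norm (Delta_factor_fun k m q) \<le> inverse (1 - r ^ m) ^ 6"
proof -
  have rm: "0 < r ^ m" "r ^ m < 1" using r m by (auto simp: power_less_one_iff)
  have pw: "r ^ (j * m) \<le> r ^ m" if "j > 0" for j
    using r that by (intro power_decreasing) auto
  have I: "1 + r ^ m \<le> inverse (1 - r ^ m)"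
  proof -
    have "(1 + r ^ m) * (1 - r ^ m) \<le> 1" by (simp add: algebra_simps)
    then show ?thesis using rm by (simp add: field_simps)
  qed
  have up: "norm (1 - q ^ (j * m)) \<le> inverse (1 - r ^ m)" if "j > 0" for j
  proof -
    have "norm (1 - q ^ (j * m)) \<le> 1 + r ^ (j * m)"
      using norm_triangle_ineq4[of 1 "q ^ (j * m)"] by (simp add: norm_power q)
    then show ?thesis using pw[OF that] I by linarith
  qed
  have lo: "norm (inverse (1 - q ^ (j * m))) \<le> inverse (1 - r ^ m)" if "j > 0" for j
  proof -
    have "norm (inverse (1 - q ^ (j * m))) \<le> inverse (1 - norm (q ^ (j * m)))"
      using pw[OF that] rm by (intro norm_inverse_one_minus_le) (simp add: norm_power q)
    also have "\<dots> \<le> inverse (1 - r ^ m)"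
      using pw[OF that] rm by (intro le_imp_inverse_le) (auto simp: norm_power q)
    finally show ?thesis .
  qed
  have "norm (Delta_factor_fun k m q) = norm (1 - q ^ (2*m)) * norm (1 - q ^ ((2*k+1)*m)) *
     (norm (inverse (1 - q ^ m)) ^ 3 * norm (inverse (1 - q ^ ((4*k+2)*m))))"
    unfolding Delta_factor_fun_def norm_mult inverse_mult_distrib norm_power power_inverse[symmetric] ..
  also have "\<dots> \<le> inverse (1 - r ^ m) * inverse (1 - r ^ m) * (inverse (1 - r ^ m) ^ 3 * inverse (1 - r ^ m))"
    using lo[of 1] rm
    by (intro mult_mono up lo power_mono mult_nonneg_nonneg zero_le_power norm_ge_zero) auto
  also have "\<dots> = inverse (1 - r ^ m) ^ 6" by (simp add: eval_nat_numeral)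
  finally show ?thesis .
qed

lemma prod_Delta_factor_fun_LIMSEQ:
  assumes q: "norm q < 1"
  shows "(\<lambda>M. \<Prod>m\<in>{1..M}. Delta_factor_fun k m q) \<longlonglongrightarrow> Delta_gf k q"
proof -
  have nj: "norm (q ^ j) < 1" if "j > 0" for j using norm_power_Suc_less_1[OF q, of "j - 1"] that by simp
  define P where "P = (\<lambda>j M. \<Prod>m<M. 1 - (q ^ j) ^ Suc m)"
  have Pl: "P j \<longlonglongrightarrow> euler_prod (q ^ j)" if "j > 0" for j
    unfolding P_def by (rule euler_prod_LIMSEQ[OF nj[OF that]])
  have "(\<lambda>M. P 2 M * P (2*k+1) M / (P 1 M ^ 3 * P (4*k+2) M)) \<longlonglongrightarrow>
    euler_prod (q ^ 2) * euler_prod (q ^ (2*k+1)) / (euler_prod (q ^ 1) ^ 3 * euler_prod (q ^ (4*k+2)))"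
    by (intro tendsto_intros Pl) (simp_all only: mult_eq_0_iff power_eq_0_iff euler_prod_nonzero nj zero_less_one add_gr_0 zero_less_numeral simp_thms)
  moreover have "(\<Prod>m\<in>{1..M}. Delta_factor_fun k m q) = P 2 M * P (2*k+1) M / (P 1 M ^ 3 * P (4*k+2) M)" for M
  proof -
    have "(\<Prod>m\<in>{1..M}. Delta_factor_fun k m q) = (\<Prod>m<M. Delta_factor_fun k (Suc m) q)"
      by (simp add: prod.atLeast1_atMost_eq)
    also have "\<dots> = P 2 M * P (2*k+1) M / (P 1 M ^ 3 * P (4*k+2) M)"
      unfolding P_def Delta_factor_fun_def
      by (simp only: prod.distrib prod_dividef prod_power_distrib[symmetric] divide_inverse[symmetric] power_mult[symmetric] mult_1_left)
    finally show ?thesis .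
  qed
  ultimately show ?thesis by (simp add: Delta_gf_def)
qed

text \<open>For every finite product with at least n factors the integral is already equal to the
  coefficient. The sequence of integrals is constant, so dominated convergence carries the formula
  to the infinite product without expanding that product.\<close>

theorem Delta_has_integral:
  assumes \<rho>: "\<rho> > 0"
  shows "((\<lambda>t. Delta_gf k (exp (- (2 * of_real pi * Complex \<rho> t))) * exp (2 * of_real pi * of_nat n * Complex \<rho> t))
    has_integral of_real (Delta k n)) {-(1/2)..1/2}"
proof -
  define q where "q = (\<lambda>t. exp (- (2 * of_real pi * Complex \<rho> t)))"
  define E where "E = (\<lambda>t. exp (2 * of_real pi * of_nat n * Complex \<rho> t))"
  define s where "s = 2 * pi * \<rho>"
  have s: "s > 0" using \<rho> by (simp add: s_def)
  have nq: "norm (q t) = exp (- s)" for t by (simp add: q_def s_def)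
  have nE: "norm (E t) = exp (2 * pi * real n * \<rho>)" for t by (simp add: E_def)
  \<comment> \<open>Starting with n factors makes \<open>Delta_truncation\<close> applicable to each
    member of the sequence.\<close>
  define f where "f = (\<lambda>M t. (\<Prod>m\<in>{1..n + M}. Delta_factor_fun k m (q t)) * E t)"
  have fi: "(f M has_integral of_real (Delta k n)) {-(1/2)..1/2}" for M
  proof -
    have "((\<lambda>q. \<Prod>m\<in>{1..n + M}. Delta_factor_fun k m q) has_fps_expansion (\<Prod>m\<in>{1..n + M}. fps_complex (Delta_factor k m)))"
      by (intro has_fps_expansion_prod Delta_factor_fun_expansion) auto
    note fps_coeff_has_integral[OF _ this \<rho>, of n]
    moreover have "(\<lambda>q. \<Prod>m\<in>{1..n + M}. Delta_factor_fun k m q) holomorphic_on ball 0 1"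
      by (intro holomorphic_intros Delta_factor_fun_holomorphic) auto
    ultimately have "(f M has_integral fps_nth (\<Prod>m\<in>{1..n + M}. fps_complex (Delta_factor k m)) n) {-(1/2)..1/2}"
      unfolding f_def q_def E_def by blast
    then show ?thesis unfolding fps_complex_prod[symmetric] fps_complex_nth by (simp only: Delta_truncation[OF le_add1])
  qed
  define h where "h = (\<lambda>t::real. exp (pi\<^sup>2 / (6 * s)) ^ 6 * exp (2 * pi * real n * \<rho>))"
  have le: "norm (f M t) \<le> h t" for M t
  proof -
    have "norm (\<Prod>m\<in>{1..n + M}. Delta_factor_fun k m (q t)) \<le> (\<Prod>m\<in>{1..n+M}. inverse (1 - exp (- s) ^ m) ^ 6)"
      unfolding prod_norm[symmetric] using s nq by (intro prod_mono conjI norm_ge_zero norm_Delta_factor_fun_le) auto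
    also have "\<dots> = (\<Prod>m<n+M. inverse (1 - exp (- s) ^ Suc m)) ^ 6"
      by (simp add: prod.atLeast1_atMost_eq prod_power_distrib)
    also have "\<dots> \<le> exp (pi\<^sup>2 / (6 * s)) ^ 6"
    proof (rule power_mono[OF prod_inverse_le_exp[OF s]], rule prod_nonneg)
      fix m
      have "exp (- s) ^ Suc m < 1" using s by (simp add: power_less_one_iff del: power_Suc)
      then show "0 \<le> inverse (1 - exp (- s) ^ Suc m)" by simp
    qed
    finally show ?thesis unfolding f_def h_def norm_mult nE by (rule mult_right_mono) simp
  qed
  have conv: "(\<lambda>M. f M t) \<longlonglongrightarrow> Delta_gf k (q t) * E t" for t
  proof -
    have "(\<lambda>M. \<Prod>m\<in>{1..M}. Delta_factor_fun k m (q t)) \<longlonglongrightarrow> Delta_gf k (q t)"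
      using nq s by (intro prod_Delta_factor_fun_LIMSEQ) simp
    from LIMSEQ_ignore_initial_segment[OF this, of n]
    show ?thesis unfolding f_def by (intro tendsto_mult tendsto_const) (simp add: add.commute)
  qed
  have "(\<lambda>t. Delta_gf k (q t) * E t) integrable_on {-(1/2)..1/2}"
    "(\<lambda>M. integral {-(1/2)..1/2} (f M)) \<longlonglongrightarrow> integral {-(1/2)..1/2} (\<lambda>t. Delta_gf k (q t) * E t)"
    using dominated_convergence[of f "{-(1/2)..1/2}" h "\<lambda>t. Delta_gf k (q t) * E t"] fi le conv
    by (auto simp: h_def has_integral_integrable[OF fi])
  note int = this(1) this(2)[unfolded integral_unique[OF fi]]
  have "of_real (Delta k n) = integral {-(1/2)..1/2} (\<lambda>t. Delta_gf k (q t) * E t)"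
    by (rule LIMSEQ_unique[OF tendsto_const int(2)])
  then show ?thesis using integrable_integral[OF int(1)] unfolding q_def E_def by simp
qed


section \<open>Transformation and bounds of the generating function\<close>

text \<open>A positive factor leaves the argument alone; the positive real part identifies the
  principal root.\<close>

lemma csqrt_of_real_mult:
  assumes "c > 0" "Re z > 0"
  shows "csqrt (of_real c * z) = of_real (sqrt c) * csqrt z"
proof (rule csqrt_unique)
  show "(of_real (sqrt c) * csqrt z)\<^sup>2 = of_real c * z"
    using assms by (simp add: power_mult_distrib flip: of_real_power)
  have "Re (csqrt z) > 0"
    using assms complex_Re_le_cmod[of z] by (simp add: real_sqrt_gt_0_iff)
  then show "0 < Re (of_real (sqrt c) * csqrt z) \<or> Re (of_real (sqrt c) * csqrt z) = 0 \<and> 0 \<le> Im (of_real (sqrt c) * csqrt z)"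
    using assms by simp
qed

lemma euler_prod_scaled_reflect:
  assumes z: "Re z > 0" and c: "c > 0"
  shows "euler_prod (exp (- (2 * of_real pi * (of_real c * z)))) =
    exp (of_real pi * of_real c * z / 12 - of_real pi / (12 * of_real c * z)) *
    euler_prod (exp (- (2 * of_real pi / (of_real c * z)))) / (of_real (sqrt c) * csqrt z)"
proof -
  have "Re (of_real c * z) > 0" using z c by simp
  from euler_prod_reflect[OF this]
  have "euler_prod (exp (- (2 * of_real pi * (of_real c * z)))) * (of_real (sqrt c) * csqrt z) =
    exp (of_real pi * of_real c * z / 12 - of_real pi / (12 * of_real c * z)) *
    euler_prod (exp (- (2 * of_real pi / (of_real c * z))))"
    unfolding csqrt_of_real_mult[OF c z] by (simp add: mult.assoc)
  moreover have "of_real (sqrt c) * csqrt z \<noteq> 0" using c z by auto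
  ultimately show ?thesis by (simp add: eq_divide_eq)
qed

text \<open>The eta quotient after inversion: with Q = exp(-2 pi/((4k+2) z)), a factor in q^c turns
  into one in Q^((4k+2)/c), so 1 is exchanged with 4k+2 and 2 with 2k+1.\<close>

definition dual_gf :: "nat \<Rightarrow> complex \<Rightarrow> complex" where
  "dual_gf k Q = euler_prod (Q ^ (2*k+1)) * euler_prod (Q ^ 2) / (euler_prod (Q ^ (4*k+2)) ^ 3 * euler_prod Q)"

lemma exp_scaled_power:
  fixes w :: complex
  assumes "real j * a = b"
  shows "exp (- (2 * of_real pi * (of_real a * w))) ^ j = exp (- (2 * of_real pi * (of_real b * w)))"
  unfolding exp_of_nat_mult[symmetric] assms[symmetric] by (intro arg_cong[where f = exp]) simp

theorem Delta_gf_transform: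
  assumes z: "Re z > 0"
  shows "Delta_gf k (exp (- (2 * of_real pi * z))) =
    exp (- (of_real (pi * (real k + 1) / 6) * z)) * z * exp (of_real (pi * alpha_k k / 12) / z) *
      dual_gf k (exp (- (2 * of_real pi / (of_real (real (4*k+2)) * z))))"
proof -
  define P where "P = (\<lambda>c. euler_prod (exp (- (2 * of_real pi * (of_real c * z)))))"
  define R where "R = (\<lambda>c. euler_prod (exp (- (2 * of_real pi / (of_real c * z)))))"
  define e where "e = (\<lambda>c::real. of_real pi * of_real c * z / 12 - of_real pi / (12 * of_real c * z))"
  have z0: "z \<noteq> 0" using z by auto
  define a where "a = real (2*k+1)"
  have a: "a > 0" by (simp add: a_def)
  have PR: "P c = exp (e c) * R c / (of_real (sqrt c) * csqrt z)" if "c > 0" for c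
    unfolding P_def R_def e_def by (rule euler_prod_scaled_reflect[OF z that])
  have Pq: "euler_prod (exp (- (2 * of_real pi * z)) ^ j) = P (real j)" for j
    unfolding P_def using exp_scaled_power[of j 1 "real j" z] by simp
  have RQ: "euler_prod (exp (- (2 * of_real pi / (of_real (2 * a) * z))) ^ j) = R c" if "real j * (1 / (2 * a)) = 1 / c" "c > 0" for j c
  proof -
    have "exp (- (2 * of_real pi * (of_real (1 / (2 * a)) * (1 / z)))) ^ j = exp (- (2 * of_real pi * (of_real (1 / c) * (1 / z))))"
      by (rule exp_scaled_power[OF that(1)])
    then show ?thesis unfolding R_def by simp
  qed
  have a2: "real (4*k+2) = 2 * a" by (simp add: a_def)
  have D: "dual_gf k (exp (- (2 * of_real pi / (of_real (real (4*k+2)) * z)))) = R 2 * R a / (R 1 ^ 3 * R (2*a))"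
  proof -
    have "euler_prod (exp (- (2 * of_real pi / (of_real (2 * a) * z))) ^ (2*k+1)) = R 2"
      by (rule RQ) (use a in \<open>simp_all add: a_def field_simps\<close>)
    moreover have "euler_prod (exp (- (2 * of_real pi / (of_real (2 * a) * z))) ^ 2) = R a"
      by (rule RQ) (use a in simp_all)
    moreover have "euler_prod (exp (- (2 * of_real pi / (of_real (2 * a) * z))) ^ (4*k+2)) = R 1"
      by (rule RQ) (use a in \<open>simp_all add: a_def field_simps\<close>)
    moreover have "euler_prod (exp (- (2 * of_real pi / (of_real (2 * a) * z)))) = R (2*a)"
      using RQ[of 1 "2*a"] a by simp
    ultimately show ?thesis unfolding dual_gf_def a2 by (simp only:)
  qed
  have G: "Delta_gf k (exp (- (2 * of_real pi * z))) = P 2 * P a / (P 1 ^ 3 * P (2*a))"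
    unfolding Delta_gf_def using Pq[of 2] Pq[of "2*k+1"] Pq[of 1] Pq[of "4*k+2"] a2 by (simp add: a_def)
  define X where "X = csqrt z"
  have X: "X \<noteq> 0" "X * X = z" using z0 by (auto simp: X_def power2_eq_square[symmetric])
  have sa: "complex_of_real (sqrt (2*a)) = of_real (sqrt 2) * of_real (sqrt a)" by (simp add: real_sqrt_mult)
  have s0: "complex_of_real (sqrt 2) \<noteq> 0" "complex_of_real (sqrt a) \<noteq> 0" using a by auto
  \<comment> \<open>Two roots \<open>csqrt z\<close> come from the numerator and four from the
    denominator, which leaves the factor z; the constants cancel because sqrt 2 sqrt a =
    sqrt(2a).\<close>
  have "P 2 * P a / (P 1 ^ 3 * P (2*a)) = (exp (e 2) * exp (e a) / (exp (e 1) ^ 3 * exp (e (2*a)))) * (X * X) * (R 2 * R a / (R 1 ^ 3 * R (2*a)))"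
    using a X(1) s0 by (simp add: PR X_def[symmetric] sa sa[unfolded mult.commute[of 2 a]] power3_eq_cube mult_ac)
  also have "exp (e 2) * exp (e a) / (exp (e 1) ^ 3 * exp (e (2*a))) = exp (e 2 + e a - (3 * e 1 + e (2*a)))"
    by (simp add: exp_add exp_diff exp_of_nat_mult[of 3, symmetric, simplified])
  also have "e 2 + e a - (3 * e 1 + e (2*a)) = - (of_real (pi * (real k + 1) / 6) * z) + of_real (pi * alpha_k k / 12) / z"
  proof -
    have al: "alpha_k k = 5 / 2 - 1 / (2 * a)" using a by (simp add: alpha_k_def a_def field_simps)
    have "2 + a - 3 - 2 * a = - (2 * (real k + 1))" by (simp add: a_def)
    then have 1: "complex_of_real pi * of_real (2 + a - 3 - 2 * a) * z / 12 = - (of_real (pi * (real k + 1) / 6) * z)"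
      by (simp only:) (simp add: field_simps)
    have a0: "complex_of_real a \<noteq> 0" using a by simp
    have 2: "- of_real pi / 12 * (1 / 2 + 1 / of_real a - 3 - 1 / (2 * of_real a)) / z = of_real (pi * alpha_k k / 12) / z"
      unfolding al using a0 z0 by (simp add: divide_simps) (simp add: algebra_simps)
    have "e 2 + e a - (3 * e 1 + e (2*a)) = complex_of_real pi * of_real (2 + a - 3 - 2 * a) * z / 12
       + (- of_real pi / 12 * (1 / 2 + 1 / of_real a - 3 - 1 / (2 * of_real a)) / z)"
      using a0 z0 by (simp add: e_def field_simps)
    then show ?thesis unfolding 1 2 .
  qed
  finally show ?thesis unfolding G D by (simp only: exp_add X(2) mult_ac)
qed

text \<open>The shape exp a - 1 is chosen because it is closed under products: the exponents add
  up.\<close>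

lemma norm_minus_1_mult_le:
  fixes x y :: "'a::real_normed_algebra_1"
  assumes "norm (x - 1) \<le> exp a - 1" "norm (y - 1) \<le> exp b - 1"
  shows "norm (x * y - 1) \<le> exp (a + b) - 1"
proof -
  have eq: "x * y - 1 = (x - 1) * (y - 1) + (x - 1) + (y - 1)" by (simp add: algebra_simps)
  have "norm (x * y - 1) \<le> norm (x - 1) * norm (y - 1) + norm (x - 1) + norm (y - 1)"
    unfolding eq using norm_triangle_ineq[of "(x - 1) * (y - 1) + (x - 1)" "y - 1"]
      norm_triangle_ineq[of "(x - 1) * (y - 1)" "x - 1"] norm_mult_ineq[of "x - 1" "y - 1"] by linarith
  also have "\<dots> \<le> (exp a - 1) * (exp b - 1) + (exp a - 1) + (exp b - 1)"
    using assms order.trans[OF norm_ge_zero assms(1)] by (intro add_mono mult_mono) auto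
  also have "\<dots> = exp (a + b) - 1" by (simp add: exp_add algebra_simps)
  finally show ?thesis .
qed

lemma norm_prod_minus_1_le_exp:
  fixes f :: "nat \<Rightarrow> complex"
  assumes "\<And>m. m < M \<Longrightarrow> norm (f m - 1) \<le> g m" "(\<Sum>m<M. g m) \<le> c"
  shows "norm ((\<Prod>m<M. f m) - 1) \<le> exp c - 1"
proof -
  have "norm ((\<Prod>m<M. 1 + (f m - 1)) - 1) \<le> (\<Prod>m<M. 1 + norm (f m - 1)) - 1"
    by (rule norm_prod_minus1_le_prod_minus1)
  also have "(\<Prod>m<M. 1 + norm (f m - 1)) \<le> exp (\<Sum>m<M. norm (f m - 1))"
    by (rule prod_le_exp_sum) simp
  also have "\<dots> \<le> exp c" using sum_mono[of "{..<M}" "\<lambda>m. norm (f m - 1)" g] assms by auto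
  finally show ?thesis by simp
qed

text \<open>For r <= 1/2 the powers of r sum to at most 2r, and inverting a factor at most doubles
  the bound for its distance from 1.\<close>

lemma euler_prod_near_1:
  assumes q: "norm q \<le> r" and r: "r \<le> 1/2"
  shows "norm (euler_prod q - 1) \<le> exp (2 * r) - 1"
    and "norm (inverse (euler_prod q) - 1) \<le> exp (4 * r) - 1"
proof -
  have r0: "0 \<le> r" using q norm_ge_zero order.trans by blast
  have q1: "norm q < 1" using q r by simp
  have s: "(\<Sum>m<M. r ^ Suc m) \<le> 2 * r" for M
  proof -
    have "(\<Sum>m<M. r ^ Suc m) \<le> r / (1 - r)" using r0 r by (intro sum_geometric_le) auto
    also have "\<dots> \<le> r / (1/2)" using r0 r by (intro divide_left_mono) auto
    finally show ?thesis by simp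
  qed
  have pw: "norm (q ^ Suc m) \<le> r ^ Suc m" for m unfolding norm_power by (rule power_mono[OF q norm_ge_zero])
  have pw2: "r ^ Suc m \<le> 1/2" for m
    using r r0 power_decreasing[of 1 "Suc m" r] by simp
  have "norm ((\<Prod>m<M. 1 - q ^ Suc m) - 1) \<le> exp (2 * r) - 1" for M
    by (rule norm_prod_minus_1_le_exp[OF _ s]) (use pw in \<open>simp del: power_Suc\<close>)
  then show "norm (euler_prod q - 1) \<le> exp (2 * r) - 1"
    by (intro LIMSEQ_le_const2[OF tendsto_norm[OF tendsto_diff[OF euler_prod_LIMSEQ[OF q1] tendsto_const]] exI[of _ 0]]) auto
  have "norm (inverse (\<Prod>m<M. 1 - q ^ Suc m) - 1) \<le> exp (4 * r) - 1" for M
  proof -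
    have "norm ((\<Prod>m<M. inverse (1 - q ^ Suc m)) - 1) \<le> exp (4 * r) - 1"
    proof (rule norm_prod_minus_1_le_exp)
      fix m
      define w where "w = q ^ Suc m"
      have w: "norm w \<le> r ^ Suc m" "norm w \<le> 1/2" using pw[of m] pw2[of m] by (auto simp: w_def simp del: power_Suc)
      have ne: "1 - w \<noteq> 0" using w(2) by auto
      have "inverse (1 - w) - 1 = w * inverse (1 - w)" using ne by (simp add: field_simps)
      then have "norm (inverse (1 - w) - 1) = norm w * norm (inverse (1 - w))" by (simp add: norm_mult)
      also have "\<dots> \<le> norm w * inverse (1 - norm w)" using w(2) by (intro mult_left_mono norm_inverse_one_minus_le) auto
      also have "\<dots> \<le> norm w * inverse (1/2)" using w(2) by (intro mult_left_mono le_imp_inverse_le) auto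
      also have "\<dots> \<le> 2 * r ^ Suc m" using w(1) by simp
      finally show "norm (inverse (1 - q ^ Suc m) - 1) \<le> 2 * r ^ Suc m" by (simp only: w_def)
    next
      show "(\<Sum>m<M. 2 * r ^ Suc m) \<le> 4 * r" using s[of M] by (simp add: sum_distrib_left[symmetric] del: power_Suc)
    qed
    then show ?thesis by (simp add: prod_inversef[symmetric] o_def del: power_Suc)
  qed
  then show "norm (inverse (euler_prod q) - 1) \<le> exp (4 * r) - 1"
    using q1 by (intro LIMSEQ_le_const2[OF tendsto_norm[OF tendsto_diff[OF tendsto_inverse[OF euler_prod_LIMSEQ[OF q1]] tendsto_const]] exI[of _ 0]])
       (auto simp: euler_prod_nonzero)
qed

text \<open>Only Q and Q^2 matter: the other exponents are at least 7, hence the 64 = 2^6. The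
  exponents of the six factors sum to less than 6r, and exp(6r) - 1 <= 6r exp 3 <= 6 r 27 = 162
  r.\<close>

lemma dual_gf_near_1:
  assumes k: "k \<ge> 3" and Q: "norm Q \<le> 1/2"
  shows "norm (dual_gf k Q - 1) \<le> 162 * norm Q"
proof -
  define r where "r = norm Q"
  have r: "0 \<le> r" "r \<le> 1/2" using Q by (auto simp: r_def)
  have r2: "norm (Q ^ 2) \<le> r / 2"
    using r mult_left_mono[of r "1/2" r] by (simp add: norm_power norm_mult r_def power2_eq_square)
  have pw: "norm (Q ^ j) \<le> r / 64" if "j \<ge> 7" for j
  proof -
    have "norm (Q ^ j) \<le> r ^ 7" unfolding norm_power r_def[symmetric] using r that by (intro power_decreasing) auto
    also have "r ^ 7 = r * r ^ 6" by (simp add: eval_nat_numeral)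
    also have "\<dots> \<le> r * (1/2) ^ 6" using r by (intro mult_left_mono power_mono) auto
    finally show ?thesis by (simp add: power_divide)
  qed
  have 1: "norm (euler_prod (Q ^ (2*k+1)) - 1) \<le> exp (2 * (r/64)) - 1"
    using k r by (intro euler_prod_near_1 pw) auto
  have 2: "norm (euler_prod (Q ^ 2) - 1) \<le> exp (2 * (r/2)) - 1"
    using r by (intro euler_prod_near_1 r2) auto
  have 3: "norm (inverse (euler_prod (Q ^ (4*k+2))) - 1) \<le> exp (4 * (r/64)) - 1"
    using k r by (intro euler_prod_near_1 pw) auto
  have 4: "norm (inverse (euler_prod Q) - 1) \<le> exp (4 * r) - 1"
    using r by (intro euler_prod_near_1) (auto simp: r_def)
  have eq: "dual_gf k Q = euler_prod (Q ^ (2*k+1)) * euler_prod (Q ^ 2) *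
     (inverse (euler_prod (Q ^ (4*k+2))) * inverse (euler_prod (Q ^ (4*k+2))) * inverse (euler_prod (Q ^ (4*k+2))) * inverse (euler_prod Q))"
    by (simp add: dual_gf_def divide_inverse power3_eq_cube)
  have "norm (dual_gf k Q - 1) \<le> exp (2 * (r/64) + 2 * (r/2) + (4 * (r/64) + 4 * (r/64) + 4 * (r/64) + 4 * r)) - 1"
    unfolding eq by (intro norm_minus_1_mult_le 1 2 3 4)
  also have "\<dots> \<le> exp (6 * r) - 1" using r by simp
  also have "\<dots> \<le> 6 * r * exp (6 * r)"
  proof -
    have "1 + - (6 * r) \<le> exp (- (6 * r))" by (rule exp_ge_add_one_self)
    then have "(1 + - (6 * r)) * exp (6 * r) \<le> exp (- (6 * r)) * exp (6 * r)" by (intro mult_right_mono) auto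
    also have "\<dots> = 1" by (simp flip: exp_add)
    finally show ?thesis by (simp add: algebra_simps)
  qed
  also have "\<dots> \<le> 6 * r * exp 3" using r by (intro mult_left_mono) auto
  also have "\<dots> \<le> 6 * r * 3 ^ 3"
    using r power_mono[OF exp_le, of 3] by (intro mult_left_mono) (auto simp flip: exp_of_nat_mult)
  finally show ?thesis by (simp add: r_def)
qed

text \<open>Two of the four groups are odd products; 5 pi^2/12 is pi^2/12 from the first of them
  plus twice pi^2/6 from the remaining reciprocals.\<close>

lemma norm_Delta_gf_trivial:
  assumes s: "s > 0" and q: "norm q = exp (- s)"
  shows "norm (Delta_gf k q) \<le> exp (5 * pi\<^sup>2 / (12 * s) + 1 / (2 * real (2*k+1) * s))"
proof -
  have u: "norm (q ^ (2*k+1)) = exp (- (real (2*k+1) * s))" by (simp only: norm_power q exp_minus_power)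
  have S: "real (2*k+1) * s > 0" using s by simp
  have uu: "(q ^ (2*k+1))\<^sup>2 = q ^ (4*k+2)" 
    unfolding power_mult[symmetric] by (rule arg_cong[where f = "\<lambda>j. q ^ j"]) simp
  have "Delta_gf k q = (euler_prod (q\<^sup>2) / euler_prod q) * (inverse (euler_prod q))\<^sup>2 *
     (euler_prod (q ^ (2*k+1)) / euler_prod ((q ^ (2*k+1))\<^sup>2))"
    unfolding uu Delta_gf_def by (simp add: power2_eq_square power3_eq_cube divide_inverse)
  then have "norm (Delta_gf k q) = norm (euler_prod (q\<^sup>2) / euler_prod q) * (norm (inverse (euler_prod q)))\<^sup>2 *
     norm (euler_prod (q ^ (2*k+1)) / euler_prod ((q ^ (2*k+1))\<^sup>2))"
    by (simp only: norm_mult norm_power)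
  also have "\<dots> \<le> exp (pi\<^sup>2 / (12 * s)) * (exp (pi\<^sup>2 / (6 * s)))\<^sup>2 * exp (1 / (2 * (real (2*k+1) * s)))"
    by (intro mult_mono power_mono norm_euler_prod_quotient_le[OF s q] norm_inverse_euler_prod_le[OF s q]
       norm_euler_prod_quotient_le(2)[OF S u] mult_nonneg_nonneg) auto
  also have "\<dots> = exp (pi\<^sup>2 / (12 * s) + 2 * (pi\<^sup>2 / (6 * s)) + 1 / (2 * (real (2*k+1) * s)))"
    by (simp add: power2_eq_square flip: exp_add)
  also have "pi\<^sup>2 / (12 * s) + 2 * (pi\<^sup>2 / (6 * s)) = 5 * pi\<^sup>2 / (12 * s)" using s by (simp add: field_simps)
  finally show ?thesis by (simp only: mult.assoc)
qed

lemma Re_of_real_mult: "Re (of_real c * z) = c * Re z"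
  by simp

text \<open>Only the part free of k, the quotient of \<open>euler_prod (q\<^sup>2)\<close> and
  \<open>euler_prod q ^ 3\<close>, is inverted. The remaining quotient is an odd product and is
  bounded directly in q, at a cost damped by 2k+1.\<close>

lemma norm_Delta_gf_minor:
  assumes z: "Re z > 0"
  shows "norm (Delta_gf k (exp (- (2 * of_real pi * z)))) \<le>
    norm z * exp (5 * pi / 24 * Re (1 / z) + (pi / 6 + 1 / (2 * pi)) / Re (1 / z) + 1 / (4 * pi * real (2*k+1) * Re z))"
proof -
  define q where "q = exp (- (2 * of_real pi * z))"
  \<comment> \<open>v is dual to q^2 and v^2 is dual to q, so that an odd product appears again
    after the inversion.\<close>
  define v where "v = exp (- (of_real pi / z))"
  define y where "y = Re (1 / z)"
  have y: "y > 0" unfolding y_def by (rule Re_inverse_pos[OF z])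
  have z0: "z \<noteq> 0" using z by auto
  have nq: "norm q = exp (- (2 * pi * Re z))" by (simp add: q_def)
  have u: "norm (q ^ (2*k+1)) = exp (- (real (2*k+1) * (2 * pi * Re z)))" by (simp only: norm_power nq exp_minus_power)
  have S: "real (2*k+1) * (2 * pi * Re z) > 0" using z by simp
  have uu: "(q ^ (2*k+1))\<^sup>2 = q ^ (4*k+2)" 
    unfolding power_mult[symmetric] by (rule arg_cong[where f = "\<lambda>j. q ^ j"]) simp
  have nv: "norm v = exp (- (pi * y))"
  proof -
    have "of_real pi / z = of_real pi * (1 / z)" by simp
    then have "Re (of_real pi / z) = pi * y" unfolding y_def by (metis Re_complex_of_real Im_complex_of_real times_complex.simps(1) mult_zero_left diff_zero)
    then show ?thesis by (simp add: v_def)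
  qed
  have v1: "norm v < 1" using nv y by simp
  have nv2: "norm (v\<^sup>2) = exp (- (2 * pi * y))" by (simp add: norm_power nv flip: exp_of_nat_mult)
  have P2: "euler_prod (q\<^sup>2) = exp (of_real pi * z / 6 - of_real pi / (24 * z)) * euler_prod v / (of_real (sqrt 2) * csqrt z)"
    using euler_prod_scaled_reflect[OF z, of 2] by (simp add: q_def v_def mult_ac flip: exp_of_nat_mult)
  have P1: "euler_prod q = exp (of_real pi * z / 12 - of_real pi / (12 * z)) * euler_prod (v\<^sup>2) / csqrt z"
    using euler_prod_scaled_reflect[OF z, of 1] by (simp add: q_def v_def flip: exp_of_nat_mult)
  have X: "csqrt z \<noteq> 0" "csqrt z * csqrt z = z" using z0 by (auto simp: power2_eq_square[symmetric])
  have "euler_prod (q\<^sup>2) / euler_prod q ^ 3 = exp (of_real pi * z / 6 - of_real pi / (24 * z) - 3 * (of_real pi * z / 12 - of_real pi / (12 * z)))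
     * (z / of_real (sqrt 2)) * ((euler_prod v / euler_prod (v\<^sup>2)) * (inverse (euler_prod (v\<^sup>2)))\<^sup>2)"
  proof -
    have rearrange: "(E2 * V / (s2 * X)) / (E1 * V2 / X) ^ 3 = (E2 / E1 ^ 3) * (X * X / s2) * (V / V2 * (inverse V2)\<^sup>2)"
      if "X \<noteq> 0" for E1 E2 V V2 s2 X :: complex
      using that by (simp add: power2_eq_square power3_eq_cube divide_inverse mult_ac)
    have "exp (a - 3 * b) = exp a / exp b ^ 3" for a b :: complex
      by (simp add: exp_diff exp_of_nat_mult[of 3, symmetric, simplified])
    then show ?thesis unfolding P1 P2 rearrange[OF X(1)] X(2) by (simp only:)
  qed
  also have "of_real pi * z / 6 - of_real pi / (24 * z) - 3 * (of_real pi * z / 12 - of_real pi / (12 * z)) = of_real (- (pi / 12)) * z + of_real (5 * pi / 24) * (1 / z)"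
    using z0 by (simp add: field_simps)
  finally have A: "norm (euler_prod (q\<^sup>2) / euler_prod q ^ 3) = exp (- (pi / 12) * Re z + 5 * pi / 24 * y) * (norm z / sqrt 2) *
      (norm (euler_prod v / euler_prod (v\<^sup>2)) * (norm (inverse (euler_prod (v\<^sup>2))))\<^sup>2)"
    by (simp only: norm_mult norm_power norm_exp_eq_Re plus_complex.simps Re_of_real_mult y_def norm_divide norm_of_real) simp
  have "norm (euler_prod (q\<^sup>2) / euler_prod q ^ 3) \<le> exp (5 * pi / 24 * y) * norm z * (exp (1 / (2 * (pi * y))) * (exp (pi\<^sup>2 / (6 * (2 * pi * y))))\<^sup>2)"
    unfolding A
  proof (intro mult_mono power_mono norm_euler_prod_quotient_le(2)[OF _ nv] norm_inverse_euler_prod_le[OF _ nv2])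
    show "exp (- (pi / 12) * Re z + 5 * pi / 24 * y) \<le> exp (5 * pi / 24 * y)" using z by simp
    have "norm z / sqrt 2 \<le> norm z / 1" by (intro divide_left_mono) auto
    then show "norm z / sqrt 2 \<le> norm z" by simp
  qed (use y in auto)
  also have "exp (1 / (2 * (pi * y))) * (exp (pi\<^sup>2 / (6 * (2 * pi * y))))\<^sup>2 = exp ((pi / 6 + 1 / (2 * pi)) / y)"
  proof -
    have "1 / (2 * (pi * y)) + 2 * (pi\<^sup>2 / (6 * (2 * pi * y))) = (pi / 6 + 1 / (2 * pi)) / y"
      using y by (simp add: field_simps power2_eq_square)
    then show ?thesis by (simp add: power2_eq_square flip: exp_add)
  qed
  finally have A': "norm (euler_prod (q\<^sup>2) / euler_prod q ^ 3) \<le> exp (5 * pi / 24 * y) * norm z * exp ((pi / 6 + 1 / (2 * pi)) / y)" .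
  have "Delta_gf k q = (euler_prod (q\<^sup>2) / euler_prod q ^ 3) * (euler_prod (q ^ (2*k+1)) / euler_prod ((q ^ (2*k+1))\<^sup>2))"
    unfolding uu Delta_gf_def by (simp add: divide_inverse)
  then have "norm (Delta_gf k q) = norm (euler_prod (q\<^sup>2) / euler_prod q ^ 3) * norm (euler_prod (q ^ (2*k+1)) / euler_prod ((q ^ (2*k+1))\<^sup>2))"
    by (simp only: norm_mult)
  also have "\<dots> \<le> (exp (5 * pi / 24 * y) * norm z * exp ((pi / 6 + 1 / (2 * pi)) / y)) * exp (1 / (2 * (real (2*k+1) * (2 * pi * Re z))))"
    by (intro mult_mono A' norm_euler_prod_quotient_le(2)[OF S u]) auto
  also have "\<dots> = norm z * exp (5 * pi / 24 * y + (pi / 6 + 1 / (2 * pi)) / y + 1 / (4 * pi * real (2*k+1) * Re z))"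
    by (simp add: exp_add mult_ac)
  finally show ?thesis unfolding q_def y_def .
qed


section \<open>The Bessel function as a contour integral\<close>

definition bessel_kernel :: "real \<Rightarrow> real \<Rightarrow> complex \<Rightarrow> complex" where
  "bessel_kernel a b z = z * exp (of_real b * z + of_real a / z)"

lemma higher_deriv_exp_mult:
  fixes c :: complex
  shows "(deriv ^^ j) (\<lambda>z. exp (c * z)) = (\<lambda>z. c ^ j * exp (c * z))"
proof (induction j)
  case (Suc j)
  have "deriv (\<lambda>z. c ^ j * exp (c * z)) z = c ^ Suc j * exp (c * z)" for z
    by (rule DERIV_imp_deriv) (auto intro!: derivative_eq_intros)
  then show ?case using Suc by auto
qed simp

text \<open>exp(a/z) is expanded uniformly on the circle. The term of index i has the pole order i -
  1 and the residue of z^(1-i) exp(bz) is b^(i-2)/(i-2)!; the weight factor z is what produces the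
  order 2 of the Bessel function.\<close>

lemma bessel_kernel_circlepath:
  assumes r: "r > 0"
  shows "(\<lambda>j. 2 * of_real pi * \<i> * of_real (a ^ (j + 2) * b ^ j / (fact j * fact (j + 2)))) sums
    contour_integral (circlepath 0 r) (bessel_kernel a b)"
proof -
  define g where "g = (\<lambda>i (z::complex). z * exp (of_real b * z) * ((of_real a / z) ^ i /\<^sub>R fact i))"
  define I where "I = (\<lambda>i. if i < 2 then 0 else 2 * of_real pi * \<i> * of_real (a ^ i * b ^ (i - 2) / (fact (i - 2) * fact i)))"
  have gi: "(g i has_contour_integral I i) (circlepath 0 r)" for i
  \<comment> \<open>For i = 0 and i = 1 the factor z removes the pole, so the integrand agrees on
    the circle with an entire function.\<close>
  proof (cases "i < 2")
    case True
    define h where "h = (\<lambda>z::complex. (of_real a ^ i / fact i) * (if i = 0 then z else 1) * exp (of_real b * z))"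
    have "(h has_contour_integral 0) (circlepath 0 r)"
      by (rule Cauchy_theorem_convex_simple[where S = UNIV]; cases "i = 0") (auto simp: h_def intro!: holomorphic_intros)
    moreover have "h z = g i z" if "z \<in> path_image (circlepath 0 r)" for z
    proof -
      have "z \<noteq> 0" using that r by auto
      moreover have "i = 0 \<or> i = 1" using True by auto
      ultimately show ?thesis by (auto simp: h_def g_def scaleR_conv_of_real)
    qed
    ultimately show ?thesis using True has_contour_integral_eq[of h 0 "circlepath 0 r" "g i"] by (simp add: I_def)
  next
    case False
    then obtain j where i: "i = j + 2" by (metis add.commute le_Suc_ex not_less)
    define C where "C = (of_real a ^ i / fact i :: complex)"
    have "((\<lambda>u. C * (exp (of_real b * u) / (u - 0) ^ Suc j)) has_contour_integral C * ((2 * pi * \<i>) / (fact j) * (deriv ^^ j) (\<lambda>u. exp (of_real b * u)) 0)) (circlepath 0 r)"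
      using r by (intro has_contour_integral_lmul Cauchy_has_contour_integral_higher_derivative_circlepath)
         (auto intro!: holomorphic_intros continuous_intros)
    moreover have "C * (exp (of_real b * u) / (u - 0) ^ Suc j) = g i u" if "u \<in> path_image (circlepath 0 r)" for u
    proof -
      have "u \<noteq> 0" using that r by auto
      then have "c / F * (e / (u - 0) ^ Suc j) = u * e * ((1 / F) * (c / u ^ (j + 2)))" for c e F :: complex
        by (simp add: field_simps)
      then show ?thesis unfolding C_def g_def i scaleR_conv_of_real power_divide
        by (simp only: of_real_inverse of_real_fact inverse_eq_divide of_real_divide of_real_1)
    qed
    moreover have "C * ((2 * pi * \<i>) / (fact j) * (deriv ^^ j) (\<lambda>u. exp (of_real b * u)) 0) = I i"
      unfolding higher_deriv_exp_mult by (simp add: C_def I_def i mult_ac)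
    ultimately show ?thesis
      using has_contour_integral_eq[of "\<lambda>u. C * (exp (of_real b * u) / (u - 0) ^ Suc j)" _ "circlepath 0 r" "g i"] by auto
  qed
  have "uniform_limit (sphere 0 r) (\<lambda>n z. \<Sum>i<n. g i z) (\<lambda>z. \<Sum>i. g i z) sequentially"
  proof (rule Weierstrass_m_test)
    show "summable (\<lambda>i. r * exp (\<bar>b\<bar> * r) * ((\<bar>a\<bar> / r) ^ i /\<^sub>R fact i))"
      by (intro summable_mult summable_exp_generic)
    fix i z assume "z \<in> sphere (0::complex) r"
    then have z: "norm z = r" by simp
    have "Re (of_real b * z) \<le> \<bar>b\<bar> * r"
      using complex_Re_le_cmod[of "of_real b * z"] z by (simp add: norm_mult)
    then show "norm (g i z) \<le> r * exp (\<bar>b\<bar> * r) * ((\<bar>a\<bar> / r) ^ i /\<^sub>R fact i)"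
      using r by (simp add: g_def norm_mult norm_power norm_divide z mult_right_mono mult_left_mono)
  qed
  moreover have "(\<Sum>i. g i z) = bessel_kernel a b z" for z
  proof -
    have "g i z = z * exp (of_real b * z) * ((of_real a / z) ^ i /\<^sub>R fact i)" for i by (simp add: g_def)
    moreover have "(\<lambda>i. z * exp (of_real b * z) * ((of_real a / z) ^ i /\<^sub>R fact i)) sums (z * exp (of_real b * z) * exp (of_real a / z))"
      by (intro sums_mult exp_converges)
    ultimately show ?thesis by (simp add: sums_iff bessel_kernel_def exp_add)
  qed
  ultimately have ul: "uniform_limit (sphere 0 r) (\<lambda>n z. \<Sum>i<n. g i z) (bessel_kernel a b) sequentially" by simp
  have si: "((\<lambda>z. \<Sum>i<n. g i z) has_contour_integral (\<Sum>i<n. I i)) (circlepath 0 r)" for n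
    by (intro has_contour_integral_sum gi) auto
  have "(\<lambda>n. contour_integral (circlepath 0 r) (\<lambda>z. \<Sum>i<n. g i z)) \<longlonglongrightarrow> contour_integral (circlepath 0 r) (bessel_kernel a b)"
    by (rule contour_integral_uniform_limit_circlepath(2)[OF _ ul]) (use r in \<open>auto intro!: always_eventually has_contour_integral_integrable[OF si]\<close>)
  then have "I sums contour_integral (circlepath 0 r) (bessel_kernel a b)"
    unfolding sums_def by (simp only: contour_integral_unique[OF si])
  then have "(\<lambda>j. I (j + 2)) sums contour_integral (circlepath 0 r) (bessel_kernel a b)"
    by (subst sums_iff_shift) (simp add: I_def numeral_2_eq_2)
  then show ?thesis by (simp add: I_def)
qed

lemma path_image_arc:
  "s \<le> t \<Longrightarrow> path_image (part_circlepath 0 (2 * \<rho>) s t) = (\<lambda>u. 0 + of_real (2 * \<rho>) * cis u) ` {s..t}"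
  unfolding path_image_part_circlepath' by (simp only: closed_segment_eq_real_ivl if_True)

lemma bessel_kernel_holomorphic: "0 \<notin> S \<Longrightarrow> bessel_kernel a b holomorphic_on S"
  unfolding bessel_kernel_def by (intro holomorphic_intros) auto

lemma cos_pi_third_bounds:
  shows "\<lbrakk>- (pi / 3) \<le> t; t \<le> pi / 3\<rbrakk> \<Longrightarrow> cos t \<ge> 1/2"
    and "\<lbrakk>pi / 3 \<le> t; t \<le> 5 * pi / 3\<rbrakk> \<Longrightarrow> cos t \<le> 1/2"
proof -
  show "cos t \<ge> 1/2" if "- (pi / 3) \<le> t" "t \<le> pi / 3"
  proof -
    have "cos (pi / 3) \<le> cos \<bar>t\<bar>" using that by (intro cos_monotone_0_pi_le) auto
    then show ?thesis by (simp add: cos_60)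
  qed
  show "cos t \<le> 1/2" if "pi / 3 \<le> t" "t \<le> 5 * pi / 3"
  proof (cases "t \<le> pi")
    case True
    then have "cos t \<le> cos (pi / 3)" using that by (intro cos_monotone_0_pi_le) auto
    then show ?thesis by (simp add: cos_60)
  next
    case False
    then have "cos (2 * pi - t) \<le> cos (pi / 3)" using that by (intro cos_monotone_0_pi_le) auto
    then show ?thesis by (simp add: cos_60 cos_diff)
  qed
qed

text \<open>The segment of integration is a chord of the circle of radius \<open>2\<rho>\<close> around \<open>0\<close> and may be replaced by the
  arc in the right half-plane; on the remaining arc \<open>Re z\<close> and \<open>Re (1/z)\<close> are at most half their maxima.\<close>

lemma bessel_kernel_chord:
  assumes \<rho>: "\<rho> > 0" and a: "a > 0" and b: "b > 0"
  defines "h \<equiv> sqrt 3 * \<rho>"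
  obtains J where "((\<lambda>t. bessel_kernel a b (Complex \<rho> t)) has_integral J) {-h..h}"
    "norm (J - contour_integral (circlepath 0 (2 * \<rho>)) (bessel_kernel a b) / \<i>) \<le> 17 * \<rho>\<^sup>2 * exp (b * \<rho> + a / (4 * \<rho>))"
proof -
  define f where "f = bessel_kernel a b"
  define S where "S = {z::complex. Re z > 0}"
  have S: "convex S" "open S" unfolding S_def by (auto intro: convex_halfspace_Re_gt open_halfspace_Re_gt)
  have "f holomorphic_on S" unfolding f_def by (rule bessel_kernel_holomorphic) (auto simp: S_def)
  \<comment> \<open>The kernel has a primitive on the half-plane, which contains the chord and the
    right-hand arc; both integrals are then differences of end point values.\<close>
  then obtain G where G: "\<And>x. x \<in> S \<Longrightarrow> (G has_field_derivative f x) (at x within S)"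
    using holomorphic_convex_primitive'[OF S] by blast
  have h: "h > 0" using \<rho> by (simp add: h_def)
  have end1: "of_real (2 * \<rho>) * exp (\<i> * of_real (pi / 3)) = Complex \<rho> h"
    unfolding cis_conv_exp[symmetric] by (simp add: h_def complex_eq_iff cos_60 sin_60)
  have end2: "of_real (2 * \<rho>) * exp (\<i> * of_real (5 * pi / 3)) = Complex \<rho> (- h)"
  proof -
    have e: "5 * pi / 3 = 2 * pi - pi / 3" by simp
    have "cos (5 * pi / 3) = 1/2" unfolding e cos_diff by (simp add: cos_60)
    moreover have "sin (5 * pi / 3) = - sqrt 3 / 2" unfolding e sin_diff by (simp add: sin_60)
    ultimately show ?thesis unfolding cis_conv_exp[symmetric] by (simp add: h_def complex_eq_iff)
  qed
  define F where "F = (\<lambda>t. f (0 + of_real (2 * \<rho>) * cis t) * of_real (2 * \<rho>) * \<i> * cis t)"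
  have arc: "(F has_integral (G (of_real (2 * \<rho>) * exp (\<i> * of_real t)) - G (of_real (2 * \<rho>) * exp (\<i> * of_real s)))) {s..t}"
    if "s < t" "\<And>u. s \<le> u \<Longrightarrow> u \<le> t \<Longrightarrow> cos u > 0" for s t
  proof -
    note st = that(1) and cosp = that(2)
    have "path_image (part_circlepath 0 (2 * \<rho>) s t) \<subseteq> S"
    proof
      fix z assume "z \<in> path_image (part_circlepath 0 (2 * \<rho>) s t)"
      then obtain u where u: "u \<in> {s..t}" "z = 0 + of_real (2 * \<rho>) * cis u"
        unfolding path_image_arc[OF less_imp_le[OF st]] by blast
      then have "cos u > 0" using cosp by simp
      then show "z \<in> S" using u(2) \<rho> by (simp add: S_def)
    qed
    from contour_integral_primitive[OF G valid_path_part_circlepath this]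
    have "(f has_contour_integral (G (of_real (2 * \<rho>) * exp (\<i> * of_real t)) - G (of_real (2 * \<rho>) * exp (\<i> * of_real s)))) (part_circlepath 0 (2 * \<rho>) s t)"
      by simp
    then show ?thesis unfolding F_def using has_contour_integral_part_circlepath_iff[OF that(1)] by blast
  qed
  have end0: "of_real (2 * \<rho>) * exp (\<i> * of_real 0) = of_real (2 * \<rho>)" by simp
  have end3: "of_real (2 * \<rho>) * exp (\<i> * of_real (2 * pi)) = of_real (2 * \<rho>)"
    unfolding cis_conv_exp[symmetric] by simp
  have c1: "cos u > 0" if "0 \<le> u" "u \<le> pi / 3" for u
    using cos_pi_third_bounds(1)[of u] that pi_gt_zero by linarith
  have less: "0 < pi / 3" "5 * pi / 3 < 2 * pi" by simp_all
  \<comment> \<open>The circle is parametrised from angle 0, which cuts the right-hand arc in two at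
    2\<rho>; the values of G there cancel.\<close>
  have arc1: "(F has_integral (G (Complex \<rho> h) - G (of_real (2 * \<rho>)))) {0..pi/3}"
    by (rule arc[OF less(1) c1, unfolded end1 end0])
  have c3: "cos u > 0" if "5 * pi / 3 \<le> u" "u \<le> 2 * pi" for u
  proof -
    have "cos (u - 2 * pi) \<ge> 1/2" using that by (intro cos_pi_third_bounds(1)) linarith+
    then show ?thesis unfolding cos_diff by simp
  qed
  have arc3: "(F has_integral (G (of_real (2 * \<rho>)) - G (Complex \<rho> (- h)))) {5*pi/3..2*pi}"
    by (rule arc[OF less(2) c3, unfolded end2 end3])
  have cont: "continuous_on A f" if "0 \<notin> A" for A
    unfolding f_def by (intro holomorphic_on_imp_continuous_on bessel_kernel_holomorphic that)
  have "f contour_integrable_on part_circlepath 0 (2 * \<rho>) (pi/3) (5*pi/3)"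
  proof (intro contour_integrable_continuous_part_circlepath cont)
    have "pi / 3 \<le> 5 * pi / 3" by simp
    then show "0 \<notin> path_image (part_circlepath 0 (2 * \<rho>) (pi/3) (5*pi/3))"
      using \<rho> by (simp only: path_image_arc) auto
  qed
  then obtain L where L: "(f has_contour_integral L) (part_circlepath 0 (2 * \<rho>) (pi/3) (5*pi/3))"
    by (auto simp: contour_integrable_on_def)
  then have arc2: "(F has_integral L) {pi/3..5*pi/3}"
    unfolding F_def by (subst (asm) has_contour_integral_part_circlepath_iff) auto
  have "(F has_integral (G (Complex \<rho> h) - G (of_real (2 * \<rho>)) + L + (G (of_real (2 * \<rho>)) - G (Complex \<rho> (- h))))) {0..2*pi}"
    by (intro has_integral_combine[OF _ _ has_integral_combine[OF _ _ arc1 arc2] arc3]) auto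
  then have "(f has_contour_integral (G (Complex \<rho> h) - G (of_real (2 * \<rho>)) + L + (G (of_real (2 * \<rho>)) - G (Complex \<rho> (- h))))) (circlepath 0 (2 * \<rho>))"
    unfolding circlepath_def F_def by (subst has_contour_integral_part_circlepath_iff) auto
  then have circ: "contour_integral (circlepath 0 (2 * \<rho>)) f = G (Complex \<rho> h) - G (Complex \<rho> (- h)) + L"
    by (simp add: contour_integral_unique)
  have "((\<lambda>t. f (Complex \<rho> t) * \<i>) has_integral (G (Complex \<rho> h) - G (Complex \<rho> (- h)))) {-h..h}"
  proof (rule fundamental_theorem_of_calculus)
    fix t :: real
    have "(G has_field_derivative f (Complex \<rho> t)) (at (Complex \<rho> t))"
    proof -
      have Sd: "Complex \<rho> t \<in> S" using \<rho> by (simp add: S_def)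
      from G[OF Sd] show ?thesis unfolding at_within_open[OF Sd S(2)] .
    qed
    then have "((\<lambda>w. G (of_real \<rho> + \<i> * w)) has_field_derivative f (Complex \<rho> t) * \<i>) (at (of_real t))"
      by (intro DERIV_chain2[of G]) (auto intro!: derivative_eq_intros simp: Complex_eq)
    from has_vector_derivative_real_field[OF this]
    show "((\<lambda>t. G (Complex \<rho> t)) has_vector_derivative f (Complex \<rho> t) * \<i>) (at t within {-h..h})"
      unfolding Complex_eq by (rule has_vector_derivative_at_within)
  qed (use h in simp)
  from has_integral_mult_left[OF this, of "1 / \<i>"]
  have J: "((\<lambda>t. f (Complex \<rho> t)) has_integral (G (Complex \<rho> h) - G (Complex \<rho> (- h))) / \<i>) {-h..h}"
    by (simp only: times_divide_eq_right mult_1_right nonzero_mult_div_cancel_right complex_i_not_zero not_False_eq_True)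
  \<comment> \<open>Here |z| = 2\<rho> and the arc has length 2\<rho> times 4 pi/3; the product is
    16 pi/3 \<rho>^2, rounded up to 17 \<rho>^2 below.\<close>
  have Lb: "norm L \<le> (2 * \<rho> * exp (b * \<rho> + a / (4 * \<rho>))) * (2 * \<rho>) * (5*pi/3 - pi/3)"
  proof (rule has_contour_integral_bound_part_circlepath[OF L])
    fix z assume "z \<in> path_image (part_circlepath 0 (2 * \<rho>) (pi / 3) (5 * pi / 3))"
    then obtain u where u: "pi/3 \<le> u" "u \<le> 5*pi/3" "z = of_real (2 * \<rho>) * cis u"
      using path_image_arc[of "pi/3" "5*pi/3" \<rho>] by auto
    have c: "cos u \<le> 1/2" using cos_pi_third_bounds(2)[OF u(1,2)] .
    have nz: "norm z = 2 * \<rho>" using u(3) \<rho> by (simp add: norm_mult)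
    have "of_real a / z = of_real (a / (2 * \<rho>)) * inverse (cis u)"
      unfolding u(3) by (simp only: divide_inverse inverse_mult_distrib of_real_mult of_real_inverse mult.assoc)
    then have "of_real a / z = of_real (a / (2 * \<rho>)) * cis (- u)" unfolding cis_inverse .
    then have "Re (of_real a / z) = a / (2 * \<rho>) * cos u" by simp
    also have "\<dots> \<le> a / (2 * \<rho>) * (1/2)" using c a \<rho> by (intro mult_left_mono) auto
    finally have 1: "Re (of_real a / z) \<le> a / (4 * \<rho>)" by simp
    have "Re (of_real b * z) = b * (2 * \<rho>) * cos u" using u(3) by simp
    also have "\<dots> \<le> b * (2 * \<rho>) * (1/2)" using c b \<rho> by (intro mult_left_mono) auto
    finally have 2: "Re (of_real b * z) \<le> b * \<rho>" by simp
    show "norm (f z) \<le> 2 * \<rho> * exp (b * \<rho> + a / (4 * \<rho>))"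
      unfolding f_def bessel_kernel_def norm_mult nz norm_exp_eq_Re plus_complex.simps
      using 1 2 \<rho> by (intro mult_left_mono) auto
  qed (use \<rho> in auto)
  have "norm ((G (Complex \<rho> h) - G (Complex \<rho> (- h))) / \<i> - contour_integral (circlepath 0 (2 * \<rho>)) f / \<i>) = norm L"
    unfolding circ diff_divide_distrib[symmetric] by (simp add: norm_divide norm_mult)
  also have "\<dots> \<le> (16 * pi / 3) * (\<rho>\<^sup>2 * exp (b * \<rho> + a / (4 * \<rho>)))"
    using Lb by (simp add: power2_eq_square algebra_simps)
  also have "\<dots> \<le> 17 * (\<rho>\<^sup>2 * exp (b * \<rho> + a / (4 * \<rho>)))"
    using pi_approx by (intro mult_right_mono) auto
  finally show ?thesis using that[OF J[unfolded f_def]] unfolding f_def by (simp add: mult.assoc)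
qed

text \<open>With y the argument and c the prefactor of the Bessel function, (y/2)^2 = a b and c = 2
  pi a/b, so the two series agree term by term.\<close>

lemma Mk_eq_circlepath:
  assumes n: "real n - (real k + 1) / 12 > 0" and r: "r > 0"
  defines "a \<equiv> pi * alpha_k k / 12" and "b \<equiv> 2 * pi * (real n - (real k + 1) / 12)"
  shows "contour_integral (circlepath 0 r) (bessel_kernel a b) / \<i> = of_real (Mk k n)"
proof -
  define T where "T = (\<lambda>j. a ^ (j + 2) * b ^ j / (fact j * fact (j + 2)))"
  have al: "alpha_k k > 0" by (simp add: alpha_k_def add_nonneg_pos)
  have ab: "a > 0" "b > 0" using al n by (simp_all add: a_def b_def)
  define C where "C = contour_integral (circlepath 0 r) (bessel_kernel a b) / \<i>"
  have "(\<lambda>j. 2 * of_real pi * \<i> * of_real (T j) / \<i>) sums C"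
    unfolding C_def T_def by (intro sums_divide bessel_kernel_circlepath r)
  moreover have "2 * of_real pi * \<i> * of_real (T j) / \<i> = complex_of_real (2 * pi * T j)" for j
  proof -
    have "2 * of_real pi * \<i> * of_real (T j) = complex_of_real (2 * pi * T j) * \<i>" by simp
    then show ?thesis by (simp only: nonzero_mult_div_cancel_right complex_i_not_zero not_False_eq_True)
  qed
  ultimately have C1: "(\<lambda>j. complex_of_real (2 * pi * T j)) sums C" by (simp only:)
  then have "summable (\<lambda>j. complex_of_real (2 * pi * T j))" by (rule sums_summable)
  then have sm: "summable (\<lambda>j. 2 * pi * T j)" by (simp only: summable_of_real_iff)
  define x where "x = xk k n"
  have x2: "x\<^sup>2 = 2 * pi\<^sup>2 * (real n - (real k + 1) / 12) / 3"
    using n unfolding x_def xk_def by (simp add: power_mult_distrib power_divide field_simps)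
  have x2b: "x\<^sup>2 = pi * b / 3" unfolding x2 b_def by (simp add: power2_eq_square)
  define c where "c = pi ^ 3 * alpha_k k / (18 * x\<^sup>2)"
  define y where "y = sqrt (alpha_k k) * x"
  have yy: "(y / 2)\<^sup>2 = a * b" using al by (simp add: y_def power_mult_distrib power_divide x2b a_def)
  have cc: "c = 2 * pi * a / b" using ab by (simp add: c_def x2b a_def power3_eq_cube field_simps)
  have coeff: "c * ((y / 2) ^ (2 * j + 2) / (fact j * fact (j + 2))) = 2 * pi * T j" for j
  proof -
    have "(y / 2) ^ (2 * j + 2) = (a * b) ^ (j + 1)" using power_mult[of "y/2" 2 "j+1"] yy by simp
    then show ?thesis using ab by (simp add: T_def cc power_mult_distrib field_simps power2_eq_square)
  qed
  have c0: "c \<noteq> 0" using ab unfolding cc by simp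
  have "summable (\<lambda>j. (y / 2) ^ (2 * j + 2) / (fact j * fact (j + 2)))"
    using sm unfolding coeff[symmetric] by (rule summable_mult_D) (rule c0)
  from suminf_mult[OF this, of c] have "c * Bessel_I2 y = (\<Sum>j. 2 * pi * T j)"
    unfolding Bessel_I2_def coeff by (rule sym)
  moreover have "Mk k n = c * Bessel_I2 y" by (simp add: Mk_def c_def y_def x_def)
  ultimately have "(\<lambda>j. 2 * pi * T j) sums Mk k n" using sm by (simp add: sums_iff)
  then have "(\<lambda>j. complex_of_real (2 * pi * T j)) sums of_real (Mk k n)" by (simp only: sums_of_real_iff)
  from sums_unique2[OF C1 this] show ?thesis by (simp add: C_def)
qed


section \<open>Major and minor arcs\<close>

text \<open>1/u + u is convex and has the same value at 4\<rho> and at 1/(4\<rho>), which settles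
  the range between them. On the short rest 1/u <= 4\<rho>, and u adds one more \<rho>.\<close>

lemma reciprocal_sum_le:
  fixes u \<rho> :: real
  assumes \<rho>: "\<rho> > 0" and u: "4 * \<rho> \<le> u" "u \<le> 1 / (4 * \<rho>) + \<rho>"
  shows "1 / u + u \<le> 1 / (4 * \<rho>) + 5 * \<rho>"
proof -
  have u0: "u > 0" using u(1) \<rho> by linarith
  show ?thesis
  proof (cases "u \<le> 1 / (4 * \<rho>)")
    case True
    then have "(u - 4 * \<rho>) * (u - 1 / (4 * \<rho>)) \<le> 0" using u by (intro mult_nonneg_nonpos) auto
    moreover have "(u - 4 * \<rho>) * (u - p) = u * u + 4 * \<rho> * p - u * (p + 4 * \<rho>)" for p
      by (simp add: algebra_simps)
    moreover have "4 * \<rho> * (1 / (4 * \<rho>)) = 1" using \<rho> by simp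
    ultimately have "u * u + 1 \<le> u * (1 / (4 * \<rho>) + 4 * \<rho>)" by simp
    then have "(u * u + 1) / u \<le> u * (1 / (4 * \<rho>) + 4 * \<rho>) / u" using u0 by (intro divide_right_mono) auto
    then have "1 / u + u \<le> 1 / (4 * \<rho>) + 4 * \<rho>" using u0 by (simp add: add_divide_distrib)
    then show ?thesis using \<rho> by linarith
  next
    case False
    then have "1 / u \<le> 1 / (1 / (4 * \<rho>))" using \<rho> u0 by (intro divide_left_mono) auto
    then show ?thesis using u(2) by simp
  qed
qed

lemma Re_inverse_Complex: "Re (1 / Complex x y) = x / (x\<^sup>2 + y\<^sup>2)"
  by (simp add: Re_divide)

text \<open>With u = (\<rho>^2 + t^2)/\<rho> one has Re(1/z) = 1/u, and the limits for |t| turn into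
  the range of u in \<open>reciprocal_sum_le\<close>.\<close>

lemma norm_minor_arc_le:
  assumes \<rho>: "\<rho> > 0" "\<rho> \<le> 1/8" and t: "sqrt 3 * \<rho> \<le> \<bar>t\<bar>" "\<bar>t\<bar> \<le> 1/2"
  shows "norm (Delta_gf k (exp (- (2 * of_real pi * Complex \<rho> t)))) \<le>
    exp ((pi / 6 + 1 / (2 * pi)) * (1 / (4 * \<rho>) + 5 * \<rho>) + 1 / (4 * pi * real (2*k+1) * \<rho>))"
proof -
  define z where "z = Complex \<rho> t"
  define D where "D = \<rho>\<^sup>2 + t\<^sup>2"
  define B where "B = pi / 6 + 1 / (2 * pi)"
  have z: "Re z > 0" using \<rho> by (simp add: z_def)
  have "(sqrt 3 * \<rho>)\<^sup>2 \<le> \<bar>t\<bar>\<^sup>2" using t \<rho> by (intro power_mono) auto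
  then have D1: "4 * \<rho>\<^sup>2 \<le> D" by (simp add: D_def power_mult_distrib)
  have "\<bar>t\<bar>\<^sup>2 \<le> (1/2)\<^sup>2" using t by (intro power_mono) auto
  then have D2: "D \<le> \<rho>\<^sup>2 + 1/4" by (simp add: D_def power2_eq_square)
  have D0: "D > 0" using D1 \<rho> by (smt (verit) zero_less_power)
  define u where "u = D / \<rho>"
  have u1: "4 * \<rho> \<le> u" using D1 \<rho> by (simp add: u_def field_simps power2_eq_square)
  have u2: "u \<le> 1 / (4 * \<rho>) + \<rho>"
  proof -
    have "u \<le> (\<rho>\<^sup>2 + 1/4) / \<rho>" unfolding u_def using D2 \<rho> by (intro divide_right_mono) auto
    also have "\<dots> = 1 / (4 * \<rho>) + \<rho>" using \<rho> by (simp add: field_simps power2_eq_square)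
    finally show ?thesis .
  qed
  have u0: "u > 0" using u1 \<rho> by linarith
  have y: "Re (1 / z) = 1 / u" by (simp add: z_def Re_inverse_Complex D_def u_def)
  have "norm z \<le> \<bar>\<rho>\<bar> + \<bar>t\<bar>" unfolding z_def using cmod_le[of "Complex \<rho> t"] by simp
  then have nz: "norm z \<le> 1" using \<rho> t by simp
  \<comment> \<open>Equivalent to pi^2 <= 12. It permits the common coefficient B for 1/u and
    u.\<close>
  have AB: "5 * pi / 24 \<le> B"
  proof -
    have "pi * pi \<le> 3.15 * 3.15" using pi_approx by (intro mult_mono) auto
    then have "pi \<le> 12 / pi" by (simp add: field_simps)
    moreover have "B - 5 * pi / 24 = (12 / pi - pi) / 24" by (simp add: B_def field_simps)
    ultimately show ?thesis by simp
  qed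
  have B0: "B > 0" by (simp add: B_def add_pos_pos)
  have "5 * pi / 24 * (1 / u) + B / (1 / u) \<le> B * (1 / u) + B * u"
    using AB u0 by (intro add_mono mult_right_mono) auto
  also have "\<dots> = B * (1 / u + u)" by (simp add: algebra_simps)
  also have "\<dots> \<le> B * (1 / (4 * \<rho>) + 5 * \<rho>)"
    using B0 by (intro mult_left_mono reciprocal_sum_le \<rho> u1 u2) auto
  finally have W: "5 * pi / 24 * Re (1 / z) + B / Re (1 / z) + 1 / (4 * pi * real (2*k+1) * Re z) \<le> B * (1 / (4 * \<rho>) + 5 * \<rho>) + 1 / (4 * pi * real (2*k+1) * \<rho>)"
    unfolding y by (simp add: z_def)
  have "norm (Delta_gf k (exp (- (2 * of_real pi * z)))) \<le> norm z * exp (5 * pi / 24 * Re (1 / z) + B / Re (1 / z) + 1 / (4 * pi * real (2*k+1) * Re z))"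
    unfolding B_def by (rule norm_Delta_gf_minor[OF z])
  also have "\<dots> \<le> 1 * exp (B * (1 / (4 * \<rho>) + 5 * \<rho>) + 1 / (4 * pi * real (2*k+1) * \<rho>))"
    using nz W by (intro mult_mono) auto
  finally show ?thesis by (simp add: z_def B_def)
qed

text \<open>For |t| <= sqrt 3 \<rho> the value Re(1/z) lies between 1/(4\<rho>) and 1/\<rho>. The
  lower limit and the hypothesis \<open>small\<close> give |Q| <= 1/2; the upper limit gives the
  exponent. The constant is 324 = 2 times 162, with |z| <= 2\<rho>.\<close>

lemma major_arc_le:
  fixes k n :: nat
  assumes k: "k \<ge> 3" and \<rho>: "\<rho> > 0" and t: "\<bar>t\<bar> \<le> sqrt 3 * \<rho>"
    and small: "pi / (4 * real (2*k+1) * \<rho>) \<ge> 7/10"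
  defines "a \<equiv> pi * alpha_k k / 12" and "b \<equiv> 2 * pi * (real n - (real k + 1) / 12)"
  shows "norm (Delta_gf k (exp (- (2 * of_real pi * Complex \<rho> t))) * exp (2 * of_real pi * of_nat n * Complex \<rho> t)
     - bessel_kernel a b (Complex \<rho> t)) \<le> 324 * \<rho> * exp (b * \<rho> + pi * beta_k k / (12 * \<rho>))"
proof -
  define z where "z = Complex \<rho> t"
  have z: "Re z > 0" "z \<noteq> 0" using \<rho> by (auto simp: z_def complex_eq_iff)
  define Q where "Q = exp (- (2 * of_real pi / (of_real (real (4*k+2)) * z)))"
  define y where "y = Re (1 / z)"
  define D where "D = \<rho>\<^sup>2 + t\<^sup>2"
  have "\<bar>t\<bar>\<^sup>2 \<le> (sqrt 3 * \<rho>)\<^sup>2" using t \<rho> by (intro power_mono) auto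
  then have D1: "D \<le> 4 * \<rho>\<^sup>2" by (simp add: D_def power_mult_distrib)
  have D0: "D \<ge> \<rho>\<^sup>2" by (simp add: D_def)
  have rr: "\<rho>\<^sup>2 > 0" using \<rho> by simp
  have yD: "y = \<rho> / D" by (simp add: y_def z_def Re_inverse_Complex D_def)
  have Dp: "D > 0" using D0 rr by linarith
  have "\<rho> / (4 * \<rho>\<^sup>2) \<le> y" unfolding yD using D1 Dp rr \<rho> by (intro divide_left_mono) auto
  then have y1: "1 / (4 * \<rho>) \<le> y" using \<rho> by (simp add: power2_eq_square)
  have "y \<le> \<rho> / \<rho>\<^sup>2" unfolding yD by (intro divide_left_mono[OF D0] mult_pos_pos Dp rr less_imp_le[OF \<rho>])
  then have y2: "y \<le> 1 / \<rho>" using \<rho> by (simp add: power2_eq_square)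
  define K where "K = real (2*k+1)"
  have K: "K > 0" by (simp add: K_def)
  have ReQ: "Re (2 * of_real pi / (of_real (real (4*k+2)) * z)) = pi / K * y"
  proof -
    have "real (4*k+2) = 2 * K" by (simp add: K_def)
    then have "2 * of_real pi / (of_real (real (4*k+2)) * z) = of_real (pi / K) * (1 / z)"
      using K by simp
    then show ?thesis by (simp only: Re_of_real_mult y_def)
  qed
  have nQ: "norm Q = exp (- (pi / K * y))" unfolding Q_def norm_exp_eq_Re uminus_complex.simps ReQ ..
  have "7/10 \<le> pi / K * (1 / (4 * \<rho>))" using small by (simp add: K_def mult_ac)
  also have "\<dots> \<le> pi / K * y" using y1 K by (intro mult_left_mono) auto
  finally have "norm Q \<le> exp (- (7/10))" unfolding nQ by simp
  also have "\<dots> \<le> 1/2"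
  proof -
    \<comment> \<open>0.7 is just above ln 2; four terms of the exponential series suffice to see
      it.\<close>
    have "1 + (7/10) + (7/10)\<^sup>2 / 2 + (7/10)^3 / 6 \<le> exp (7/10::real)"
    proof -
      have "(\<Sum>i<4. (7/10::real) ^ i /\<^sub>R fact i) \<le> exp (7/10)"
        unfolding exp_def by (rule sum_le_suminf[OF summable_exp_generic]) auto
      then show ?thesis by (simp add: eval_nat_numeral lessThan_Suc)
    qed
    moreover have "(2::real) \<le> 1 + (7/10) + (7/10)\<^sup>2 / 2 + (7/10)^3 / 6" by (simp add: eval_nat_numeral)
    ultimately have "2 \<le> exp (7/10::real)" by linarith
    then have "inverse (exp (7/10::real)) \<le> inverse 2" by (rule le_imp_inverse_le) simp
    then show ?thesis by (simp add: exp_minus)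
  qed
  finally have Qh: "norm Q \<le> 1/2" .
  have e: "exp (- (of_real (pi * (real k + 1) / 6) * z)) * exp (2 * of_real pi * of_nat n * z) = exp (of_real b * z)"
    unfolding exp_add[symmetric] b_def by (intro arg_cong[where f = exp]) (simp add: algebra_simps)
  have "u * z * v * w * t = (u * t) * z * v * w" for u v w t :: complex by (simp only: mult_ac)
  from this[of "exp (- (of_real (pi * (real k + 1) / 6) * z))" _ _ "exp (2 * of_real pi * of_nat n * z)", unfolded e]
  have "Delta_gf k (exp (- (2 * of_real pi * z))) * exp (2 * of_real pi * of_nat n * z) = exp (of_real b * z) * z * exp (of_real a / z) * dual_gf k Q"
    unfolding Delta_gf_transform[OF z(1)] Q_def a_def .
  then have "Delta_gf k (exp (- (2 * of_real pi * z))) * exp (2 * of_real pi * of_nat n * z) - bessel_kernel a b z =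
      bessel_kernel a b z * (dual_gf k Q - 1)"
    by (simp add: bessel_kernel_def exp_add algebra_simps)
  moreover have "norm (bessel_kernel a b z) = norm z * exp (b * \<rho> + a * y)"
  proof -
    have "Re (of_real a / z) = a * y" using Re_of_real_mult[of a "1 / z"] by (simp add: y_def del: Re_divide)
    moreover have "Re (of_real b * z) = b * \<rho>" by (simp add: z_def)
    ultimately show ?thesis unfolding bessel_kernel_def norm_mult norm_exp_eq_Re plus_complex.simps by simp
  qed
  ultimately have "norm (Delta_gf k (exp (- (2 * of_real pi * z))) * exp (2 * of_real pi * of_nat n * z) - bessel_kernel a b z)
      = norm z * exp (b * \<rho> + a * y) * norm (dual_gf k Q - 1)"
    by (simp add: norm_mult)
  also have "\<dots> \<le> (2 * \<rho>) * exp (b * \<rho> + a * y) * (162 * norm Q)"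
  proof (intro mult_mono dual_gf_near_1 k Qh)
    have "norm z = sqrt D" by (simp add: z_def D_def cmod_def)
    also have "\<dots> \<le> sqrt ((2 * \<rho>)\<^sup>2)" using D1 by (intro real_sqrt_le_mono) (simp add: power_mult_distrib)
    also have "\<dots> = 2 * \<rho>" using \<rho> by (simp only: real_sqrt_abs)
    finally show "norm z \<le> 2 * \<rho>" .
  qed (use \<rho> in auto)
  also have "\<dots> = 324 * \<rho> * exp (b * \<rho> + (a - pi / K) * y)"
    unfolding nQ by (simp add: exp_add[symmetric] exp_diff exp_minus field_simps)
  \<comment> \<open>The decay of |Q| lowers \<alpha> by 12/(2k+1), and 5k + 2 - 12 = 5k -
    10.\<close>
  also have "a - pi / K = pi * beta_k k / 12"
  proof -
    have K2: "2 * real k + 1 = K" by (simp add: K_def)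
    show ?thesis unfolding a_def alpha_k_def beta_k_def K2 using K by (simp add: field_simps)
  qed
  also have "324 * \<rho> * exp (b * \<rho> + pi * beta_k k / 12 * y) \<le> 324 * \<rho> * exp (b * \<rho> + pi * beta_k k / 12 * (1 / \<rho>))"
  proof -
    have "beta_k k \<ge> 0" using k by (simp add: beta_k_def)
    then have "pi * beta_k k / 12 * y \<le> pi * beta_k k / 12 * (1 / \<rho>)" using y2 by (intro mult_left_mono) auto
    then show ?thesis using \<rho> by (intro mult_left_mono) auto
  qed
  finally show ?thesis by (simp add: z_def)
qed

text \<open>The three terms belong to the left-over arc of the circle, to the major arc of length at
  most 7/2 \<rho> (324 times 7/2 is 1134), and to the two minor arcs of total length at most
  1.\<close>

theorem Delta_Mk_diff_le:
  fixes k n :: nat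
  assumes k: "k \<ge> 3" and n: "real n - (real k + 1) / 12 > 0" and \<rho>: "\<rho> > 0" "\<rho> \<le> 1/8"
    and small: "pi / (4 * real (2*k+1) * \<rho>) \<ge> 7/10"
  defines "a \<equiv> pi * alpha_k k / 12" and "b \<equiv> 2 * pi * (real n - (real k + 1) / 12)"
  shows "\<bar>Delta k n - Mk k n\<bar> \<le> 17 * \<rho>\<^sup>2 * exp (b * \<rho> + a / (4 * \<rho>)) + 1134 * \<rho>\<^sup>2 * exp (b * \<rho> + pi * beta_k k / (12 * \<rho>))
     + exp (2 * pi * real n * \<rho> + ((pi / 6 + 1 / (2 * pi)) * (1 / (4 * \<rho>) + 5 * \<rho>) + 1 / (4 * pi * real (2*k+1) * \<rho>)))"
proof -
  define h where "h = sqrt 3 * \<rho>"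
  have h: "0 < h" "h \<le> 1/2" "h \<le> (7/4) * \<rho>"
  proof -
    have "sqrt 3 \<le> sqrt ((7/4)\<^sup>2)" by (rule real_sqrt_le_mono) (simp add: power2_eq_square)
    then have s: "sqrt 3 \<le> (7/4)" by simp
    show "h \<le> (7/4) * \<rho>" unfolding h_def using s \<rho> by (intro mult_right_mono) auto
    then show "h \<le> 1/2" using \<rho> by linarith
    show "0 < h" using \<rho> by (simp add: h_def)
  qed
  define \<Phi> where "\<Phi> = (\<lambda>t. Delta_gf k (exp (- (2 * of_real pi * Complex \<rho> t))) * exp (2 * of_real pi * of_nat n * Complex \<rho> t))"
  define m where "m = exp (2 * pi * real n * \<rho> + ((pi / 6 + 1 / (2 * pi)) * (1 / (4 * \<rho>) + 5 * \<rho>) + 1 / (4 * pi * real (2*k+1) * \<rho>)))"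
  have tot: "(\<Phi> has_integral of_real (Delta k n)) {-(1/2)..1/2}"
    unfolding \<Phi>_def by (rule Delta_has_integral[OF \<rho>(1)])
  have int: "\<Phi> integrable_on {c..d}" if "-(1/2) \<le> c" "d \<le> 1/2" for c d
    by (rule integrable_subinterval_real[OF has_integral_integrable[OF tot]]) (use that in auto)
  have minor: "norm (\<Phi> t) \<le> m" if "h \<le> \<bar>t\<bar>" "\<bar>t\<bar> \<le> 1/2" for t
  proof -
    have "norm (\<Phi> t) = norm (Delta_gf k (exp (- (2 * of_real pi * Complex \<rho> t)))) * exp (2 * pi * real n * \<rho>)"
      by (simp add: \<Phi>_def norm_mult)
    also have "\<dots> \<le> exp ((pi / 6 + 1 / (2 * pi)) * (1 / (4 * \<rho>) + 5 * \<rho>) + 1 / (4 * pi * real (2*k+1) * \<rho>)) * exp (2 * pi * real n * \<rho>)"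
      using that \<rho> by (intro mult_right_mono norm_minor_arc_le) (auto simp: h_def)
    finally show ?thesis by (simp add: m_def exp_add mult_ac)
  qed
  obtain I1 I2 I3 where I: "(\<Phi> has_integral I1) {-(1/2)..-h}" "(\<Phi> has_integral I2) {-h..h}" "(\<Phi> has_integral I3) {h..1/2}"
    using int[of "-(1/2)" "-h"] int[of "-h" h] int[of h "1/2"] h by (auto simp: integrable_on_def)
  have "(\<Phi> has_integral (I1 + I2 + I3)) {-(1/2)..1/2}"
    using h by (intro has_integral_combine[OF _ _ has_integral_combine[OF _ _ I(1) I(2)] I(3)]) auto
  then have sum: "of_real (Delta k n) = I1 + I2 + I3" using tot has_integral_unique by blast
  have m0: "m \<ge> 0" by (simp add: m_def)
  have b1: "norm I1 \<le> m * (1/2)"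
  proof -
    have "norm I1 \<le> m * measure lborel {-(1/2)..-h}"
      by (rule has_integral_bound_real[OF m0 finite.emptyI I(1)]) (use h in \<open>auto intro!: minor\<close>)
    also have "\<dots> \<le> m * (1/2)" using h m0 by (intro mult_left_mono) auto
    finally show ?thesis .
  qed
  have b3: "norm I3 \<le> m * (1/2)"
  proof -
    have "norm I3 \<le> m * measure lborel {h..1/2}"
      by (rule has_integral_bound_real[OF m0 finite.emptyI I(3)]) (use h in \<open>auto intro!: minor\<close>)
    also have "\<dots> \<le> m * (1/2)" using h m0 by (intro mult_left_mono) auto
    finally show ?thesis .
  qed
  have ab: "a > 0" "b > 0" using n by (simp_all add: a_def b_def alpha_k_def add_nonneg_pos)
  obtain J where J: "((\<lambda>t. bessel_kernel a b (Complex \<rho> t)) has_integral J) {-h..h}"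
    "norm (J - contour_integral (circlepath 0 (2 * \<rho>)) (bessel_kernel a b) / \<i>) \<le> 17 * \<rho>\<^sup>2 * exp (b * \<rho> + a / (4 * \<rho>))"
    using bessel_kernel_chord[OF \<rho>(1) ab] unfolding h_def by blast
  have M: "contour_integral (circlepath 0 (2 * \<rho>)) (bessel_kernel a b) / \<i> = of_real (Mk k n)"
    unfolding a_def b_def by (rule Mk_eq_circlepath[OF n]) (use \<rho> in simp)
  define E where "E = 324 * \<rho> * exp (b * \<rho> + pi * beta_k k / (12 * \<rho>))"
  have E0: "E \<ge> 0" using \<rho> by (simp add: E_def)
  have b2: "norm (I2 - J) \<le> 1134 * \<rho>\<^sup>2 * exp (b * \<rho> + pi * beta_k k / (12 * \<rho>))"
  proof -
    have "norm (I2 - J) \<le> E * measure lborel {-h..h}"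
    proof (rule has_integral_bound_real[OF E0 finite.emptyI has_integral_diff[OF I(2) J(1)]])
      fix t assume "t \<in> {-h..h} - {}"
      then have "\<bar>t\<bar> \<le> sqrt 3 * \<rho>" by (auto simp: h_def)
      from major_arc_le[OF k \<rho>(1) this small, of n]
      show "norm (\<Phi> t - bessel_kernel a b (Complex \<rho> t)) \<le> E" unfolding \<Phi>_def E_def a_def b_def .
    qed
    also have "\<dots> \<le> E * (7/2 * \<rho>)" using h E0 by (intro mult_left_mono) auto
    finally show ?thesis by (simp add: E_def power2_eq_square)
  qed
  have "complex_of_real (Delta k n - Mk k n) = I1 + I3 + (I2 - J) + (J - of_real (Mk k n))"
    using sum by simp
  then have "\<bar>Delta k n - Mk k n\<bar> = norm (I1 + I3 + (I2 - J) + (J - of_real (Mk k n)))"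
    by (metis norm_of_real)
  also have "\<dots> \<le> norm I1 + norm I3 + norm (I2 - J) + norm (J - of_real (Mk k n))"
    by (intro norm_triangle_mono order_refl)
  finally show ?thesis using b1 b2 b3 J(2) unfolding M m_def by simp
qed


section \<open>Explicit constants\<close>

lemma xk_square:
  assumes "real n - (real k + 1) / 12 > 0"
  shows "(xk k n)\<^sup>2 = 2 * pi\<^sup>2 / 3 * (real n - (real k + 1) / 12)" "xk k n \<ge> 1/2"
proof -
  have p: "24 * real n - (2 * real k + 2) > 0" using assms by (simp add: field_simps)
  show "(xk k n)\<^sup>2 = 2 * pi\<^sup>2 / 3 * (real n - (real k + 1) / 12)"
    using p unfolding xk_def by (simp add: power_mult_distrib power_divide field_simps)
  \<comment> \<open>Integrality: a positive integer under the root is at least 1, so x >= pi/6. This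
    keeps x away from 0.\<close>
  have "2 * k + 2 < 24 * n" using p by (metis (mono_tags, lifting) diff_gt_0_iff_gt of_nat_1 of_nat_add of_nat_less_iff of_nat_mult of_nat_numeral one_add_one)
  then have "2 * k + 3 \<le> 24 * n" by simp
  then have "real (2 * k + 3) \<le> real (24 * n)" by (simp only: of_nat_le_iff)
  then have "1 \<le> sqrt (24 * real n - (2 * real k + 2))" by simp
  then have "pi * 1 / 6 \<le> xk k n" unfolding xk_def by (intro divide_right_mono mult_left_mono) auto
  then show "xk k n \<ge> 1/2" using pi_gt3 by simp
qed

text \<open>\<beta> increases with k from 5/7 at k = 3 towards 5/2.\<close>

lemma sqrt_beta_bounds:
  assumes "k \<ge> 3"
  shows "sqrt (beta_k k) \<ge> 0.84" "(sqrt (beta_k k))\<^sup>2 = beta_k k" "beta_k k \<ge> 5/7" "beta_k k \<le> 5/2" "sqrt (beta_k k) \<le> 1.59"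
proof -
  have k: "real k \<ge> 3" using assms by simp
  show b: "beta_k k \<ge> 5/7" unfolding beta_k_def using k by (simp add: field_simps)
  then show "(sqrt (beta_k k))\<^sup>2 = beta_k k" by simp
  show b2: "beta_k k \<le> 5/2" unfolding beta_k_def using k by (simp add: field_simps)
  have "sqrt (0.84\<^sup>2) \<le> sqrt (beta_k k)" using b by (intro real_sqrt_le_mono) (simp add: power2_eq_square)
  then show "sqrt (beta_k k) \<ge> 0.84" by simp
  have "sqrt (beta_k k) \<le> sqrt (1.59\<^sup>2)" using b2 by (intro real_sqrt_le_mono) (simp add: power2_eq_square)
  then show "sqrt (beta_k k) \<le> 1.59" by simp
qed

lemma powr_minus_three_halves: "x > 0 \<Longrightarrow> x powr (-3/2) = 1 / (x * sqrt x)"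
proof -
  assume x: "x > 0"
  have "x powr (-3/2) = x powr (- (1 + 1/2))" by simp
  also have "\<dots> = 1 / (x powr 1 * x powr (1/2))" unfolding powr_minus powr_add by (simp add: inverse_eq_divide)
  finally show ?thesis using x by (simp add: powr_half_sqrt)
qed

text \<open>Turns a saving of x/100 in an exponent into the power x^(-3/2). With y = x/100, the mean
  inequality gives y sqrt y <= 1 + y + y^2/2 <= exp y, and 1000 = 100^(3/2).\<close>

lemma exp_decay_le:
  fixes x :: real
  assumes x: "x > 0"
  shows "exp (- (x / 100)) \<le> 1000 * x powr (-3/2)"
proof -
  define y where "y = x / 100"
  have y: "y > 0" using x by (simp add: y_def)
  have "sqrt y * 1 \<le> (y + 1) / 2" using arith_geo_mean_sqrt[of y 1] y by simp
  then have "y * sqrt y \<le> y * ((y + 1) / 2)" using y by (intro mult_left_mono) auto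
  also have "\<dots> \<le> 1 + y + y\<^sup>2 / 2" using y by (simp add: field_simps power2_eq_square)
  also have "\<dots> \<le> exp y" using y by (intro exp_lower_Taylor_quadratic) auto
  finally have "y * sqrt y \<le> exp y" .
  moreover have "x * sqrt x = 1000 * (y * sqrt y)"
  proof -
    have "sqrt x = sqrt (10\<^sup>2 * y)" by (simp add: y_def)
    also have "\<dots> = 10 * sqrt y" by (simp add: real_sqrt_mult)
    finally show ?thesis by (simp add: y_def)
  qed
  ultimately have "x * sqrt x \<le> 1000 * exp y" by simp
  then have "1 / exp y \<le> 1000 / (x * sqrt x)" using x by (simp add: field_simps)
  then show ?thesis unfolding powr_minus_three_halves[OF x] y_def exp_minus by (simp add: inverse_eq_divide)
qed

lemma exp_ge_13: "x \<ge> 3 \<Longrightarrow> exp x \<ge> (13::real)"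
proof -
  assume "x \<ge> 3"
  have "(\<Sum>i<4. (3::real) ^ i /\<^sub>R fact i) \<le> exp 3"
    unfolding exp_def by (rule sum_le_suminf[OF summable_exp_generic]) auto
  then have "13 \<le> exp (3::real)" by (simp add: eval_nat_numeral lessThan_Suc)
  also have "\<dots> \<le> exp x" using \<open>x \<ge> 3\<close> by simp
  finally show ?thesis .
qed

lemma pi_sqrt_third_ge: "k \<ge> 3 \<Longrightarrow> pi * sqrt (real k / 3) \<ge> pi"
proof -
  assume "k \<ge> 3"
  then have "1 \<le> sqrt (real k / 3)" by simp
  then show ?thesis using mult_left_mono[of 1 "sqrt (real k / 3)" pi] by simp
qed

lemma pi_square_bounds: "9.86 \<le> pi\<^sup>2" "pi\<^sup>2 \<le> (9.87::real)"
proof -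
  have "(3.1415::real)\<^sup>2 \<le> pi\<^sup>2" using pi_approx by (intro power_mono) auto
  then show "9.86 \<le> pi\<^sup>2" by (simp add: power2_eq_square)
  have "pi\<^sup>2 \<le> (3.1416::real)\<^sup>2" using pi_approx by (intro power_mono) auto
  then show "pi\<^sup>2 \<le> (9.87::real)" by (simp add: power2_eq_square)
qed

text \<open>x >= 3k/2 makes \<rho> small enough for \<open>Delta_Mk_diff_le\<close>. The errors then
  share exp(s x) x^(-3/2) with the constant 1151 times 0.69 plus 3000, which is below 12 times 27
  times 13; here 27 and 13 are lower bounds for k^3 and exp(pi sqrt(k/3)).\<close>

theorem Delta_Mk_error_large_xk:
  fixes k n :: nat
  assumes k: "k \<ge> 3" and n: "real n - (real k + 1) / 12 > 0" and x: "xk k n \<ge> 3 * real k / 2"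
  shows "\<bar>Delta k n - Mk k n\<bar> \<le>
    12 * real k ^ 3 * exp (pi * sqrt (real k / 3)) * xk k n powr (-3/2) * exp (sqrt (beta_k k) * xk k n)"
proof -
  define x where "x = xk k n"
  define s where "s = sqrt (beta_k k)"
  define N where "N = real n - (real k + 1) / 12"
  define b where "b = 2 * pi * N"
  \<comment> \<open>The minimiser of b \<rho> + pi \<beta>/(12 \<rho>), where b = 3 x^2/pi; both
    terms are then s x/2.\<close>
  define \<rho> where "\<rho> = pi * s / (6 * x)"
  define K where "K = real k"
  define w where "w = x powr (-3/2)"
  have K: "K \<ge> 3" using k by (simp add: K_def)
  note sb = sqrt_beta_bounds[OF k, folded s_def]
  have xK: "x \<ge> 3 * K / 2" using assms(3) by (simp add: x_def K_def)
  have x1: "x \<ge> 4.5" using xK K by simp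
  have x0: "x > 0" using x1 by simp
  have s0: "s > 0" using sb(1) by simp
  have \<rho>0: "\<rho> > 0" using s0 x0 by (simp add: \<rho>_def)
  have xb: "x\<^sup>2 = pi * b / 3" using xk_square(1)[OF n] by (simp add: x_def b_def N_def power2_eq_square)
  have b: "b = 3 * x\<^sup>2 / pi" using xb by (simp add: field_simps)
  have b\<rho>: "b * \<rho> = s * x / 2" unfolding b \<rho>_def using x0 by (simp add: field_simps power2_eq_square)
  have inv\<rho>: "1 / \<rho> = 6 * x / (pi * s)" using x0 s0 by (simp add: \<rho>_def)
  have \<beta>\<rho>: "pi * beta_k k / (12 * \<rho>) = s * x / 2"
  proof -
    have "pi * beta_k k / (12 * \<rho>) = pi * s\<^sup>2 / 12 * (1 / \<rho>)" using sb(2) by simp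
    then show ?thesis unfolding inv\<rho> using s0 by (simp add: power2_eq_square field_simps)
  qed
  have \<rho>K: "\<rho> \<le> pi * s / (9 * K)"
    unfolding \<rho>_def using xK K s0 by (intro divide_left_mono) (auto intro!: mult_pos_pos)
  have bK: "beta_k k = (5 * K - 10) / (2 * K + 1)" by (simp add: beta_k_def K_def)
  have "\<rho> \<le> 1/8"
  proof -
    have "(8 * (pi * s))\<^sup>2 \<le> (9 * K)\<^sup>2"
    proof -
      have "(8 * (pi * s))\<^sup>2 = 64 * pi\<^sup>2 * beta_k k" using sb(2) by (simp add: power_mult_distrib)
      also have "\<dots> \<le> 64 * 9.87 * beta_k k" using pi_square_bounds sb by (intro mult_right_mono) auto
      also have "\<dots> \<le> 81 * K\<^sup>2"
      proof -
        obtain j where j: "K = 3 + j" "j \<ge> 0" using K by (metis add.commute diff_add_cancel diff_ge_0_iff_ge)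
        have "64 * 9.87 * (5 * K - 10) \<le> 81 * K\<^sup>2 * (2 * K + 1)"
          unfolding j(1) using j(2) by (simp add: power2_eq_square algebra_simps)
        moreover have "2 * K + 1 > 0" using K by simp
        ultimately show ?thesis unfolding bK times_divide_eq_right by (simp only: pos_divide_le_eq)
      qed
      finally show ?thesis by (simp add: power_mult_distrib)
    qed
    then have "8 * (pi * s) \<le> 9 * K" by (rule power2_le_imp_le) (use K in simp)
    then have "pi * s / (9 * K) \<le> 1/8" using K by (simp add: divide_le_eq)
    then show ?thesis using \<rho>K by simp
  qed
  note \<rho>8 = this
  \<comment> \<open>By x >= 3K/2 it is enough that 2.8 (2K+1) s <= 9K. Squared, with (2K+1) s^2 = 5K
    - 10, this is a quadratic inequality in K.\<close>
  have small: "pi / (4 * real (2*k+1) * \<rho>) \<ge> 7/10"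
  proof -
    have "(2.8 * ((2 * K + 1) * s))\<^sup>2 \<le> (9 * K)\<^sup>2"
    proof -
      have "(2.8 * ((2 * K + 1) * s))\<^sup>2 = 7.84 * (2 * K + 1)\<^sup>2 * beta_k k"
        using sb(2) by (simp add: power_mult_distrib power2_eq_square)
      also have "\<dots> = 7.84 * (2 * K + 1) * ((2 * K + 1) * beta_k k)" by (simp add: power2_eq_square)
      also have "\<dots> = 7.84 * (2 * K + 1) * (5 * K - 10)" unfolding bK using K by simp
      also have "\<dots> \<le> (9 * K)\<^sup>2" using K by (simp add: power2_eq_square algebra_simps)
      finally show ?thesis .
    qed
    then have "2.8 * ((2 * K + 1) * s) \<le> 9 * K" by (rule power2_le_imp_le) (use K in simp)
    also have "\<dots> \<le> 6 * x" using xK by simp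
    finally have "2.8 * ((2 * K + 1) * s) \<le> 6 * x" .
    moreover have "4 * (2 * K + 1) * s > 0" using K s0 by simp
    ultimately have "7/10 \<le> 6 * x / (4 * (2 * K + 1) * s)" by (subst pos_le_divide_eq) (simp_all add: algebra_simps)
    also have "\<dots> = pi / (4 * (2 * K + 1)) * (1 / \<rho>)" unfolding inv\<rho> by (simp add: field_simps)
    finally show ?thesis by (simp add: K_def algebra_simps)
  qed
  define e1 where "e1 = exp (s * x)"
  have t2: "exp (b * \<rho> + pi * beta_k k / (12 * \<rho>)) = e1" unfolding b\<rho> \<beta>\<rho> e1_def by simp
  have t1: "exp (b * \<rho> + pi * alpha_k k / 12 / (4 * \<rho>)) \<le> e1"
  proof -
    \<comment> \<open>Amounts to 15k >= 42, so it is exactly here that k = 2 would fail.\<close>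
    have "alpha_k k \<le> 4 * beta_k k" unfolding alpha_k_def beta_k_def using k by (simp add: divide_right_mono)
    then have "pi * alpha_k k / 12 / (4 * \<rho>) \<le> pi * (4 * beta_k k) / 12 / (4 * \<rho>)"
      using \<rho>0 by (intro divide_right_mono mult_left_mono) auto
    also have "\<dots> = s * x / 2" using \<beta>\<rho> by simp
    finally show ?thesis unfolding b\<rho> e1_def by simp
  qed
  have r2: "\<rho>\<^sup>2 \<le> 0.69 * w"
  proof -
    have sx: "sqrt x \<le> x" using x1 by (intro real_le_lsqrt) (auto simp: power2_eq_square)
    have "\<rho>\<^sup>2 = pi\<^sup>2 * beta_k k / 36 / (x * x)" using sb(2) by (simp add: \<rho>_def power_mult_distrib power_divide power2_eq_square)
    also have "\<dots> \<le> 0.69 / (x * x)"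
    proof (rule divide_right_mono)
      have "pi\<^sup>2 * beta_k k \<le> 9.87 * (5/2)" using pi_square_bounds sb by (intro mult_mono) auto
      then show "pi\<^sup>2 * beta_k k / 36 \<le> 0.69" by (simp add: mult.commute)
    qed simp
    also have "\<dots> \<le> 0.69 / (x * sqrt x)" using sx x0 by (intro divide_left_mono mult_left_mono) auto
    finally show ?thesis using powr_minus_three_halves[OF x0] by (simp add: w_def)
  qed
  have minor: "exp (2 * pi * real n * \<rho> + ((pi / 6 + 1 / (2 * pi)) * (1 / (4 * \<rho>) + 5 * \<rho>) + 1 / (4 * pi * real (2*k+1) * \<rho>))) \<le> 3000 * w * e1"
  proof -
    define B where "B = pi / 6 + 1 / (2 * pi)"
    have B: "0 \<le> B" "B \<le> 0.69"
    proof -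
      show "0 \<le> B" by (simp add: B_def)
      have "1 / (2 * pi) \<le> 1 / (2 * 3.14)" using pi_approx by (intro divide_left_mono) auto
      then show "B \<le> 0.69" using pi_approx by (simp add: B_def)
    qed
    have i1: "2 * pi * real n * \<rho> = s * x / 2 + pi * \<rho> * (K + 1) / 6"
    proof -
      have "2 * pi * real n * \<rho> = b * \<rho> + pi * \<rho> * (K + 1) / 6"
        by (simp add: b_def N_def K_def field_simps)
      then show ?thesis unfolding b\<rho> .
    qed
    \<comment> \<open>The shift of n by (k+1)/12 stays bounded in the exponent because \<rho> is of
      order 1/k.\<close>
    have i2: "pi * \<rho> * (K + 1) / 6 \<le> 2/5"
    proof -
      have "pi * \<rho> * (K + 1) / 6 \<le> pi * (pi * s / (9 * K)) * (K + 1) / 6"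
        using \<rho>K K by (intro divide_right_mono mult_right_mono mult_left_mono) auto
      also have "\<dots> = (pi\<^sup>2 * s) * ((K + 1) / K) / 54" by (simp add: power2_eq_square)
      also have "\<dots> \<le> (9.87 * 1.59) * (4/3) / 54"
        using pi_square_bounds sb s0 K by (intro divide_right_mono mult_mono) (auto simp: field_simps)
      finally show ?thesis by simp
    qed
    have i3: "B * (5 * \<rho>) \<le> 11/25"
    proof -
      have "B * (5 * \<rho>) \<le> 0.69 * (5 * (1/8))" using B \<rho>8 \<rho>0 by (intro mult_mono) auto
      then show ?thesis by simp
    qed
    \<comment> \<open>The narrowest estimate. With 1/\<rho> = 6x/(pi s) and 2K+1 >= 7 the left side
      is at most about 0.3477 x/s, against s^2/2 >= 5/14 = 0.357 on the right; the gap leaves room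
      for x/100.\<close>
    have i4: "B * (1 / (4 * \<rho>)) + 1 / (4 * pi * real (2*k+1) * \<rho>) \<le> s * x / 2 - x / 100"
    proof -
      have "1 / (4 * pi * real (2*k+1) * \<rho>) = 1 / (4 * pi * (2 * K + 1)) * (1 / \<rho>)" by (simp add: K_def)
      also have "\<dots> \<le> 1 / (4 * pi * 7) * (1 / \<rho>)"
        using K \<rho>0 by (intro mult_right_mono divide_left_mono mult_left_mono) auto
      finally have "B * (1 / (4 * \<rho>)) + 1 / (4 * pi * real (2*k+1) * \<rho>) \<le> (B / 4 + 1 / (4 * pi * 7)) * (1 / \<rho>)"
        by (simp add: algebra_simps)
      also have "\<dots> = (1/4 + 27/28 / pi\<^sup>2) * (x / s)"
        unfolding inv\<rho> B_def using s0 by (simp add: field_simps power2_eq_square)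
      also have "\<dots> \<le> 0.3479 * (x / s)"
      proof (rule mult_right_mono)
        have "27/28 / pi\<^sup>2 \<le> 27/28 / 9.86" using pi_square_bounds by (intro divide_left_mono) auto
        then show "1/4 + 27/28 / pi\<^sup>2 \<le> 0.3479" by simp
      qed (use x0 s0 in simp)
      also have "\<dots> \<le> (s\<^sup>2 / 2 - s / 100) * (x / s)"
      proof (rule mult_right_mono)
        have "0.84 * s \<le> s * s" using sb(1) s0 by (intro mult_right_mono) auto
        then have "21 * s \<le> 25 * s\<^sup>2" by (simp add: power2_eq_square)
        then have "s\<^sup>2 / 2 - s / 100 \<ge> s\<^sup>2 * (488/1000)" using zero_le_power2[of s] by linarith
        then show "0.3479 \<le> s\<^sup>2 / 2 - s / 100" using sb(2,3) by simp
      qed (use x0 s0 in simp)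
      also have "\<dots> = s * x / 2 - x / 100" using s0 by (simp add: field_simps power2_eq_square)
      finally show ?thesis .
    qed
    have "exp (2 * pi * real n * \<rho> + (B * (1 / (4 * \<rho>) + 5 * \<rho>) + 1 / (4 * pi * real (2*k+1) * \<rho>))) \<le> exp (1 + s * x + - (x / 100))"
      unfolding exp_le_cancel_iff distrib_left using i1 i2 i3 i4 by linarith
    also have "\<dots> = exp 1 * e1 * exp (- (x / 100))" by (simp only: exp_add e1_def)
    also have "\<dots> \<le> 3 * e1 * (1000 * w)"
      unfolding w_def using exp_le by (intro mult_mono exp_decay_le x0) (auto simp: e1_def)
    finally show ?thesis by (simp add: B_def mult_ac)
  qed
  have w0: "w \<ge> 0" by (simp add: w_def)
  have "\<bar>Delta k n - Mk k n\<bar> \<le> 17 * \<rho>\<^sup>2 * e1 + 1134 * \<rho>\<^sup>2 * e1 + 3000 * w * e1"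
  proof -
    note Delta_Mk_diff_le[OF k n \<rho>0 \<rho>8 small, folded N_def, folded b_def]
    also have "17 * \<rho>\<^sup>2 * exp (b * \<rho> + pi * alpha_k k / 12 / (4 * \<rho>)) \<le> 17 * \<rho>\<^sup>2 * e1"
      using t1 by (intro mult_left_mono) auto
    finally show ?thesis using minor unfolding t2 by simp
  qed
  also have "\<dots> = 1151 * (\<rho>\<^sup>2 * e1) + 3000 * (w * e1)" by simp
  also have "\<dots> \<le> 1151 * (0.69 * w * e1) + 3000 * (w * e1)"
    using r2 by (intro add_mono mult_left_mono mult_right_mono) (auto simp: e1_def)
  also have "\<dots> \<le> (12 * 27 * 13) * (w * e1)" using w0 by (simp add: e1_def)
  also have "\<dots> \<le> (12 * K ^ 3 * exp (pi * sqrt (K / 3))) * (w * e1)"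
  proof (rule mult_right_mono)
    have "27 \<le> K ^ 3" using power_mono[of 3 K 3] K by simp
    moreover have "13 \<le> exp (pi * sqrt (K / 3))"
      using pi_sqrt_third_ge[OF k] pi_gt3 unfolding K_def by (intro exp_ge_13) linarith
    ultimately show "12 * 27 * 13 \<le> 12 * K ^ 3 * exp (pi * sqrt (K / 3))"
      using mult_mono[of 27 "K ^ 3" 13 "exp (pi * sqrt (K / 3))"] K by simp
  qed (simp add: w_def e1_def)
  finally show ?thesis by (simp add: K_def w_def e1_def s_def x_def mult_ac)
qed

section \<open>Trivial bounds for small arguments\<close>

lemma Bessel_I2_bounds:
  assumes y: "y \<ge> 0"
  shows "0 \<le> Bessel_I2 y" "Bessel_I2 y \<le> exp y"
proof -
  define T where "T = (\<lambda>j. (y / 2) ^ (2 * j + 2) / (fact j * fact (j + 2)))"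
  have T0: "T j \<ge> 0" for j using y by (simp add: T_def)
  \<comment> \<open>A binomial coefficient below 2^(2j+2) compares each term with the term of degree
    2j+2 of the exponential series.\<close>
  have Tle: "T j \<le> y ^ (2 * j + 2) /\<^sub>R fact (2 * j + 2)" for j
  proof -
    have "(2 * j + 2 choose j) \<le> 2 ^ (2 * j + 2)" by (rule binomial_le_pow2)
    then have "real (2 * j + 2 choose j) \<le> real (2 ^ (2 * j + 2))" by (simp only: of_nat_le_iff)
    then have c: "real (2 * j + 2 choose j) \<le> 2 ^ (2 * j + 2)" by (simp only: of_nat_power of_nat_numeral)
    have "(fact (2 * j + 2) :: real) = fact j * fact (j + 2) * real (2 * j + 2 choose j)"
    proof -
      have "fact j * fact (2 * j + 2 - j) * (2 * j + 2 choose j) = fact (2 * j + 2)"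
        by (rule binomial_fact_lemma) simp
      moreover have "2 * j + 2 - j = j + 2" by simp
      ultimately have "real (fact j * fact (j + 2) * (2 * j + 2 choose j)) = real (fact (2 * j + 2))" by (simp only:)
      then show ?thesis by (simp only: of_nat_mult of_nat_fact)
    qed
    also have "\<dots> \<le> fact j * fact (j + 2) * 2 ^ (2 * j + 2)" using c by (intro mult_left_mono) auto
    finally have "fact (2 * j + 2) \<le> fact j * fact (j + 2) * (2::real) ^ (2 * j + 2)" .
    then have "fact (2 * j + 2) \<le> (2::real) ^ (2 * j + 2) * (fact j * fact (j + 2))" by (simp only: mult.commute)
    then have "y ^ (2 * j + 2) / (2 ^ (2 * j + 2) * (fact j * fact (j + 2))) \<le> y ^ (2 * j + 2) / fact (2 * j + 2)"
      by (rule divide_left_mono) (use y in \<open>auto simp del: fact_Suc power_Suc\<close>)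
    moreover have "T j = y ^ (2 * j + 2) / (2 ^ (2 * j + 2) * (fact j * fact (j + 2)))"
      by (simp only: T_def power_divide divide_divide_eq_left)
    moreover have "y ^ (2 * j + 2) /\<^sub>R fact (2 * j + 2) = y ^ (2 * j + 2) / fact (2 * j + 2)"
      by (simp only: real_scaleR_def divide_inverse mult.commute)
    ultimately show ?thesis by (simp only:)
  qed
  have S: "summable (\<lambda>i. y ^ i /\<^sub>R fact i)" by (rule summable_exp_generic)
  have e0: "0 \<le> y ^ i /\<^sub>R fact i" for i using y by simp
  have part: "(\<Sum>j<n. T j) \<le> exp y" for n
  proof -
    have "(\<Sum>j<n. T j) \<le> (\<Sum>j<n. y ^ (2 * j + 2) /\<^sub>R fact (2 * j + 2))" by (intro sum_mono Tle)
    also have "\<dots> = (\<Sum>i\<in>(\<lambda>j. 2 * j + 2) ` {..<n}. y ^ i /\<^sub>R fact i)"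
      by (subst sum.reindex) (simp_all only: inj_on_def o_def, simp)
    also have "\<dots> \<le> exp y" unfolding exp_def by (rule sum_le_suminf[OF S _ e0]) simp
    finally show ?thesis .
  qed
  have sT: "summable T" by (rule summableI_nonneg_bounded[OF T0 part])
  show "0 \<le> Bessel_I2 y" unfolding Bessel_I2_def T_def[symmetric] by (rule suminf_nonneg[OF sT T0])
  show "Bessel_I2 y \<le> exp y" unfolding Bessel_I2_def by (rule suminf_le_const[OF sT[unfolded T_def] part[unfolded T_def]])
qed

lemma Delta_trivial_bound:
  assumes \<sigma>: "\<sigma> > 0"
  shows "\<bar>Delta k n\<bar> \<le> exp (5 * pi\<^sup>2 / (12 * \<sigma>) + 1 / (2 * real (2*k+1) * \<sigma>) + real n * \<sigma>)"
proof -
  define \<rho> where "\<rho> = \<sigma> / (2 * pi)"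
  have \<rho>: "\<rho> > 0" "2 * pi * \<rho> = \<sigma>" using \<sigma> by (simp_all add: \<rho>_def)
  define m where "m = exp (5 * pi\<^sup>2 / (12 * \<sigma>) + 1 / (2 * real (2*k+1) * \<sigma>) + real n * \<sigma>)"
  have m0: "m \<ge> 0" by (simp add: m_def)
  have "norm (complex_of_real (Delta k n)) \<le> m * measure lborel {-(1/2)..1/2::real}"
  proof (rule has_integral_bound_real[OF m0 finite.emptyI Delta_has_integral[OF \<rho>(1)]])
    fix t :: real
    have nq: "norm (exp (- (2 * of_real pi * Complex \<rho> t))) = exp (- \<sigma>)" using \<rho>(2) by simp
    have nE: "norm (exp (2 * of_real pi * of_nat n * Complex \<rho> t)) = exp (real n * \<sigma>)"
      using \<rho>(2) by (simp add: mult_ac flip: \<rho>(2))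
    have "norm (Delta_gf k (exp (- (2 * of_real pi * Complex \<rho> t))) * exp (2 * of_real pi * of_nat n * Complex \<rho> t))
      \<le> exp (5 * pi\<^sup>2 / (12 * \<sigma>) + 1 / (2 * real (2*k+1) * \<sigma>)) * exp (real n * \<sigma>)"
      unfolding norm_mult nE by (intro mult_right_mono norm_Delta_gf_trivial[OF \<sigma> nq]) simp
    then show "norm (Delta_gf k (exp (- (2 * of_real pi * Complex \<rho> t))) * exp (2 * of_real pi * of_nat n * Complex \<rho> t)) \<le> m"
      by (simp only: m_def exp_add)
  qed
  then show ?thesis by (simp add: m_def)
qed

text \<open>r collects both reciprocal terms of the trivial bound: since pi^2 >= 9, with R = 2k+1
  the term 1/(2R \<sigma>) is at most pi^2/(18 R \<sigma>), and the sum becomes pi^2 r^2/(6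
  \<sigma>).\<close>

lemma Delta_saddle_bound:
  assumes n: "real n \<le> 3 * Y\<^sup>2 / (2 * pi\<^sup>2)" and Y: "Y > 0"
  shows "\<bar>Delta k n\<bar> \<le> exp (sqrt (5/2 + 1 / (3 * real (2*k+1))) * Y)"
proof -
  define r where "r = sqrt (5/2 + 1 / (3 * real (2*k+1)))"
  have r2: "r\<^sup>2 = 5/2 + 1 / (3 * real (2*k+1))" unfolding r_def by (rule real_sqrt_pow2) simp
  have r: "r > 0" unfolding r_def by (simp add: add_pos_nonneg)
  \<comment> \<open>Chosen to balance pi^2 r^2/(6 \<sigma>) against 3 Y^2 \<sigma>/(2 pi^2); each is
    r Y/2.\<close>
  define \<sigma> where "\<sigma> = pi\<^sup>2 * r / (3 * Y)"
  have \<sigma>: "\<sigma> > 0" using r Y by (simp add: \<sigma>_def)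
  have "real n * \<sigma> \<le> 3 * Y\<^sup>2 / (2 * pi\<^sup>2) * \<sigma>" using n \<sigma> by (intro mult_right_mono) auto
  also have "\<dots> = r * Y / 2" unfolding \<sigma>_def using Y by (simp add: power2_eq_square)
  finally have 1: "real n * \<sigma> \<le> r * Y / 2" .
  define R where "R = real (2*k+1)"
  have R: "R > 0" by (simp add: R_def)
  have "1 / (2 * R * \<sigma>) = (3 / pi\<^sup>2) * (pi\<^sup>2 / (6 * R * \<sigma>))" using \<sigma> R by simp
  also have "\<dots> \<le> (1/3) * (pi\<^sup>2 / (6 * R * \<sigma>))"
  proof (rule mult_right_mono)
    have "3 / pi\<^sup>2 \<le> 3 / 9" using pi_square_bounds(1) by (intro divide_left_mono) auto
    then show "3 / pi\<^sup>2 \<le> 1/3" by simp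
  qed (use \<sigma> R in simp)
  finally have "5 * pi\<^sup>2 / (12 * \<sigma>) + 1 / (2 * R * \<sigma>) \<le> 5 * pi\<^sup>2 / (12 * \<sigma>) + (1/3) * (pi\<^sup>2 / (6 * R * \<sigma>))" by simp
  also have "\<dots> = pi\<^sup>2 / (6 * \<sigma>) * r\<^sup>2" unfolding r2 R_def[symmetric] using \<sigma> R by (simp add: distrib_left mult_ac)
  also have "\<dots> = r * Y / 2" unfolding \<sigma>_def using r Y by (simp add: power2_eq_square)
  finally have 2: "5 * pi\<^sup>2 / (12 * \<sigma>) + 1 / (2 * real (2*k+1) * \<sigma>) \<le> r * Y / 2" unfolding R_def .
  have "\<bar>Delta k n\<bar> \<le> exp (5 * pi\<^sup>2 / (12 * \<sigma>) + 1 / (2 * real (2*k+1) * \<sigma>) + real n * \<sigma>)"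
    by (rule Delta_trivial_bound[OF \<sigma>])
  also have "\<dots> \<le> exp (r * Y)" unfolding exp_le_cancel_iff using 1 2 by linarith
  finally show ?thesis by (simp add: r_def)
qed

text \<open>\<open>Delta\<close> and \<open>Mk\<close> are bounded separately, with the shares 10
  and 2 of the constant 12.\<close>

theorem Delta_Mk_error_small_xk:
  fixes k n :: nat
  assumes k: "k \<ge> 3" and n: "real n - (real k + 1) / 12 > 0" and small: "xk k n \<le> 3 * real k / 2"
  shows "\<bar>Delta k n - Mk k n\<bar> \<le>
    12 * real k ^ 3 * exp (pi * sqrt (real k / 3)) * xk k n powr (-3/2) * exp (sqrt (beta_k k) * xk k n)"
proof -
  define x where "x = xk k n"
  define s where "s = sqrt (beta_k k)"
  define K where "K = real k"
  define w where "w = x powr (-3/2)"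
  define P where "P = pi * sqrt (K / 3)"
  define e1 where "e1 = exp (s * x)"
  have K: "K \<ge> 3" using k by (simp add: K_def)
  note sb = sqrt_beta_bounds[OF k, folded s_def]
  have xK: "x \<le> 3 * K / 2" using small by (simp add: x_def K_def)
  have x1: "x \<ge> 1/2" using xk_square(2)[OF n] by (simp add: x_def)
  have x0: "x > 0" using x1 by simp
  have w: "w = 1 / (x * sqrt x)" unfolding w_def by (rule powr_minus_three_halves[OF x0])
  have w0: "w > 0" unfolding w using x0 by simp
  have "pi \<ge> 25/8" using pi_approx by simp
  then have P3: "P \<ge> 25/8" using pi_sqrt_third_ge[OF k] unfolding P_def K_def by linarith
  have K3: "27 \<le> K ^ 3" using power_mono[of 3 K 3] K by simp
  have bK: "beta_k k = (5 * K - 10) / (2 * K + 1)" by (simp add: beta_k_def K_def)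
  have D: "\<bar>Delta k n\<bar> \<le> 10 * K ^ 3 * exp P * w * e1"
  proof -
    define r where "r = sqrt (5/2 + 1 / (3 * real (2*k+1)))"
    have r2: "r\<^sup>2 = 5/2 + 1 / (3 * (2 * K + 1))" unfolding r_def K_def by (subst real_sqrt_pow2) auto
    have r58: "r \<ge> 1.58"
    proof -
      have "sqrt (1.58\<^sup>2) \<le> r" unfolding r_def by (intro real_sqrt_le_mono) (simp add: power2_eq_square add_increasing2)
      then show ?thesis by simp
    qed
    \<comment> \<open>c undoes the shift in the definition of x: 3 c^2/(2 pi^2) = (k+1)/12, so n = 3
      (x^2 + c^2)/(2 pi^2), and x^2 + c^2 <= (x + c)^2.\<close>
    define c where "c = pi * sqrt ((K + 1) / 18)"
    define Y where "Y = x + c"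
    have c0: "c \<ge> 0" using K by (simp add: c_def)
    have Y0: "Y > 0" using x0 c0 by (simp add: Y_def)
    have "real n \<le> 3 * Y\<^sup>2 / (2 * pi\<^sup>2)"
    proof -
      have c2: "c\<^sup>2 = pi\<^sup>2 * ((K + 1) / 18)" using K by (simp add: c_def power_mult_distrib)
      have "real n = 3 * (x\<^sup>2 + c\<^sup>2) / (2 * pi\<^sup>2)"
        unfolding c2 x_def xk_square(1)[OF n] K_def by (simp add: field_simps)
      also have "\<dots> \<le> 3 * Y\<^sup>2 / (2 * pi\<^sup>2)"
        using x0 c0 by (intro divide_right_mono mult_left_mono) (auto simp: Y_def power2_sum)
      finally show ?thesis .
    qed
    from Delta_saddle_bound[OF this Y0, of k] have D1: "\<bar>Delta k n\<bar> \<le> exp (r * Y)" by (simp only: r_def)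
    \<comment> \<open>r^2 - s^2 is of order 1/k and x of order k, so the product is bounded after
      division by r + s >= 2.42.\<close>
    have "(r - s) * x \<le> 4"
    proof -
      have "(r - s) * (r + s) = r\<^sup>2 - s\<^sup>2" by (simp add: algebra_simps power2_eq_square)
      also have "\<dots> = 77 / (6 * (2 * K + 1))" unfolding r2 sb(2) bK using K by (simp add: divide_simps) (simp add: algebra_simps)
      finally have rs: "(r - s) * (r + s) = 77 / (6 * (2 * K + 1))" .
      have rs0: "r + s \<ge> 2.42" using r58 sb(1) by simp
      have "(r - s) * (r + s) * x \<le> 77 / (6 * (2 * K + 1)) * (3 * K / 2)"
        unfolding rs using xK K by (intro mult_left_mono) auto
      also have "\<dots> \<le> 9.68" using K by (simp add: divide_simps)
      also have "\<dots> \<le> 4 * (r + s)" using rs0 by simp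
      finally have "((r - s) * x) * (r + s) \<le> 4 * (r + s)" by (simp add: mult_ac)
      then show ?thesis using rs0 by (subst (asm) mult_le_cancel_right_pos) auto
    qed
    \<comment> \<open>The ratio of r c to P is about 0.753 at k = 3 and smaller beyond. The spare
      0.24 P, with P >= 25/8, is at least 3/4 and reduces the constant 4 to 13/4.\<close>
    moreover have "r * c \<le> 0.76 * P"
    proof -
      have "(r * c)\<^sup>2 \<le> (0.76 * P)\<^sup>2"
      proof -
        have "r\<^sup>2 \<le> 5/2 + 1/21"
          unfolding r2 using K by (intro add_left_mono divide_left_mono) auto
        moreover have "(K + 1) / 18 \<le> 4 * K / 54" using K by simp
        ultimately have "r\<^sup>2 * ((K + 1) / 18) \<le> (5/2 + 1/21) * (4 * K / 54)" using K by (intro mult_mono) auto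
        also have "\<dots> \<le> 0.76\<^sup>2 * (K / 3)" using K by (simp add: power2_eq_square)
        finally have "pi\<^sup>2 * (r\<^sup>2 * ((K + 1) / 18)) \<le> pi\<^sup>2 * (0.76\<^sup>2 * (K / 3))" by (intro mult_left_mono) auto
        moreover have "(r * c)\<^sup>2 = pi\<^sup>2 * (r\<^sup>2 * ((K + 1) / 18))" using K by (simp add: c_def power_mult_distrib)
        moreover have "(0.76 * P)\<^sup>2 = pi\<^sup>2 * (0.76\<^sup>2 * (K / 3))" using K by (simp add: P_def power_mult_distrib power_divide)
        ultimately show ?thesis by (simp only:)
      qed
      then show ?thesis by (rule power2_le_imp_le) (use P3 in simp)
    qed
    moreover have "r * Y = s * x + (r - s) * x + r * c" by (simp add: Y_def algebra_simps)
    ultimately have "r * Y \<le> s * x + 13/4 + P" using P3 by simp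
    then have "exp (r * Y) \<le> e1 * exp (13/4) * exp P" unfolding e1_def exp_add[symmetric] by simp
    also have "\<dots> \<le> e1 * (10 * K ^ 3 * w) * exp P"
    proof -
      have e28: "exp (13/4 :: real) \<le> 28"
      proof -
        have "exp (13/4 :: real) ^ 4 = exp 1 ^ 13" by (simp flip: exp_of_nat_mult)
        also have "\<dots> \<le> (2.72::real) ^ 13" using e_less_272 by (intro power_mono) auto
        also have "\<dots> \<le> 28 ^ 4" by (simp add: power_divide)
        finally show ?thesis by (rule power_le_imp_le_base[of _ 3, simplified]) simp
      qed
      \<comment> \<open>x <= 3K/2 and sqrt x <= K^2/4.2 give at most K^3/2.8; the second bound rests
        on 17.64 times 3/2 <= 27 <= K^3.\<close>
      have "28 * (x * sqrt x) \<le> 10 * K ^ 3"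
      proof -
        have "sqrt x \<le> K\<^sup>2 / 4.2"
        proof (rule real_le_lsqrt)
          have "17.64 * (3 * K / 2) \<le> K ^ 3 * K" using mult_right_mono[OF K3, of K] K by simp
          then have "3 * K / 2 \<le> (K\<^sup>2 / 4.2)\<^sup>2" by (simp add: power_divide power2_eq_square power3_eq_cube)
          then show "x \<le> (K\<^sup>2 / 4.2)\<^sup>2" using xK by simp
        qed (use x0 in auto)
        then have "x * sqrt x \<le> (3 * K / 2) * (K\<^sup>2 / 4.2)" using xK x0 K by (intro mult_mono) auto
        then show ?thesis by (simp add: power2_eq_square power3_eq_cube)
      qed
      then have "28 \<le> 10 * K ^ 3 * w" unfolding w using x0 by (simp add: field_simps)
      then have "exp (13/4) \<le> 10 * K ^ 3 * w" using e28 by linarith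
      then show ?thesis by (intro mult_right_mono mult_left_mono) (auto simp: e1_def)
    qed
    finally show ?thesis using D1 by (simp add: mult_ac)
  qed
  have M: "\<bar>Mk k n\<bar> \<le> 2 * K ^ 3 * exp P * w * e1"
  proof -
    define q where "q = sqrt (alpha_k k)"
    have al: "alpha_k k = (5 * K + 2) / (2 * K + 1)" by (simp add: alpha_k_def K_def)
    have al1: "alpha_k k \<ge> 17/7" "alpha_k k \<le> 5/2" unfolding al using K by (simp_all add: divide_simps)
    have q2: "q\<^sup>2 = alpha_k k" using al1 by (simp add: q_def)
    have q155: "q \<ge> 1.55"
    proof -
      have "sqrt (1.55\<^sup>2) \<le> q" unfolding q_def using al1 by (intro real_sqrt_le_mono) (simp add: power2_eq_square)
      then show ?thesis by simp
    qed
    have qs: "(q - s) * x \<le> 4"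
    proof -
      have "(q - s) * (q + s) = q\<^sup>2 - s\<^sup>2" by (simp add: algebra_simps power2_eq_square)
      also have "\<dots> = 12 / (2 * K + 1)" unfolding q2 sb(2) bK al using K by (simp add: divide_simps)
      finally have rs: "(q - s) * (q + s) = 12 / (2 * K + 1)" .
      have rs0: "q + s \<ge> 2.39" using q155 sb(1) by simp
      have "(q - s) * (q + s) * x \<le> 12 / (2 * K + 1) * (3 * K / 2)"
        unfolding rs using xK K by (intro mult_left_mono) auto
      also have "\<dots> \<le> 9" using K by (simp add: divide_simps)
      also have "\<dots> \<le> 4 * (q + s)" using rs0 by simp
      finally have "((q - s) * x) * (q + s) \<le> 4 * (q + s)" by (simp add: mult_ac)
      then show ?thesis using rs0 by (subst (asm) mult_le_cancel_right_pos) auto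
    qed
    have "pi ^ 3 * alpha_k k / (18 * x\<^sup>2) \<le> 6.4 * w"
    proof -
      have "pi ^ 3 \<le> 3.1416 ^ 3" using pi_approx by (intro power_mono) auto
      then have "pi ^ 3 * alpha_k k \<le> 31.1 * (5/2)" using al1 by (intro mult_mono) (auto simp: power3_eq_cube)
      then have 1: "pi ^ 3 * alpha_k k / (18 * x\<^sup>2) \<le> 31.1 * (5/2) / (18 * x\<^sup>2)" by (intro divide_right_mono) auto
      \<comment> \<open>x >= 1/2 lets the x^(-2) of \<open>Mk\<close> be replaced by x^(-3/2) at the
        price of a constant.\<close>
      have "0.7 \<le> sqrt x" using x1 by (intro real_le_rsqrt) (simp add: power2_eq_square)
      then have "0.7 * sqrt x \<le> sqrt x * sqrt x" using x0 by (intro mult_right_mono) auto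
      then have "0.7 * sqrt x \<le> x" using x0 by simp
      then have "x * (0.7 * sqrt x) \<le> x * x" using x0 by (intro mult_left_mono) auto
      then have "31.1 * (5/2) / (18 * x\<^sup>2) \<le> 31.1 * (5/2) / (18 * (x * (0.7 * sqrt x)))"
        using x0 by (intro divide_left_mono mult_left_mono) (auto simp: power2_eq_square)
      also have "\<dots> \<le> 6.4 * w" unfolding w using x0 by (simp add: field_simps)
      finally show ?thesis using 1 by simp
    qed
    moreover have "Bessel_I2 (q * x) \<le> e1 * 55"
    proof -
      have "Bessel_I2 (q * x) \<le> exp (q * x)" using q155 x0 by (intro Bessel_I2_bounds) auto
      also have "\<dots> \<le> e1 * exp 4" unfolding e1_def exp_add[symmetric] using qs by (simp add: algebra_simps)
      also have "exp (4::real) \<le> 55"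
      proof -
        have "exp (4::real) = exp 1 ^ 4" by (simp flip: exp_of_nat_mult)
        also have "\<dots> \<le> (2.72::real) ^ 4" using e_less_272 by (intro power_mono) auto
        also have "\<dots> \<le> 55" by (simp add: power_divide)
        finally show ?thesis .
      qed
      finally show ?thesis by (simp add: e1_def)
    qed
    moreover have "0 \<le> Bessel_I2 (q * x)" using q155 x0 by (intro Bessel_I2_bounds) auto
    moreover have "0 \<le> pi ^ 3 * alpha_k k / (18 * x\<^sup>2)" using al1 by simp
    moreover have "Mk k n = pi ^ 3 * alpha_k k / (18 * x\<^sup>2) * Bessel_I2 (q * x)" by (simp add: Mk_def q_def x_def)
    ultimately have "\<bar>Mk k n\<bar> \<le> (6.4 * w) * (e1 * 55)"
      using w0 by (simp only: abs_mult abs_of_nonneg) (intro mult_mono, auto)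
    also have "\<dots> = 352 * (w * e1)" by simp
    also have "\<dots> \<le> (2 * K ^ 3 * exp P) * (w * e1)"
    proof (rule mult_right_mono)
      have "13 \<le> exp P" using P3 by (intro exp_ge_13) simp
      then show "352 \<le> 2 * K ^ 3 * exp P" using mult_mono[OF K3, of 13 "exp P"] K by (simp add: mult_ac)
    qed (use w0 in \<open>simp add: e1_def\<close>)
    finally show ?thesis by (simp add: mult_ac)
  qed
  have "\<bar>Delta k n - Mk k n\<bar> \<le> \<bar>Delta k n\<bar> + \<bar>Mk k n\<bar>" by simp
  also have "\<dots> \<le> 12 * K ^ 3 * exp P * w * e1" using D M by simp
  finally show ?thesis by (simp add: K_def P_def w_def e1_def s_def x_def)
qed

theorem theorem1p2:
  fixes k n :: nat
  assumes "k \<ge> 3" and "real n - (real k + 1) / 12 > 0"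
  shows "\<bar>Delta k n - Mk k n\<bar> \<le>
    12 * real k ^ 3 * exp (pi * sqrt (real k / 3)) * xk k n powr (-3/2)
      * exp (sqrt (beta_k k) * xk k n)"
  using Delta_Mk_error_large_xk[OF assms] Delta_Mk_error_small_xk[OF assms] by (cases "xk k n \<ge> 3 * real k / 2") auto

end
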